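(* Let $\Bbbk$ be a field, let $\mathscr{P}$ be a finite graded poset and let $t\in\mathscr{P}$ be a maximal element. Let $A$ and $B$ denote the incidence algebras over $\Bbbk$ of $\mathscr{P}$ and $\mathscr{Q}:=\mathscr{P}\setminus\{t\}$, respectively, and let $R=\sum_{x\in\mathscr{P}}\Bbbk e_{x,x}$ and $S=\sum_{x\in\mathscr{Q}}\Bbbk e_{x,x}$. If the set $\mathscr{F}$ of all predecessors of $t$ in $\mathscr{P}$ satisfies the condition $(\dagger)$, then $A$ is a Koszul $R$-ring if and only if $B$ is a Koszul $S$-ring.
   Context: Posets. In a poset, $x$ is a predecessor of $y$ (and $y$ a successor of $x$) if $x<y$ and there is no $z$ with $x<z<y$. A finite poset is graded if for every interval $[x,y]=\{z\mid x\le z\le y\}$ all maximal chains $x=x_0<x_1<\dots<x_l=y$ (each $x_i$ a predecessor of $x_{i+1}$) have the same length $l$, denoted $l([x,y])$. Subsets of posets carry the induced order. Condition $(\dagger)$. A set $\mathscr{F}$ satisfies $(\dagger)$ if either $\mathscr{F}$ is a singleton, or there is a common predecessor $s$ of all elements of $\mathscr{F}$ such that $s=\inf\{u,v\}$ for every two distinct elements $u,v\in\mathscr{F}$. Incidence rings. The incidence algebra $\Bbbk^a[\mathscr{P}]$ of a finite poset $\mathscr{P}$ has $\Bbbk$-basis $\{e_{x,y}\mid x\le y\}$ and product $e_{x,y}e_{z,u}=\delta_{y,z}e_{x,u}$. If $\mathscr{P}$ is graded, it is a connected $R$-ring with $R=\sum_{x}\Bbbk e_{x,x}$, the component of degree $p$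 being spanned by the $e_{x,y}$ with $l([x,y])=p$. Koszul rings. For a semisimple ring $R$, a connected $R$-ring is an $\mathbb{N}$-graded algebra $A=\bigoplus_{n\ge0} A_n$ in the category of $R$-bimodules with $A_0=R$; it is strongly graded if all multiplication maps $A_p\otimes_R A_q\to A_{p+q}$ are surjective. A connected strongly graded $R$-ring $A$ is Koszul if there is a resolution $P_\ast$ of $R=A/A_+$ (where $A_+=\bigoplus_{n>0}A_n$) by projective graded left $A$-modules such that each $P_n$ is generated by its component of degree $n$. *)

theory Defs
  imports "HOL-Algebra.Subrings" "HOL-Algebra.QuotRing" "HOL-Algebra.Generated_Groups"
begin

section \<open>Finite posets\<close>

text \<open>
  A poset is a set \<open>P\<close> with a relation \<open>r\<close> such that \<^term>\<open>partial_order_on P r\<close>;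
  \<open>(x, y) \<in> r\<close> means \<open>x \<le> y\<close>. A subset \<open>Q\<close> carries the induced order \<^term>\<open>Restr r Q\<close>.
\<close>

text \<open>\<open>(x, y) \<in> covering r\<close> means that \<open>x\<close> is a predecessor of \<open>y\<close>.\<close>

definition covering :: "'a rel \<Rightarrow> 'a rel" where
  "covering r = {(x, y). (x, y) \<in> r \<and> x \<noteq> y \<and>
     \<not> (\<exists>z. (x, z) \<in> r \<and> x \<noteq> z \<and> (z, y) \<in> r \<and> z \<noteq> y)}"

text \<open>
  A maximal chain of length \<open>l\<close> in the interval \<open>[x, y]\<close> is a path of \<open>l\<close> covering steps from \<open>x\<close>
  to \<open>y\<close>, so such a chain exists if and only if \<open>(x, y) \<in> covering r ^^ l\<close>.
\<close>

definition graded_poset :: "'a set \<Rightarrow> 'a rel \<Rightarrow> bool" where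
  "graded_poset P r \<longleftrightarrow> finite P \<and> partial_order_on P r \<and>
     (\<forall>(x, y) \<in> r. \<forall>l m. (x, y) \<in> covering r ^^ l \<longrightarrow> (x, y) \<in> covering r ^^ m \<longrightarrow> l = m)"

definition interval_length :: "'a rel \<Rightarrow> 'a \<Rightarrow> 'a \<Rightarrow> nat" where
  "interval_length r x y = (THE l. (x, y) \<in> covering r ^^ l)"

definition maximal_in :: "'a set \<Rightarrow> 'a rel \<Rightarrow> 'a \<Rightarrow> bool" where
  "maximal_in P r t \<longleftrightarrow> t \<in> P \<and> (\<forall>x \<in> P. (t, x) \<in> r \<longrightarrow> x = t)"

definition is_infimum :: "'a set \<Rightarrow> 'a rel \<Rightarrow> 'a \<Rightarrow> 'a set \<Rightarrow> bool" where
  "is_infimum P r s Y \<longleftrightarrow> s \<in> P \<and> (\<forall>x \<in> Y. (s, x) \<in> r) \<and>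
     (\<forall>z \<in> P. (\<forall>x \<in> Y. (z, x) \<in> r) \<longrightarrow> (z, s) \<in> r)"

definition dagger :: "'a set \<Rightarrow> 'a rel \<Rightarrow> 'a set \<Rightarrow> bool" where
  "dagger P r F \<longleftrightarrow> is_singleton F \<or>
     (\<exists>s \<in> P. (\<forall>u \<in> F. (s, u) \<in> covering r) \<and>
              (\<forall>u \<in> F. \<forall>v \<in> F. u \<noteq> v \<longrightarrow> is_infimum P r s {u, v}))"


section \<open>Incidence rings\<close>

text \<open>
  An element of the incidence algebra is given by its coordinates in the basis \<open>e\<^bsub>x,y\<^esub>\<close>
  (\<open>x \<le> y\<close>), extended by \<open>0\<close> to all pairs. The span of the \<open>e\<^bsub>x,y\<^esub>\<close> with \<open>(x, y)\<close> in a finite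
  set \<open>E\<close> then consists of all functions vanishing outside \<open>E\<close>.
\<close>

definition incidence_unit :: "'a \<Rightarrow> 'a \<Rightarrow> 'a \<times> 'a \<Rightarrow> 'k :: field" where
  "incidence_unit x y = (\<lambda>p. if p = (x, y) then 1 else 0)"

definition incidence_span :: "('a \<times> 'a) set \<Rightarrow> ('a \<times> 'a \<Rightarrow> 'k :: field) set" where
  "incidence_span E = {f. \<forall>p. p \<notin> E \<longrightarrow> f p = 0}"

definition incidence_ring :: "'a set \<Rightarrow> 'a rel \<Rightarrow> ('a \<times> 'a \<Rightarrow> 'k :: field) ring" where
  "incidence_ring P r = \<lparr>
     carrier = incidence_span r,
     mult = (\<lambda>f g. \<lambda>(x, y). \<Sum>z\<in>P. f (x, z) * g (z, y)),
     one = (\<lambda>p. \<Sum>x\<in>P. incidence_unit x x p),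
     zero = (\<lambda>p. 0),
     add = (\<lambda>f g p. f p + g p)\<rparr>"

lemma incidence_unit_mult:
  fixes P :: "'a set" and r :: "'a rel"
  assumes "finite P" "y \<in> P"
  shows "(incidence_unit x y :: 'a \<times> 'a \<Rightarrow> 'k :: field) \<otimes>\<^bsub>incidence_ring P r\<^esub> incidence_unit z u =
           (if y = z then incidence_unit x u else \<zero>\<^bsub>incidence_ring P r\<^esub>)"
proof
  fix p :: "'a \<times> 'a"
  obtain a b where p: "p = (a, b)" by (cases p)
  have "(\<Sum>w\<in>P. incidence_unit x y (a, w) * incidence_unit z u (w, b))
      = (\<Sum>w\<in>P. if w = y then (if a = x \<and> y = z \<and> b = u then 1 else 0) else (0 :: 'k))"
    by (rule sum.cong) (auto simp: incidence_unit_def)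
  also have "\<dots> = (if a = x \<and> y = z \<and> b = u then 1 else 0)"
    using assms by simp
  finally show "((incidence_unit x y :: 'a \<times> 'a \<Rightarrow> 'k) \<otimes>\<^bsub>incidence_ring P r\<^esub> incidence_unit z u) p =
      (if y = z then incidence_unit x u else \<zero>\<^bsub>incidence_ring P r\<^esub>) p"
    by (auto simp: p incidence_ring_def incidence_unit_def)
qed

definition incidence_diag :: "'a set \<Rightarrow> ('a \<times> 'a \<Rightarrow> 'k :: field) set" where
  "incidence_diag P = incidence_span (Id_on P)"

definition incidence_component :: "'a rel \<Rightarrow> nat \<Rightarrow> ('a \<times> 'a \<Rightarrow> 'k :: field) set" where
  "incidence_component r p = incidence_span {(x, y) \<in> r. interval_length r x y = p}"


section \<open>Left modules\<close>

text \<open>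
  The locale \<^locale>\<open>module\<close> requires a commutative base ring. Left modules over an arbitrary
  ring use the same record type; its fields \<open>mult\<close> and \<open>one\<close> are irrelevant.
\<close>

locale left_module = R?: ring R + M?: abelian_group M
  for R :: "('r, 'b) ring_scheme" (structure) and M :: "('r, 'm, 'c) module_scheme" (structure) +
  assumes smult_closed:
      "\<lbrakk>a \<in> carrier R; x \<in> carrier M\<rbrakk> \<Longrightarrow> a \<odot>\<^bsub>M\<^esub> x \<in> carrier M"
    and smult_l_distr:
      "\<lbrakk>a \<in> carrier R; b \<in> carrier R; x \<in> carrier M\<rbrakk> \<Longrightarrow>
        (a \<oplus>\<^bsub>R\<^esub> b) \<odot>\<^bsub>M\<^esub> x = a \<odot>\<^bsub>M\<^esub> x \<oplus>\<^bsub>M\<^esub> b \<odot>\<^bsub>M\<^esub> x"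
    and smult_r_distr:
      "\<lbrakk>a \<in> carrier R; x \<in> carrier M; y \<in> carrier M\<rbrakk> \<Longrightarrow>
        a \<odot>\<^bsub>M\<^esub> (x \<oplus>\<^bsub>M\<^esub> y) = a \<odot>\<^bsub>M\<^esub> x \<oplus>\<^bsub>M\<^esub> a \<odot>\<^bsub>M\<^esub> y"
    and smult_assoc1:
      "\<lbrakk>a \<in> carrier R; b \<in> carrier R; x \<in> carrier M\<rbrakk> \<Longrightarrow>
        (a \<otimes>\<^bsub>R\<^esub> b) \<odot>\<^bsub>M\<^esub> x = a \<odot>\<^bsub>M\<^esub> (b \<odot>\<^bsub>M\<^esub> x)"
    and smult_one:
      "x \<in> carrier M \<Longrightarrow> \<one>\<^bsub>R\<^esub> \<odot>\<^bsub>M\<^esub> x = x"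

definition lmod_hom ::
    "('r, 'b) ring_scheme \<Rightarrow> ('r, 'm) module \<Rightarrow> ('r, 'n) module \<Rightarrow> ('m \<Rightarrow> 'n) set" where
  "lmod_hom R M N = {f \<in> carrier M \<rightarrow> carrier N.
     (\<forall>x \<in> carrier M. \<forall>y \<in> carrier M. f (x \<oplus>\<^bsub>M\<^esub> y) = f x \<oplus>\<^bsub>N\<^esub> f y) \<and>
     (\<forall>a \<in> carrier R. \<forall>x \<in> carrier M. f (a \<odot>\<^bsub>M\<^esub> x) = a \<odot>\<^bsub>N\<^esub> f x)}"

definition regular_module :: "('r, 'b) ring_scheme \<Rightarrow> ('r, 'r) module" where
  "regular_module R = \<lparr>carrier = carrier R, mult = mult R, one = one R, zero = zero R,
     add = add R, smult = mult R\<rparr>"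

definition quotient_module :: "('r, 'b) ring_scheme \<Rightarrow> 'r set \<Rightarrow> ('r, 'r set) module" where
  "quotient_module R I = \<lparr>carrier = carrier (R Quot I), mult = mult (R Quot I),
     one = one (R Quot I), zero = zero (R Quot I), add = add (R Quot I),
     smult = (\<lambda>a Y. (I +>\<^bsub>R\<^esub> a) \<otimes>\<^bsub>R Quot I\<^esub> Y)\<rparr>"

text \<open>
  Projectivity is the lifting property against surjections of modules \<open>N \<rightarrow> L\<close>. HOL cannot
  quantify over types, so \<open>N\<close> and \<open>L\<close> range over modules with elements in fixed types. This does
  not weaken the notion: the types suffice for \<open>L = M\<close> and for \<open>N\<close> the free module on the set
  \<open>carrier M\<close> (finitely supported functions from \<open>'m\<close> to \<open>'r\<close>), and splitting \<open>N \<rightarrow> M\<close> makes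
  \<open>M\<close> a direct summand of a free module.
\<close>

definition projective_module :: "('r, 'b) ring_scheme \<Rightarrow> ('r, 'm) module \<Rightarrow> bool" where
  "projective_module R M \<longleftrightarrow> left_module R M \<and>
     (\<forall>(N :: ('r, 'm \<Rightarrow> 'r) module) (L :: ('r, 'm) module) g h.
        left_module R N \<longrightarrow> left_module R L \<longrightarrow>
        g \<in> lmod_hom R N L \<longrightarrow> g ` carrier N = carrier L \<longrightarrow> h \<in> lmod_hom R M L \<longrightarrow>
        (\<exists>k \<in> lmod_hom R M N. \<forall>x \<in> carrier M. g (k x) = h x))"

text \<open>A ring is semisimple if it is the sum of its simple left ideals.\<close>

definition simple_submodule :: "'m set \<Rightarrow> ('r, 'b) ring_scheme \<Rightarrow> ('r, 'm) module \<Rightarrow> bool" where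
  "simple_submodule H R M \<longleftrightarrow> submodule H R M \<and> H \<noteq> {\<zero>\<^bsub>M\<^esub>} \<and>
     (\<forall>K. submodule K R M \<longrightarrow> K \<subseteq> H \<longrightarrow> K = {\<zero>\<^bsub>M\<^esub>} \<or> K = H)"

definition semisimple_ring :: "('r, 'b) ring_scheme \<Rightarrow> bool" where
  "semisimple_ring R \<longleftrightarrow> ring R \<and>
     carrier R = generate (add_monoid R) (\<Union>{I. simple_submodule I R (regular_module R)})"


section \<open>Graded rings and graded modules\<close>

definition internal_direct_sum :: "('m, 'b) ring_scheme \<Rightarrow> (nat \<Rightarrow> 'm set) \<Rightarrow> bool" where
  "internal_direct_sum M G \<longleftrightarrow> (\<forall>n. subgroup (G n) (add_monoid M)) \<and>
     (\<forall>x \<in> carrier M. \<exists>!f. (\<forall>n. f n \<in> G n) \<and> finite {n. f n \<noteq> \<zero>\<^bsub>M\<^esub>} \<and>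
        x = finsum M f {n. f n \<noteq> \<zero>\<^bsub>M\<^esub>})"

text \<open>
  \<open>R\<close> is a subset of \<open>A\<close> which is a ring for the operations of \<open>A\<close>; the bimodule structure of
  \<open>A\<close> over \<open>R\<close> is given by multiplication.
\<close>

locale connected_ring = A?: ring A for A (structure) +
  fixes R :: "'a set" and A_grade :: "nat \<Rightarrow> 'a set"
  assumes subring_R: "subring R A"
    and semisimple_R: "semisimple_ring (A\<lparr>carrier := R\<rparr>)"
    and decomposition: "internal_direct_sum A A_grade"
    and grade_mult: "\<lbrakk>a \<in> A_grade p; b \<in> A_grade q\<rbrakk> \<Longrightarrow> a \<otimes>\<^bsub>A\<^esub> b \<in> A_grade (p + q)"
    and grade_zero: "A_grade 0 = R"

text \<open>
  The image of the multiplication map \<open>A\<^sub>p \<otimes>\<^sub>R A\<^sub>q \<rightarrow> A\<^bsub>p+q\<^esub>\<close> is the additive subgroup generated by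
  all products.
\<close>

definition strongly_graded :: "('r, 'b) ring_scheme \<Rightarrow> (nat \<Rightarrow> 'r set) \<Rightarrow> bool" where
  "strongly_graded A Ag \<longleftrightarrow> (\<forall>p q.
     generate (add_monoid A) {a \<otimes>\<^bsub>A\<^esub> b | a b. a \<in> Ag p \<and> b \<in> Ag q} = Ag (p + q))"

definition positive_part :: "('r, 'b) ring_scheme \<Rightarrow> (nat \<Rightarrow> 'r set) \<Rightarrow> 'r set" where
  "positive_part A Ag = generate (add_monoid A) (\<Union>n \<in> {0<..}. Ag n)"

definition graded_module ::
    "('r, 'b) ring_scheme \<Rightarrow> (nat \<Rightarrow> 'r set) \<Rightarrow> ('r, 'm) module \<Rightarrow> (nat \<Rightarrow> 'm set) \<Rightarrow> bool" where
  "graded_module A Ag M G \<longleftrightarrow> left_module A M \<and> internal_direct_sum M G \<and>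
     (\<forall>p n. \<forall>a \<in> Ag p. \<forall>x \<in> G n. a \<odot>\<^bsub>M\<^esub> x \<in> G (p + n))"

definition graded_hom ::
    "('r, 'b) ring_scheme \<Rightarrow> ('r, 'm) module \<Rightarrow> (nat \<Rightarrow> 'm set) \<Rightarrow>
     ('r, 'n) module \<Rightarrow> (nat \<Rightarrow> 'n set) \<Rightarrow> ('m \<Rightarrow> 'n) set" where
  "graded_hom A M G N H = {f \<in> lmod_hom A M N. \<forall>n. f ` G n \<subseteq> H n}"

definition generated_by :: "('r, 'b) ring_scheme \<Rightarrow> ('r, 'm) module \<Rightarrow> 'm set \<Rightarrow> bool" where
  "generated_by A M Y \<longleftrightarrow> carrier M = \<Inter>{K. submodule K A M \<and> Y \<subseteq> K}"


section \<open>Koszul rings\<close>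

text \<open>
  An exact sequence of graded modules \<open>\<dots> \<rightarrow> M 2 \<rightarrow> M 1 \<rightarrow> M 0 \<rightarrow> N \<rightarrow> 0\<close> with projective \<open>M n\<close>;
  \<open>d n\<close> maps \<open>M (Suc n)\<close> to \<open>M n\<close>, and \<open>\<epsilon>\<close> is the augmentation.
\<close>

definition projective_graded_resolution ::
    "('r, 'b) ring_scheme \<Rightarrow> (nat \<Rightarrow> 'r set) \<Rightarrow> ('r, 'n) module \<Rightarrow> (nat \<Rightarrow> 'n set) \<Rightarrow>
     (nat \<Rightarrow> ('r, 'm) module) \<Rightarrow> (nat \<Rightarrow> nat \<Rightarrow> 'm set) \<Rightarrow> (nat \<Rightarrow> 'm \<Rightarrow> 'm) \<Rightarrow> ('m \<Rightarrow> 'n) \<Rightarrow> bool"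
  where
  "projective_graded_resolution A Ag N H M G d \<epsilon> \<longleftrightarrow>
     (\<forall>n. graded_module A Ag (M n) (G n) \<and> projective_module A (M n)) \<and>
     (\<forall>n. d n \<in> graded_hom A (M (Suc n)) (G (Suc n)) (M n) (G n)) \<and>
     \<epsilon> \<in> graded_hom A (M 0) (G 0) N H \<and>
     \<epsilon> ` carrier (M 0) = carrier N \<and>
     d 0 ` carrier (M 1) = a_kernel (M 0) N \<epsilon> \<and>
     (\<forall>n. d (Suc n) ` carrier (M (Suc (Suc n))) = a_kernel (M (Suc n)) (M n) (d n))"

text \<open>
  As HOL cannot quantify existentially over types, the modules of the resolution have elements of
  type \<open>nat \<Rightarrow> 'r\<close>. This is no restriction. If \<open>P\<^sub>*\<close> is any resolution as in the definition, then
  \<open>P\<^sub>n\<close> is generated over \<open>A\<close> by its component \<open>V\<^sub>n\<close> of degree \<open>n\<close>, and exactness in degree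
  \<open>n + 1\<close> embeds \<open>V\<^bsub>n+1\<^esub>\<close> into the component of degree \<open>n + 1\<close> of \<open>P\<^sub>n\<close> (for \<open>n = 0\<close>, the component
  \<open>V\<^sub>0\<close> embeds into \<open>A/A\<^sub>+\<close>). Hence no \<open>P\<^sub>n\<close> has more elements than \<open>nat \<Rightarrow> 'r\<close>, and the whole
  resolution can be transported to this type. Likewise gradings by natural numbers suffice: since
  \<open>A\<close> vanishes in negative degrees, a module generated in degree \<open>n \<ge> 0\<close> does so too.
\<close>

definition koszul_ring :: "('r, 'b) ring_scheme \<Rightarrow> 'r set \<Rightarrow> (nat \<Rightarrow> 'r set) \<Rightarrow> bool" where
  "koszul_ring A R Ag \<longleftrightarrow> connected_ring A R Ag \<and> strongly_graded A Ag \<and>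
     (\<exists>(M :: nat \<Rightarrow> ('r, nat \<Rightarrow> 'r) module) G d \<epsilon>.
        projective_graded_resolution A Ag
          (quotient_module A (positive_part A Ag))
          (\<lambda>n. (\<lambda>a. positive_part A Ag +>\<^bsub>A\<^esub> a) ` Ag n)
          M G d \<epsilon> \<and>
        (\<forall>n. generated_by A (M n) (G n n)))"

end

theory Submission
  imports Defs
begin

text \<open>
  Left modules over the incidence algebra \<open>A\<close> are the contravariant functors from \<open>P\<close> to vector
  spaces. As \<open>t\<close> is maximal, \<open>e\<^sub>t A = k e\<^sub>t\<close>; therefore the elements of a module killed by
  \<open>e\<^sub>t\<close> form a submodule, and the \<open>B\<close>-modules are the \<open>A\<close>-modules killed by \<open>e\<^sub>t\<close>. A module of
  this kind is projective over \<open>A\<close> if and only if it is projective over \<open>B\<close>. Moreover, if \<open>e\<^sub>t\<close> kills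
  a module with a linear resolution, then it kills the whole resolution. Hence linear resolutions
  of modules killed by \<open>e\<^sub>t\<close> are the same over \<open>A\<close> and over \<open>B\<close> (\<open>linear_resolution_inflate\<close>,
  \<open>linear_resolution_restrict\<close>).

  As an \<open>A\<close>-module, \<open>R = A/A\<^sub>+\<close> is the direct sum of \<open>S\<close> and the simple module \<open>k\<^sub>t\<close> at \<open>t\<close>. So
  it suffices to know two things.

  \<^item> The module \<open>k\<^sub>t\<close> has a linear resolution. Its projective cover is \<open>A e\<^sub>t\<close>, with kernel the
    constant functor on the elements below \<open>t\<close>, which is a quotient of the sum of the \<open>A e\<^sub>u\<close>
    with \<open>u\<close> in \<open>F\<close>. By \<open>(\<dagger>)\<close>, an element below two different \<open>u\<close> lies below \<open>s\<close>. So the relations are the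
    families of scalars with sum \<open>0\<close>, placed at the elements below \<open>s\<close>, and
    \<open>0 \<rightarrow> (A e\<^sub>s)\<^bsup>|F|-1\<^esup> \<rightarrow> \<Oplus>\<^sub>u A e\<^sub>u \<rightarrow> A e\<^sub>t \<rightarrow> k\<^sub>t\<close> is exact, where the first term is
    \<open>0\<close> if \<open>F\<close> has at most one element (\<open>simple_linear_resolution\<close>). Only
    coverings occur in the boundary maps, so the resolution is linear.
  \<^item> Linear resolutions can be added and split off. Addition is easy
    (\<open>linear_resolution_direct_sum\<close>). For the other direction, lift the projection \<open>R \<rightarrow> k\<^sub>t\<close> and
    the inclusion \<open>k\<^sub>t \<rightarrow> R\<close> to chain maps \<open>\<rho>\<close> and \<open>\<sigma>\<close> of the resolutions. A linear resolution is
    rigid: its only degree preserving endomorphism over the identity is the identity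
    (\<open>chain_endomorphism_id\<close>). So \<open>\<rho> \<sigma> = 1\<close>, and the kernel of \<open>\<rho>\<close> is a direct summand of the
    resolution of \<open>R\<close> that resolves \<open>S\<close> (\<open>linear_resolution_summand\<close>).
\<close>

section \<open>Gradings\<close>

definition homogeneous_part :: "('m, 'b) ring_scheme \<Rightarrow> (nat \<Rightarrow> 'm set) \<Rightarrow> nat \<Rightarrow> 'm \<Rightarrow> 'm" where
  "homogeneous_part M G n x = (THE f. (\<forall>n. f n \<in> G n) \<and> finite {n. f n \<noteq> \<zero>\<^bsub>M\<^esub>} \<and>
     finsum M f {n. f n \<noteq> \<zero>\<^bsub>M\<^esub>} = x) n"

lemma additive_subgroupD:
  assumes "abelian_group M" "subgroup H (add_monoid M)"
  shows "H \<subseteq> carrier M" "\<zero>\<^bsub>M\<^esub> \<in> H" "\<And>x y. x \<in> H \<Longrightarrow> y \<in> H \<Longrightarrow> x \<oplus>\<^bsub>M\<^esub> y \<in> H"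
    "\<And>x. x \<in> H \<Longrightarrow> \<ominus>\<^bsub>M\<^esub> x \<in> H"
  using subgroup.subset[OF assms(2)] subgroup.one_closed[OF assms(2)]
    subgroup.m_closed[OF assms(2)] subgroup.m_inv_closed[OF assms(2)]
  by (auto simp: a_inv_def)

lemma additive_subgroupI:
  assumes "abelian_group M" "H \<subseteq> carrier M" "\<zero>\<^bsub>M\<^esub> \<in> H"
    "\<And>x y. x \<in> H \<Longrightarrow> y \<in> H \<Longrightarrow> x \<oplus>\<^bsub>M\<^esub> y \<in> H"
    "\<And>x. x \<in> H \<Longrightarrow> \<ominus>\<^bsub>M\<^esub> x \<in> H"
  shows "subgroup H (add_monoid M)"
  using assms group.subgroupI[OF abelian_group.a_group[OF assms(1)], of H]
  by (auto simp: a_inv_def)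

lemma eq_of_add_minus:
  assumes "abelian_group M" "x \<in> carrier M" "y \<in> carrier M" "x \<oplus>\<^bsub>M\<^esub> \<ominus>\<^bsub>M\<^esub> y = \<zero>\<^bsub>M\<^esub>"
  shows "x = y"
  using abelian_group.minus_equality[OF assms(1,4)] abelian_group.minus_minus[OF assms(1,3)]
    abelian_group.a_inv_closed[OF assms(1)] assms(2,3) by simp

context
  fixes M :: "('m, 'b) ring_scheme" (structure) and G :: "nat \<Rightarrow> 'm set"
  assumes ab: "abelian_group M" and ids: "internal_direct_sum M G"
begin

interpretation abelian_group M by (rule ab)

lemma grade_subgroup: "subgroup (G n) (add_monoid M)"
  using ids by (simp add: internal_direct_sum_def)

lemmas grade_closed = additive_subgroupD[OF ab grade_subgroup]

private definition "expands x f \<longleftrightarrow> (\<forall>n. f n \<in> G n) \<and> finite {n. f n \<noteq> \<zero>} \<and>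
   finsum M f {n. f n \<noteq> \<zero>} = x"

private lemma expands_ex1:
  assumes "x \<in> carrier M" shows "\<exists>!f. expands x f"
proof -
  have "expands x f \<longleftrightarrow> (\<forall>n. f n \<in> G n) \<and> finite {n. f n \<noteq> \<zero>} \<and> x = finsum M f {n. f n \<noteq> \<zero>}" for f
    unfolding expands_def by (intro conj_cong refl eq_commute)
  thus ?thesis using ids assms unfolding internal_direct_sum_def by simp
qed

private lemma homogeneous_part_eqI: "x \<in> carrier M \<Longrightarrow> expands x f \<Longrightarrow> homogeneous_part M G n x = f n"
  using the1_equality[OF expands_ex1] unfolding homogeneous_part_def expands_def
    by fastforce

private lemma expands_homogeneous_part:
  assumes "x \<in> carrier M" shows "expands x (\<lambda>n. homogeneous_part M G n x)"
proof -
  obtain f where "expands x f" using expands_ex1[OF assms] by blast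
  moreover from homogeneous_part_eqI[OF assms this] have "(\<lambda>n. homogeneous_part M G n x) = f" by blast
  ultimately show ?thesis by (simp only:)
qed

lemma homogeneous_part_in: "x \<in> carrier M \<Longrightarrow> homogeneous_part M G n x \<in> G n"
  using expands_homogeneous_part by (simp add: expands_def)

lemma homogeneous_part_closed: "x \<in> carrier M \<Longrightarrow> homogeneous_part M G n x \<in> carrier M"
  using homogeneous_part_in grade_closed(1) by blast

lemma homogeneous_part_finite: "x \<in> carrier M \<Longrightarrow> finite {n. homogeneous_part M G n x \<noteq> \<zero>}"
  using expands_homogeneous_part by (simp add: expands_def)

private lemma homogeneous_part_sum: "x \<in> carrier M \<Longrightarrow>
   finsum M (\<lambda>n. homogeneous_part M G n x) {n. homogeneous_part M G n x \<noteq> \<zero>} = x"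
  using expands_homogeneous_part[of x] unfolding expands_def by simp

private lemma expands_superset:
  assumes "finite S" "\<And>n. f n \<in> G n" "\<And>n. n \<notin> S \<Longrightarrow> f n = \<zero>"
  shows "expands (finsum M f S) f"
proof -
  have "finsum M f {n. f n \<noteq> \<zero>} = finsum M f S"
    using assms grade_closed(1) by (intro add.finprod_mono_neutral_cong_left) auto
  moreover have "finite {n. f n \<noteq> \<zero>}"
    using assms by (metis (mono_tags, lifting) mem_Collect_eq rev_finite_subset subsetI)
  ultimately show ?thesis using assms by (simp add: expands_def)
qed

lemma homogeneous_part_homogeneous:
  assumes "x \<in> G n" shows "homogeneous_part M G m x = (if m = n then x else \<zero>)"
proof -
  have x: "x \<in> carrier M" using assms grade_closed(1) by blast
  have "expands (finsum M (\<lambda>m. if m = n then x else \<zero>) {n}) (\<lambda>m. if m = n then x else \<zero>)"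
    using assms grade_closed(2) by (intro expands_superset) auto
  hence "expands x (\<lambda>m. if m = n then x else \<zero>)" using x by simp
  from homogeneous_part_eqI[OF x this] show ?thesis .
qed

lemma homogeneous_part_zero: "homogeneous_part M G n \<zero> = \<zero>"
  using homogeneous_part_homogeneous[OF grade_closed(2), of n n] by simp

lemma homogeneous_part_add:
  assumes "x \<in> carrier M" "y \<in> carrier M"
  shows "homogeneous_part M G n (x \<oplus> y) = homogeneous_part M G n x \<oplus> homogeneous_part M G n y"
proof -
  let ?f = "\<lambda>n. homogeneous_part M G n x" and ?g = "\<lambda>n. homogeneous_part M G n y"
  let ?S = "{n. ?f n \<noteq> \<zero>} \<union> {n. ?g n \<noteq> \<zero>}"
  have fin: "finite ?S" using assms homogeneous_part_finite by simp
  have "expands (finsum M (\<lambda>n. ?f n \<oplus> ?g n) ?S) (\<lambda>n. ?f n \<oplus> ?g n)"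
    using fin assms homogeneous_part_in grade_closed(3) by (intro expands_superset) auto
  moreover have "finsum M (\<lambda>n. ?f n \<oplus> ?g n) ?S = finsum M ?f ?S \<oplus> finsum M ?g ?S"
    using assms homogeneous_part_closed by (intro finsum_addf) auto
  moreover have "finsum M ?f ?S = x"
  proof -
    have "finsum M ?f ?S = finsum M ?f {n. ?f n \<noteq> \<zero>}"
      using fin assms homogeneous_part_closed by (intro add.finprod_mono_neutral_cong_right) auto
    thus ?thesis using homogeneous_part_sum[OF assms(1)] by simp
  qed
  moreover have "finsum M ?g ?S = y"
  proof -
    have "finsum M ?g ?S = finsum M ?g {n. ?g n \<noteq> \<zero>}"
      using fin assms homogeneous_part_closed by (intro add.finprod_mono_neutral_cong_right) auto
    thus ?thesis using homogeneous_part_sum[OF assms(2)] by simp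
  qed
  ultimately have "expands (x \<oplus> y) (\<lambda>n. ?f n \<oplus> ?g n)" by simp
  from homogeneous_part_eqI[OF _ this] show ?thesis using assms by simp
qed

lemma graded_induct:
  assumes x: "x \<in> carrier M" and hom: "\<And>n x. x \<in> G n \<Longrightarrow> Q x"
    and add: "\<And>x y. x \<in> carrier M \<Longrightarrow> y \<in> carrier M \<Longrightarrow> Q x \<Longrightarrow> Q y \<Longrightarrow> Q (x \<oplus> y)"
  shows "Q x"
proof -
  have *: "finite S \<Longrightarrow> f \<in> S \<rightarrow> carrier M \<Longrightarrow> (\<And>n. n \<in> S \<Longrightarrow> f n \<in> G n) \<Longrightarrow> Q (finsum M f S)" for S f
  proof (induction S rule: finite_induct)
    case empty
    show ?case using hom[OF grade_closed(2)] by simp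
  next
    case (insert n S)
    have "finsum M f (insert n S) = f n \<oplus> finsum M f S" using insert by (intro finsum_insert) auto
    thus ?case using insert hom by (auto intro!: add)
  qed
  have "Q (finsum M (\<lambda>n. homogeneous_part M G n x) {n. homogeneous_part M G n x \<noteq> \<zero>})"
    using homogeneous_part_in[OF x] homogeneous_part_closed[OF x] homogeneous_part_finite[OF x]
    by (intro *) auto
  thus ?thesis by (simp only: homogeneous_part_sum[OF x])
qed

lemma homogeneous_part_minus:
  assumes "x \<in> carrier M"
  shows "homogeneous_part M G n (\<ominus> x) = \<ominus> homogeneous_part M G n x"
proof -
  have "homogeneous_part M G n (\<ominus> x) \<oplus> homogeneous_part M G n x = \<zero>"
    using homogeneous_part_add[of "\<ominus> x" x] assms homogeneous_part_zero by (simp add: l_neg)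
  thus ?thesis using assms homogeneous_part_closed by (simp add: minus_equality)
qed

lemma homogeneous_part_eq_0:
  assumes "x \<in> carrier M" "\<And>n. homogeneous_part M G n x = \<zero>"
  shows "x = \<zero>"
  using homogeneous_part_sum[OF assms(1)] assms(2) by simp

lemma homogeneous_parts_eqI:
  assumes "x \<in> carrier M" "y \<in> carrier M" "\<And>n. homogeneous_part M G n x = homogeneous_part M G n y"
  shows "x = y"
proof -
  have "homogeneous_part M G n (x \<oplus> \<ominus> y) = \<zero>" for n
    using assms(1,2) homogeneous_part_add[of x "\<ominus> y"] homogeneous_part_minus[of y]
      homogeneous_part_closed[of y] assms(3)[of n] by (simp add: r_neg)
  hence "x \<oplus> \<ominus> y = \<zero>" using homogeneous_part_eq_0[of "x \<oplus> \<ominus> y"] assms(1,2) by simp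
  thus ?thesis using assms eq_of_add_minus[OF ab] by blast
qed

end

text \<open>A grading can be given by its projections \<open>c n\<close>, without mentioning sums over supports: \<open>x\<close> and
  the sum of the \<open>c n x\<close> have the same projections, so their difference vanishes by \<open>c_0\<close>.\<close>

lemma internal_direct_sumI:
  fixes M :: "('m, 'b) ring_scheme" (structure)
  assumes ab: "abelian_group M"
    and sub: "\<And>n. subgroup (G n) (add_monoid M)"
    and c_in: "\<And>n x. x \<in> carrier M \<Longrightarrow> c n x \<in> G n"
    and c_add: "\<And>n x y. x \<in> carrier M \<Longrightarrow> y \<in> carrier M \<Longrightarrow> c n (x \<oplus> y) = c n x \<oplus> c n y"
    and c_hom: "\<And>m n x. x \<in> G n \<Longrightarrow> c m x = (if m = n then x else \<zero>)"
    and c_fin: "\<And>x. x \<in> carrier M \<Longrightarrow> finite {n. c n x \<noteq> \<zero>}"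
    and c_0: "\<And>x. x \<in> carrier M \<Longrightarrow> (\<And>n. c n x = \<zero>) \<Longrightarrow> x = \<zero>"
  shows "internal_direct_sum M G"
proof -
  interpret abelian_group M by (rule ab)
  note G = additive_subgroupD[OF ab sub]
  have c_closed: "c n x \<in> carrier M" if "x \<in> carrier M" for n x using c_in[OF that] G(1) by blast
  have c_zero: "c n \<zero> = \<zero>" for n using c_hom[OF G(2), of n n] by simp
  have c_sum: "c m (finsum M f S) = finsum M (\<lambda>n. c m (f n)) S"
    if "finite S" "\<And>n. f n \<in> carrier M" for f m and S :: "nat set"
    using that
  proof (induction S rule: finite_induct)
    case (insert n S)
    have "finsum M f (insert n S) = f n \<oplus> finsum M f S" using insert by (intro finsum_insert) auto
    moreover have "finsum M (\<lambda>n. c m (f n)) (insert n S) = c m (f n) \<oplus> finsum M (\<lambda>n. c m (f n)) S"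
      using insert c_closed by (intro finsum_insert) auto
    ultimately show ?case using insert c_add by simp
  qed (simp add: c_zero)
  have c_expand: "c m (finsum M f {n. f n \<noteq> \<zero>}) = f m"
    if "finite {n. f n \<noteq> \<zero>}" "\<And>n. f n \<in> G n" for f m
  proof -
    have fc: "f n \<in> carrier M" for n using that G(1) by blast
    have "c m (finsum M f {n. f n \<noteq> \<zero>}) = finsum M (\<lambda>n. c m (f n)) {n. f n \<noteq> \<zero>}"
      using c_sum that fc by simp
    also have "\<dots> = finsum M (\<lambda>n. if m = n then f n else \<zero>) {n. f n \<noteq> \<zero>}"
      using that fc by (intro finsum_cong') (auto simp: c_hom)
    also have "\<dots> = finsum M (\<lambda>n. if m = n then f n else \<zero>) (insert m {n. f n \<noteq> \<zero>})"
      using that(1) fc by (intro add.finprod_mono_neutral_cong_left) auto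
    also have "\<dots> = f m"
      using add.finprod_singleton[of m "insert m {n. f n \<noteq> \<zero>}" f] that(1) fc by simp
    finally show ?thesis .
  qed
  have "\<exists>!f. (\<forall>n. f n \<in> G n) \<and> finite {n. f n \<noteq> \<zero>} \<and> x = finsum M f {n. f n \<noteq> \<zero>}"
    if x: "x \<in> carrier M" for x
  proof (rule ex1I[of _ "\<lambda>n. c n x"])
    let ?s = "finsum M (\<lambda>n. c n x) {n. c n x \<noteq> \<zero>}"
    have s: "?s \<in> carrier M" using c_closed x by (intro finsum_closed) auto
    have c_neg: "c n (\<ominus> ?s) = \<ominus> c n ?s" for n
      using c_add[of "\<ominus> ?s" ?s n] s c_zero c_closed
      by (metis a_inv_closed l_neg minus_equality)
    have "x \<oplus> \<ominus> ?s = \<zero>"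
    proof (rule c_0)
      show "x \<oplus> \<ominus> ?s \<in> carrier M" using x s by simp
      show "c n (x \<oplus> \<ominus> ?s) = \<zero>" for n
        using c_add[of x "\<ominus> ?s" n] c_neg[of n] c_expand[of "\<lambda>n. c n x" n]
          c_fin[OF x] c_in[OF x] c_closed[OF x] x s by (simp add: r_neg)
    qed
    hence "x = ?s" using x s eq_of_add_minus[OF ab] by blast
    thus "(\<forall>n. c n x \<in> G n) \<and> finite {n. c n x \<noteq> \<zero>} \<and> x = ?s"
      using c_in x c_fin by blast
  next
    fix f assume f: "(\<forall>n. f n \<in> G n) \<and> finite {n. f n \<noteq> \<zero>} \<and> x = finsum M f {n. f n \<noteq> \<zero>}"
    thus "f = (\<lambda>n. c n x)" using c_expand[of f] by (intro ext) (elim conjE, metis)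
  qed
  thus ?thesis using sub unfolding internal_direct_sum_def by blast
qed

section \<open>Modules and homomorphisms\<close>

context left_module
begin

lemma smult_zero_right: "a \<in> carrier R \<Longrightarrow> a \<odot>\<^bsub>M\<^esub> \<zero>\<^bsub>M\<^esub> = \<zero>\<^bsub>M\<^esub>"
  using smult_r_distr[of a "\<zero>\<^bsub>M\<^esub>" "\<zero>\<^bsub>M\<^esub>"] smult_closed[of a "\<zero>\<^bsub>M\<^esub>"]
  by (metis M.add.l_cancel_one M.zero_closed M.l_zero)

lemma smult_zero_left: "x \<in> carrier M \<Longrightarrow> \<zero>\<^bsub>R\<^esub> \<odot>\<^bsub>M\<^esub> x = \<zero>\<^bsub>M\<^esub>"
  using smult_l_distr[of "\<zero>\<^bsub>R\<^esub>" "\<zero>\<^bsub>R\<^esub>" x] smult_closed[of "\<zero>\<^bsub>R\<^esub>" x]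
  by (metis M.add.l_cancel_one R.zero_closed R.l_zero)

lemma smult_minus_right: "a \<in> carrier R \<Longrightarrow> x \<in> carrier M \<Longrightarrow> a \<odot>\<^bsub>M\<^esub> (\<ominus>\<^bsub>M\<^esub> x) = \<ominus>\<^bsub>M\<^esub> (a \<odot>\<^bsub>M\<^esub> x)"
  using smult_r_distr[of a "\<ominus>\<^bsub>M\<^esub> x" x] smult_closed smult_zero_right
  by (metis M.a_inv_closed M.l_neg M.minus_equality)

lemma minus_as_smult: "x \<in> carrier M \<Longrightarrow> \<ominus>\<^bsub>M\<^esub> x = (\<ominus>\<^bsub>R\<^esub> \<one>\<^bsub>R\<^esub>) \<odot>\<^bsub>M\<^esub> x"
  using smult_l_distr[of "\<ominus>\<^bsub>R\<^esub> \<one>\<^bsub>R\<^esub>" "\<one>\<^bsub>R\<^esub>" x] smult_closed smult_zero_left smult_one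
  by (metis M.minus_equality R.a_inv_closed R.l_neg R.one_closed)

end

lemma left_moduleD:
  assumes "left_module R M"
  shows "ring R" "abelian_group M"
  using assms by (auto simp: left_module_def)

text \<open>Closure under negation is automatic, as \<open>- x = (- 1) x\<close>.\<close>

lemma submoduleI':
  assumes "left_module R M" "K \<subseteq> carrier M" "\<zero>\<^bsub>M\<^esub> \<in> K"
    "\<And>x y. x \<in> K \<Longrightarrow> y \<in> K \<Longrightarrow> x \<oplus>\<^bsub>M\<^esub> y \<in> K"
    "\<And>a x. a \<in> carrier R \<Longrightarrow> x \<in> K \<Longrightarrow> a \<odot>\<^bsub>M\<^esub> x \<in> K"
  shows "submodule K R M"
proof -
  interpret left_module R M by (rule assms(1))
  have "\<ominus>\<^bsub>M\<^esub> x \<in> K" if "x \<in> K" for x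
    using that assms(2,5) minus_as_smult by (metis R.a_inv_closed R.one_closed subsetD)
  hence "subgroup K (add_monoid M)"
    using assms by (intro additive_subgroupI left_moduleD(2)) auto
  thus ?thesis using assms(5) by (simp add: submodule_def submodule_axioms_def)
qed

lemma submoduleD:
  assumes "left_module R M" "submodule K R M"
  shows "K \<subseteq> carrier M" "\<zero>\<^bsub>M\<^esub> \<in> K"
    "\<And>x y. x \<in> K \<Longrightarrow> y \<in> K \<Longrightarrow> x \<oplus>\<^bsub>M\<^esub> y \<in> K"
    "\<And>x. x \<in> K \<Longrightarrow> \<ominus>\<^bsub>M\<^esub> x \<in> K"
    "\<And>a x. a \<in> carrier R \<Longrightarrow> x \<in> K \<Longrightarrow> a \<odot>\<^bsub>M\<^esub> x \<in> K"
  using additive_subgroupD[OF left_moduleD(2)[OF assms(1)], of K] assms(2)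
  by (auto simp: submodule_def submodule_axioms_def)

lemma left_module_submodule:
  assumes M: "left_module R M" and K: "submodule K R M"
  shows "left_module R (M\<lparr>carrier := K\<rparr>)"
proof -
  interpret left_module R M by (rule M)
  note K' = submoduleD[OF M K]
  have c: "x \<in> carrier M" if "x \<in> K" for x using K'(1) that by blast
  show ?thesis
  proof (intro left_module.intro abelian_groupI left_module_axioms.intro)
    show "ring R" by (rule R.ring_axioms)
    fix x assume "x \<in> carrier (M\<lparr>carrier := K\<rparr>)"
    thus "\<exists>y\<in>carrier (M\<lparr>carrier := K\<rparr>). y \<oplus>\<^bsub>M\<lparr>carrier := K\<rparr>\<^esub> x = \<zero>\<^bsub>M\<lparr>carrier := K\<rparr>\<^esub>"
      using K'(4) c by (intro bexI[of _ "\<ominus>\<^bsub>M\<^esub> x"]) (auto simp: M.l_neg)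
  qed (use K' c in \<open>auto simp: M.a_ac smult_l_distr smult_r_distr smult_assoc1 smult_one\<close>)
qed

lemma lmod_homD:
  assumes "f \<in> lmod_hom R M N"
  shows "x \<in> carrier M \<Longrightarrow> f x \<in> carrier N"
    "x \<in> carrier M \<Longrightarrow> y \<in> carrier M \<Longrightarrow> f (x \<oplus>\<^bsub>M\<^esub> y) = f x \<oplus>\<^bsub>N\<^esub> f y"
    "a \<in> carrier R \<Longrightarrow> x \<in> carrier M \<Longrightarrow> f (a \<odot>\<^bsub>M\<^esub> x) = a \<odot>\<^bsub>N\<^esub> f x"
  using assms by (auto simp: lmod_hom_def)

lemma lmod_homI:
  assumes "\<And>x. x \<in> carrier M \<Longrightarrow> f x \<in> carrier N"
    "\<And>x y. x \<in> carrier M \<Longrightarrow> y \<in> carrier M \<Longrightarrow> f (x \<oplus>\<^bsub>M\<^esub> y) = f x \<oplus>\<^bsub>N\<^esub> f y"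
    "\<And>a x. a \<in> carrier R \<Longrightarrow> x \<in> carrier M \<Longrightarrow> f (a \<odot>\<^bsub>M\<^esub> x) = a \<odot>\<^bsub>N\<^esub> f x"
  shows "f \<in> lmod_hom R M N"
  using assms by (auto simp: lmod_hom_def)

lemma lmod_hom_comp: "f \<in> lmod_hom R M N \<Longrightarrow> g \<in> lmod_hom R N L \<Longrightarrow> (\<lambda>x. g (f x)) \<in> lmod_hom R M L"
  by (auto simp: lmod_hom_def Pi_iff)

lemma lmod_hom_zero:
  assumes "left_module R M" "left_module R N" "f \<in> lmod_hom R M N"
  shows "f \<zero>\<^bsub>M\<^esub> = \<zero>\<^bsub>N\<^esub>"
proof -
  interpret M: left_module R M by (rule assms(1))
  interpret N: left_module R N by (rule assms(2))
  have "f (\<zero>\<^bsub>R\<^esub> \<odot>\<^bsub>M\<^esub> \<zero>\<^bsub>M\<^esub>) = \<zero>\<^bsub>R\<^esub> \<odot>\<^bsub>N\<^esub> f \<zero>\<^bsub>M\<^esub>"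
    using assms(3) by (intro lmod_homD(3)) auto
  thus ?thesis using lmod_homD(1)[OF assms(3)] by (simp add: M.smult_zero_left N.smult_zero_left)
qed

lemma lmod_hom_minus:
  assumes "left_module R M" "left_module R N" "f \<in> lmod_hom R M N" "x \<in> carrier M"
  shows "f (\<ominus>\<^bsub>M\<^esub> x) = \<ominus>\<^bsub>N\<^esub> f x"
proof -
  interpret M: left_module R M by (rule assms(1))
  interpret N: left_module R N by (rule assms(2))
  show ?thesis using lmod_homD[OF assms(3)] assms(4)
    by (simp add: M.minus_as_smult N.minus_as_smult)
qed

lemma lmod_hom_diff:
  assumes "left_module R M" "left_module R N" "f \<in> lmod_hom R M N" "x \<in> carrier M" "y \<in> carrier M"
  shows "f (x \<oplus>\<^bsub>M\<^esub> \<ominus>\<^bsub>M\<^esub> y) = f x \<oplus>\<^bsub>N\<^esub> \<ominus>\<^bsub>N\<^esub> f y"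
proof -
  interpret M: left_module R M by (rule assms(1))
  show ?thesis using lmod_homD[OF assms(3)] lmod_hom_minus[OF assms(1-3)] assms(4,5) by simp
qed

lemma submodule_vimage:
  assumes "left_module R M" "left_module R N" "f \<in> lmod_hom R M N" "submodule K R N"
  shows "submodule {x \<in> carrier M. f x \<in> K} R M"
proof -
  interpret M: left_module R M by (rule assms(1))
  show ?thesis using lmod_homD[OF assms(3)] lmod_hom_zero[OF assms(1-3)] submoduleD[OF assms(2,4)]
    by (intro submoduleI' assms(1)) (auto simp: M.smult_closed)
qed

lemma submodule_zero:
  assumes "left_module R M" shows "submodule {\<zero>\<^bsub>M\<^esub>} R M"
proof -
  interpret M: left_module R M by (rule assms(1))
  show ?thesis by (intro submoduleI' assms) (auto simp: M.smult_zero_right)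
qed

lemma submodule_carrier:
  assumes "left_module R M" shows "submodule (carrier M) R M"
proof -
  interpret M: left_module R M by (rule assms(1))
  show ?thesis by (intro submoduleI' assms) (auto simp: M.smult_closed)
qed

lemma submodule_a_kernel:
  assumes "left_module R M" "left_module R N" "f \<in> lmod_hom R M N"
  shows "submodule (a_kernel M N f) R M"
  using submodule_vimage[OF assms submodule_zero[OF assms(2)]]
  by (simp add: a_kernel_def kernel_def)

lemma in_a_kernel: "x \<in> a_kernel M N f \<longleftrightarrow> x \<in> carrier M \<and> f x = \<zero>\<^bsub>N\<^esub>"
  by (simp add: a_kernel_def kernel_def)

lemma submodule_image:
  assumes "left_module R M" "left_module R N" "f \<in> lmod_hom R M N"
  shows "submodule (f ` carrier M) R N"
proof -
  interpret M: left_module R M by (rule assms(1))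
  note f = lmod_homD[OF assms(3)]
  show ?thesis
  proof (intro submoduleI' assms(2))
    show "\<zero>\<^bsub>N\<^esub> \<in> f ` carrier M"
      using lmod_hom_zero[OF assms] by (intro image_eqI[of _ _ "\<zero>\<^bsub>M\<^esub>"]) auto
    show "x \<oplus>\<^bsub>N\<^esub> y \<in> f ` carrier M" if "x \<in> f ` carrier M" "y \<in> f ` carrier M" for x y
      using that f(2)[symmetric] by auto
    show "a \<odot>\<^bsub>N\<^esub> x \<in> f ` carrier M" if "a \<in> carrier R" "x \<in> f ` carrier M" for a x
      using that f(3)[symmetric] by (auto simp: M.smult_closed)
  qed (use f in auto)
qed

lemma generated_byD: "generated_by R M Y \<Longrightarrow> submodule K R M \<Longrightarrow> Y \<subseteq> K \<Longrightarrow> x \<in> carrier M \<Longrightarrow> x \<in> K"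
  by (auto simp: generated_by_def)

lemma generated_byI:
  assumes "left_module R M" "Y \<subseteq> carrier M"
    "\<And>K x. submodule K R M \<Longrightarrow> Y \<subseteq> K \<Longrightarrow> x \<in> carrier M \<Longrightarrow> x \<in> K"
  shows "generated_by R M Y"
  using submodule_carrier[OF assms(1)] assms(2,3) by (auto simp: generated_by_def)

text \<open>The set where two homomorphisms agree is a submodule.\<close>

lemma generated_by_hom_eq:
  assumes M: "left_module R M" and N: "left_module R N" and f: "f \<in> lmod_hom R M N"
    and g: "g \<in> lmod_hom R M N" and gen: "generated_by R M Y" and Y: "Y \<subseteq> carrier M"
    and eq: "\<And>y. y \<in> Y \<Longrightarrow> f y = g y" and x: "x \<in> carrier M"
  shows "f x = g x"
proof -
  interpret M: left_module R M by (rule M)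
  have "submodule {x \<in> carrier M. f x = g x} R M"
    using lmod_homD[OF f] lmod_homD[OF g] lmod_hom_zero[OF M N f] lmod_hom_zero[OF M N g]
    by (intro submoduleI' M) (auto simp: M.smult_closed)
  from generated_byD[OF gen this _ x] show ?thesis using Y eq by auto
qed

text \<open>The module structure on the image of \<open>M\<close> under an injection \<open>j\<close> that makes \<open>j\<close> an isomorphism.\<close>

definition transport_module :: "('m \<Rightarrow> 'n) \<Rightarrow> ('r, 'm) module \<Rightarrow> ('r, 'n) module" where
  "transport_module j M = \<lparr>carrier = j ` carrier M, mult = undefined, one = undefined,
     zero = j \<zero>\<^bsub>M\<^esub>, add = (\<lambda>x y. j (the_inv j x \<oplus>\<^bsub>M\<^esub> the_inv j y)),
     smult = (\<lambda>a x. j (a \<odot>\<^bsub>M\<^esub> the_inv j x))\<rparr>"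

lemma left_module_transport:
  assumes M: "left_module R M" and j: "inj j"
  shows "left_module R (transport_module j M)"
proof -
  interpret left_module R M by (rule M)
  show ?thesis
  proof (intro left_module.intro abelian_groupI left_module_axioms.intro)
    show "ring R" by (rule R.ring_axioms)
    fix x assume "x \<in> carrier (transport_module j M)"
    then obtain y where y: "y \<in> carrier M" "x = j y" by (auto simp: transport_module_def)
    thus "\<exists>y\<in>carrier (transport_module j M).
        y \<oplus>\<^bsub>transport_module j M\<^esub> x = \<zero>\<^bsub>transport_module j M\<^esub>"
      using the_inv_f_f[OF j] by (intro bexI[of _ "j (\<ominus>\<^bsub>M\<^esub> y)"]) (auto simp: transport_module_def M.l_neg)
  qed (use the_inv_f_f[OF j] in \<open>auto simp: transport_module_def M.a_ac smult_closed smult_l_distr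
       smult_r_distr smult_assoc1 smult_one\<close>)
qed

lemma transport_homs:
  assumes M: "left_module R M" and j: "inj j"
  shows "the_inv j \<in> lmod_hom R (transport_module j M) M"
  using assms the_inv_f_f[OF j] by (intro lmod_homI) (auto simp: transport_module_def left_module.smult_closed)

text \<open>Projectivity is tested only against surjections \<open>N \<rightarrow> L\<close> of modules with prescribed element types.
  To lift along \<open>g\<close>, take for \<open>L\<close> the image of \<open>g\<close>, and for \<open>N\<close> a copy of \<open>P\<close> on the characteristic
  functions of its elements.\<close>

lemma projective_lift:
  fixes R :: "('r, 'b) ring_scheme" and M P Q :: "('r, 'm) module"
  assumes proj: "projective_module R M" and one: "\<one>\<^bsub>R\<^esub> \<noteq> \<zero>\<^bsub>R\<^esub>"
    and P: "left_module R P" and Q: "left_module R Q"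
    and g: "g \<in> lmod_hom R P Q" and h: "h \<in> lmod_hom R M Q"
    and im: "h ` carrier M \<subseteq> g ` carrier P"
  shows "\<exists>k \<in> lmod_hom R M P. \<forall>x \<in> carrier M. g (k x) = h x"
proof -
  define j :: "'m \<Rightarrow> 'm \<Rightarrow> 'r" where "j = (\<lambda>x y. if x = y then \<one>\<^bsub>R\<^esub> else \<zero>\<^bsub>R\<^esub>)"
  have j: "inj j"
  proof (rule injI)
    fix x y assume "j x = j y"
    hence "j x y = j y y" by simp
    thus "x = y" using one by (simp add: j_def split: if_splits)
  qed
  let ?N = "transport_module j P" and ?L = "Q\<lparr>carrier := g ` carrier P\<rparr>"
  let ?g = "\<lambda>x. g (the_inv j x)"
  have c: "the_inv j ` carrier ?N = carrier P" using the_inv_f_f[OF j] by (auto simp: transport_module_def image_image)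
  have "?g \<in> lmod_hom R ?N ?L"
    using lmod_hom_comp[OF transport_homs[OF P j] g] c by (auto simp: lmod_hom_def Pi_iff)
  moreover have "?g ` carrier ?N = carrier ?L" using c by (simp flip: image_image)
  moreover have "h \<in> lmod_hom R M ?L" using h im by (auto simp: lmod_hom_def)
  ultimately obtain k where k: "k \<in> lmod_hom R M ?N" "\<forall>x \<in> carrier M. ?g (k x) = h x"
    using proj left_module_transport[OF P j] left_module_submodule[OF Q submodule_image[OF P Q g]]
    unfolding projective_module_def by blast
  show ?thesis
    using lmod_hom_comp[OF k(1) transport_homs[OF P j]] k(2) by (intro bexI[of _ "\<lambda>x. the_inv j (k x)"])
qed

section \<open>Graded modules\<close>

lemma graded_moduleD:
  assumes "graded_module A Ag M G"
  shows "left_module A M" "abelian_group M" "internal_direct_sum M G" "G n \<subseteq> carrier M"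
    "\<And>a x. a \<in> Ag p \<Longrightarrow> x \<in> G n \<Longrightarrow> a \<odot>\<^bsub>M\<^esub> x \<in> G (p + n)"
    "\<And>x. x \<in> G n \<Longrightarrow> x \<in> carrier M"
  using assms grade_closed(1) by (auto simp: graded_module_def left_module_def)

lemma graded_homD:
  assumes "f \<in> graded_hom A M G N H"
  shows "f \<in> lmod_hom A M N" "x \<in> G n \<Longrightarrow> f x \<in> H n"
  using assms by (auto simp: graded_hom_def)

lemma graded_hom_closed: "f \<in> graded_hom A M G N H \<Longrightarrow> x \<in> carrier M \<Longrightarrow> f x \<in> carrier N"
  by (rule lmod_homD(1)[OF graded_homD(1)])

lemma graded_hom_comp:
  "f \<in> graded_hom A M G N H \<Longrightarrow> g \<in> graded_hom A N H L K \<Longrightarrow> (\<lambda>x. g (f x)) \<in> graded_hom A M G L K"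
  using lmod_hom_comp[of f A M N g L] by (fastforce simp: graded_hom_def)

lemma graded_hom_homogeneous_part:
  assumes M: "graded_module A Ag M G" and N: "graded_module A Ag N H"
    and f: "f \<in> graded_hom A M G N H" and x: "x \<in> carrier M"
  shows "f (homogeneous_part M G n x) = homogeneous_part N H n (f x)"
  using x
proof (induction rule: graded_induct[OF graded_moduleD(2,3)[OF M] x])
  case (1 m x)
  from graded_homD(2)[OF f this(1)] this show ?case
    using lmod_hom_zero[OF graded_moduleD(1)[OF M] graded_moduleD(1)[OF N] graded_homD(1)[OF f]]
    by (simp add: homogeneous_part_homogeneous[OF graded_moduleD(2,3)[OF M]]
        homogeneous_part_homogeneous[OF graded_moduleD(2,3)[OF N]])
next
  case (2 x y)
  thus ?case using lmod_homD[OF graded_homD(1)[OF f]]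
    by (simp add: homogeneous_part_add[OF graded_moduleD(2,3)[OF M]]
        homogeneous_part_add[OF graded_moduleD(2,3)[OF N]]
        homogeneous_part_closed[OF graded_moduleD(2,3)[OF M]])
qed

lemma connected_ringD:
  assumes "connected_ring A R Ag"
  shows "ring A" "abelian_group A" "internal_direct_sum A Ag" "Ag p \<subseteq> carrier A"
proof -
  interpret connected_ring A R Ag by (rule assms)
  show "ring A" "abelian_group A" "internal_direct_sum A Ag" by unfold_locales (rule decomposition)
  thus "Ag p \<subseteq> carrier A" by (intro grade_closed(1))
qed

lemma graded_submodule:
  assumes A: "connected_ring A R Ag" and M: "graded_module A Ag M G" and K: "submodule K A M"
    and hom: "\<And>n x. x \<in> K \<Longrightarrow> homogeneous_part M G n x \<in> K"
  shows "graded_module A Ag (M\<lparr>carrier := K\<rparr>) (\<lambda>n. G n \<inter> K)"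
proof -
  note m = graded_moduleD[OF M]
  note K' = submoduleD[OF m(1) K]
  note G = grade_closed[OF m(2,3)]
  let ?K = "M\<lparr>carrier := K\<rparr>"
  have lm: "left_module A ?K" by (rule left_module_submodule[OF m(1) K])
  have c: "x \<in> carrier M" if "x \<in> K" for x using that K'(1) by blast
  have "internal_direct_sum ?K (\<lambda>n. G n \<inter> K)"
  proof (rule internal_direct_sumI[where c = "homogeneous_part M G"])
    show "abelian_group ?K" using lm by (rule left_moduleD)
    have *: "\<ominus>\<^bsub>?K\<^esub> x = \<ominus>\<^bsub>M\<^esub> x" if "x \<in> K" for x
      using that K' abelian_group.minus_equality[OF \<open>abelian_group ?K\<close>, of "\<ominus>\<^bsub>M\<^esub> x" x]
        abelian_group.l_neg[OF m(2) c[OF that]] by simp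
    show "subgroup (G n \<inter> K) (add_monoid ?K)" for n
      using G K' * \<open>abelian_group ?K\<close> by (intro additive_subgroupI) auto
    show "homogeneous_part M G n x \<in> G n \<inter> K" if "x \<in> carrier ?K" for n x
      using that hom homogeneous_part_in[OF m(2,3)] c by auto
    show "finite {n. homogeneous_part M G n x \<noteq> \<zero>\<^bsub>?K\<^esub>}" if "x \<in> carrier ?K" for x
      using that homogeneous_part_finite[OF m(2,3)] c by auto
    show "x = \<zero>\<^bsub>?K\<^esub>" if "x \<in> carrier ?K" "\<And>n. homogeneous_part M G n x = \<zero>\<^bsub>?K\<^esub>" for x
      using that homogeneous_part_eq_0[OF m(2,3)] c by auto
  qed (auto simp: c homogeneous_part_add[OF m(2,3)] homogeneous_part_homogeneous[OF m(2,3)])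
  thus ?thesis using lm m(5) K' subsetD[OF connected_ringD(4)[OF A]] by (auto simp: graded_module_def)
qed

lemma homogeneous_part_smult:
  assumes A: "connected_ring A R Ag" and M: "graded_module A Ag M G"
    and a: "a \<in> Ag p" and x: "x \<in> carrier M"
  shows "homogeneous_part M G n (a \<odot>\<^bsub>M\<^esub> x) =
    (if p \<le> n then a \<odot>\<^bsub>M\<^esub> homogeneous_part M G (n - p) x else \<zero>\<^bsub>M\<^esub>)"
  using x
proof (induction rule: graded_induct[OF graded_moduleD(2,3)[OF M] x])
  case (1 m x)
  interpret M: left_module A M by (rule graded_moduleD(1)[OF M])
  have "a \<in> carrier A" using a connected_ringD(4)[OF A] by blast
  thus ?case using graded_moduleD(5)[OF M a 1(1)] 1
    by (auto simp: homogeneous_part_homogeneous[OF graded_moduleD(2,3)[OF M]] M.smult_zero_right)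
next
  case (2 x y)
  interpret M: left_module A M by (rule graded_moduleD(1)[OF M])
  have "a \<in> carrier A" using a connected_ringD(4)[OF A] by blast
  thus ?case using 2
    by (simp add: M.smult_r_distr homogeneous_part_add[OF graded_moduleD(2,3)[OF M]] M.smult_closed
      homogeneous_part_closed[OF graded_moduleD(2,3)[OF M]])
qed

text \<open>Multiplication by elements of \<open>A\<close> never lowers degrees, so the elements without components below
  degree \<open>n\<close> form a submodule.\<close>

lemma generated_in_degree_vanishing:
  assumes A: "connected_ring A R Ag" and M: "graded_module A Ag M G"
    and gen: "generated_by A M (G n)" and m: "m < n" and x: "x \<in> carrier M"
  shows "homogeneous_part M G m x = \<zero>\<^bsub>M\<^esub>"
proof -
  interpret M: left_module A M by (rule graded_moduleD(1)[OF M])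
  note hp = homogeneous_part_add[OF graded_moduleD(2,3)[OF M]]
    homogeneous_part_zero[OF graded_moduleD(2,3)[OF M]]
  let ?K = "{x \<in> carrier M. \<forall>m<n. homogeneous_part M G m x = \<zero>\<^bsub>M\<^esub>}"
  have smult: "a \<odot>\<^bsub>M\<^esub> x \<in> ?K" if a: "a \<in> carrier A" and x: "x \<in> ?K" for a x
    using a
  proof (induction rule: graded_induct[OF connected_ringD(2,3)[OF A] a])
    case (1 p a)
    thus ?case using x
      by (auto simp: homogeneous_part_smult[OF A M 1(1)] M.smult_closed M.smult_zero_right)
  next
    case (2 a b)
    thus ?case using x by (auto simp: M.smult_l_distr hp)
  qed
  have "submodule ?K A M"
    by (intro submoduleI' graded_moduleD(1)[OF M] smult) (auto simp: hp)
  moreover have "G n \<subseteq> ?K"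
    using graded_moduleD(6)[OF M]
    by (auto simp: homogeneous_part_homogeneous[OF graded_moduleD(2,3)[OF M]])
  ultimately show ?thesis using generated_byD[OF gen _ _ x] m by blast
qed

text \<open>A lift \<open>k0\<close> provided by projectivity need not preserve degrees, but its component of degree \<open>0\<close>
  does, and it is again a lift because \<open>g\<close> and \<open>h\<close> preserve degrees.\<close>

lemma projective_graded_lift:
  fixes A :: "('r, 'b) ring_scheme" and M P Q :: "('r, 'm) module"
  assumes A: "connected_ring A R Ag" and one: "\<one>\<^bsub>A\<^esub> \<noteq> \<zero>\<^bsub>A\<^esub>"
    and proj: "projective_module A M" and M: "graded_module A Ag M G"
    and P: "graded_module A Ag P GP" and Q: "graded_module A Ag Q GQ"
    and g: "g \<in> graded_hom A P GP Q GQ" and h: "h \<in> graded_hom A M G Q GQ"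
    and im: "h ` carrier M \<subseteq> g ` carrier P"
  shows "\<exists>k \<in> graded_hom A M G P GP. \<forall>x \<in> carrier M. g (k x) = h x"
proof -
  interpret M: left_module A M by (rule graded_moduleD(1)[OF M])
  interpret P: left_module A P by (rule graded_moduleD(1)[OF P])
  obtain k0 where k0: "k0 \<in> lmod_hom A M P" "\<And>x. x \<in> carrier M \<Longrightarrow> g (k0 x) = h x"
    using projective_lift[OF proj one graded_moduleD(1)[OF P] graded_moduleD(1)[OF Q]
        graded_homD(1)[OF g] graded_homD(1)[OF h] im] by blast
  note k0D = lmod_homD[OF k0(1)]
  let ?m = "homogeneous_part M G" and ?p = "homogeneous_part P GP" and ?q = "homogeneous_part Q GQ"
  note Mi = graded_moduleD(2,3)[OF M] and Pi = graded_moduleD(2,3)[OF P]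
  note m = homogeneous_part_add[OF Mi] homogeneous_part_closed[OF Mi] homogeneous_part_homogeneous[OF Mi]
  note p = homogeneous_part_add[OF Pi] homogeneous_part_closed[OF Pi] homogeneous_part_homogeneous[OF Pi]
  (* S x y says that y is the sum over n of the degree n part of k0 applied to the degree n part of x. *)
  define S where "S x y \<longleftrightarrow> y \<in> carrier P \<and> (\<forall>n. ?p n y = ?p n (k0 (?m n x)))" for x y
  have k0z: "k0 \<zero>\<^bsub>M\<^esub> = \<zero>\<^bsub>P\<^esub>" by (rule lmod_hom_zero[OF M.left_module_axioms P.left_module_axioms k0(1)])
  have S_hom: "S x (?p n (k0 x))" "?p n (k0 x) \<in> GP n" if "x \<in> G n" for n x
  proof -
    have x: "x \<in> carrier M" by (rule graded_moduleD(6)[OF M that])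
    from homogeneous_part_in[OF Pi k0D(1)[OF x]] show h: "?p n (k0 x) \<in> GP n" .
    show "S x (?p n (k0 x))"
      using p(2)[OF k0D(1)[OF x]] m(3)[OF that] p(3)[OF h]
      by (auto simp: S_def k0z homogeneous_part_zero[OF Pi])
  qed
  have S_add: "S (x \<oplus>\<^bsub>M\<^esub> x') (y \<oplus>\<^bsub>P\<^esub> y')"
    if "S x y" "S x' y'" "x \<in> carrier M" "x' \<in> carrier M" for x x' y y'
    using that by (auto simp: S_def m p k0D)
  have S_unique: "y = y'" if "S x y" "S x y'" for x y y'
    using homogeneous_parts_eqI[OF Pi, of y y'] that by (auto simp: S_def)
  have S_ex: "\<exists>y. S x y" if "x \<in> carrier M" for x
    using that
  proof (induction rule: graded_induct[OF Mi that])
    case (1 n x) thus ?case using S_hom by blast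
  next
    case (2 x y) thus ?case using S_add by blast
  qed
  define k where "k x = (SOME y. S x y)" for x
  have k: "S x (k x)" if "x \<in> carrier M" for x unfolding k_def by (rule someI_ex[OF S_ex[OF that]])
  have k_eqI: "k x = y" if "x \<in> carrier M" "S x y" for x y
    using S_unique k that by blast
  have kc: "k x \<in> carrier P" if "x \<in> carrier M" for x using k[OF that] by (simp add: S_def)
  have k_smult: "k (a \<odot>\<^bsub>M\<^esub> x) = a \<odot>\<^bsub>P\<^esub> k x" if a: "a \<in> carrier A" and x: "x \<in> carrier M" for a x
    using a
  proof (induction rule: graded_induct[OF connected_ringD(2,3)[OF A] a])
    case (1 d a)
    show ?case
    proof (rule k_eqI)
      show "S (a \<odot>\<^bsub>M\<^esub> x) (a \<odot>\<^bsub>P\<^esub> k x)"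
        using k[OF x] x 1(2)
        by (auto simp: S_def homogeneous_part_smult[OF A M 1(1)] homogeneous_part_smult[OF A P 1(1)]
          k0D m P.smult_closed k0z homogeneous_part_zero[OF Pi])
    qed (use x 1 M.smult_closed in auto)
  next
    case (2 a b)
    have "k (a \<odot>\<^bsub>M\<^esub> x \<oplus>\<^bsub>M\<^esub> b \<odot>\<^bsub>M\<^esub> x) = k (a \<odot>\<^bsub>M\<^esub> x) \<oplus>\<^bsub>P\<^esub> k (b \<odot>\<^bsub>M\<^esub> x)"
      using S_add[OF k k, of "a \<odot>\<^bsub>M\<^esub> x" "b \<odot>\<^bsub>M\<^esub> x"] x 2(1,2) M.smult_closed
      by (intro k_eqI) simp_all
    thus ?case using 2 x kc by (simp add: M.smult_l_distr P.smult_l_distr)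
  qed
  have k_add: "k (x \<oplus>\<^bsub>M\<^esub> y) = k x \<oplus>\<^bsub>P\<^esub> k y" if "x \<in> carrier M" "y \<in> carrier M" for x y
    using S_add[OF k k, of x y] that by (intro k_eqI) simp_all
  have k_hom: "k x = ?p n (k0 x)" if "x \<in> G n" for n x
    using S_hom(1)[OF that] graded_moduleD(6)[OF M that] by (intro k_eqI)
  have "k \<in> graded_hom A M G P GP"
    unfolding graded_hom_def
  proof (intro CollectI conjI allI lmod_homI image_subsetI)
    show "k x \<in> GP n" if "x \<in> G n" for n x using k_hom[OF that] S_hom(2)[OF that] by simp
  qed (use kc k_add k_smult in auto)
  moreover have "g (k x) = h x" if x: "x \<in> carrier M" for x
    using x
  proof (induction rule: graded_induct[OF Mi x])
    case (1 n x)
    hence "g (k x) = ?q n (g (k0 x))"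
      using graded_hom_homogeneous_part[OF P Q g k0D(1)] k_hom[OF 1(1)] by simp
    also have "\<dots> = h x"
      using 1 graded_homD(2)[OF h 1(1)] k0(2)
      by (simp add: homogeneous_part_homogeneous[OF graded_moduleD(2,3)[OF Q]])
    finally show ?case .
  next
    case (2 x y)
    thus ?case using k_add 2 kc lmod_homD(2)[OF graded_homD(1)[OF g]] lmod_homD(2)[OF graded_homD(1)[OF h]]
      by simp
  qed
  ultimately show ?thesis by blast
qed

section \<open>Linear resolutions\<close>

definition linear_resolution ::
    "('r, 'b) ring_scheme \<Rightarrow> (nat \<Rightarrow> 'r set) \<Rightarrow> ('r, 'n) module \<Rightarrow> (nat \<Rightarrow> 'n set) \<Rightarrow>
     (nat \<Rightarrow> ('r, 'm) module) \<Rightarrow> (nat \<Rightarrow> nat \<Rightarrow> 'm set) \<Rightarrow> (nat \<Rightarrow> 'm \<Rightarrow> 'm) \<Rightarrow> ('m \<Rightarrow> 'n) \<Rightarrow> bool"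
  where
  "linear_resolution A Ag N H M G d \<epsilon> \<longleftrightarrow>
     projective_graded_resolution A Ag N H M G d \<epsilon> \<and> (\<forall>n. generated_by A (M n) (G n n))"

lemma linear_resolutionD:
  assumes "linear_resolution A Ag N H M G d \<epsilon>"
  shows "graded_module A Ag (M n) (G n)" "projective_module A (M n)" "left_module A (M n)"
    "d n \<in> graded_hom A (M (Suc n)) (G (Suc n)) (M n) (G n)"
    "\<epsilon> \<in> graded_hom A (M 0) (G 0) N H"
    "\<epsilon> ` carrier (M 0) = carrier N"
    "x \<in> carrier (M (Suc 0)) \<Longrightarrow> \<epsilon> (d 0 x) = \<zero>\<^bsub>N\<^esub>"
    "y \<in> carrier (M 0) \<Longrightarrow> \<epsilon> y = \<zero>\<^bsub>N\<^esub> \<Longrightarrow> \<exists>x \<in> carrier (M (Suc 0)). d 0 x = y"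
    "x \<in> carrier (M (Suc (Suc n))) \<Longrightarrow> d n (d (Suc n) x) = \<zero>\<^bsub>M n\<^esub>"
    "z \<in> carrier (M (Suc n)) \<Longrightarrow> d n z = \<zero>\<^bsub>M n\<^esub> \<Longrightarrow> \<exists>x \<in> carrier (M (Suc (Suc n))). d (Suc n) x = z"
    "generated_by A (M n) (G n n)"
proof -
  note D = assms[unfolded linear_resolution_def projective_graded_resolution_def]
  show "graded_module A Ag (M n) (G n)" "projective_module A (M n)"
    "d n \<in> graded_hom A (M (Suc n)) (G (Suc n)) (M n) (G n)"
    "\<epsilon> \<in> graded_hom A (M 0) (G 0) N H" "\<epsilon> ` carrier (M 0) = carrier N" "generated_by A (M n) (G n n)"
    using D by auto
  thus "left_module A (M n)" by (simp add: graded_module_def)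
  have e0: "d 0 ` carrier (M (Suc 0)) = a_kernel (M 0) N \<epsilon>"
    and e: "d (Suc n) ` carrier (M (Suc (Suc n))) = a_kernel (M (Suc n)) (M n) (d n)"
    using D by auto
  show "x \<in> carrier (M (Suc 0)) \<Longrightarrow> \<epsilon> (d 0 x) = \<zero>\<^bsub>N\<^esub>"
    "x \<in> carrier (M (Suc (Suc n))) \<Longrightarrow> d n (d (Suc n) x) = \<zero>\<^bsub>M n\<^esub>"
    using e0 e in_a_kernel[of "d 0 x" "M 0" N \<epsilon>] in_a_kernel[of "d (Suc n) x" "M (Suc n)" "M n" "d n"]
    by auto
  show "y \<in> carrier (M 0) \<Longrightarrow> \<epsilon> y = \<zero>\<^bsub>N\<^esub> \<Longrightarrow> \<exists>x \<in> carrier (M (Suc 0)). d 0 x = y"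
    using eqset_imp_iff[OF e0, of y] in_a_kernel[of y "M 0" N \<epsilon>] by auto
  show "z \<in> carrier (M (Suc n)) \<Longrightarrow> d n z = \<zero>\<^bsub>M n\<^esub> \<Longrightarrow> \<exists>x \<in> carrier (M (Suc (Suc n))). d (Suc n) x = z"
    using eqset_imp_iff[OF e, of z] in_a_kernel[of z "M (Suc n)" "M n" "d n"] by auto
qed

lemma linear_resolutionI:
  assumes "\<And>n. graded_module A Ag (M n) (G n)" "\<And>n. projective_module A (M n)"
    "\<And>n. d n \<in> graded_hom A (M (Suc n)) (G (Suc n)) (M n) (G n)"
    "\<epsilon> \<in> graded_hom A (M 0) (G 0) N H"
    "\<epsilon> ` carrier (M 0) = carrier N"
    "\<And>x. x \<in> carrier (M (Suc 0)) \<Longrightarrow> \<epsilon> (d 0 x) = \<zero>\<^bsub>N\<^esub>"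
    "\<And>y. y \<in> carrier (M 0) \<Longrightarrow> \<epsilon> y = \<zero>\<^bsub>N\<^esub> \<Longrightarrow> \<exists>x \<in> carrier (M (Suc 0)). d 0 x = y"
    "\<And>n x. x \<in> carrier (M (Suc (Suc n))) \<Longrightarrow> d n (d (Suc n) x) = \<zero>\<^bsub>M n\<^esub>"
    "\<And>n z. z \<in> carrier (M (Suc n)) \<Longrightarrow> d n z = \<zero>\<^bsub>M n\<^esub> \<Longrightarrow> \<exists>x \<in> carrier (M (Suc (Suc n))). d (Suc n) x = z"
    "\<And>n. generated_by A (M n) (G n n)"
  shows "linear_resolution A Ag N H M G d \<epsilon>"
proof -
  have c: "d n x \<in> carrier (M n)" if "x \<in> carrier (M (Suc n))" for n x
    using graded_hom_closed[OF assms(3) that] .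
  have "d 0 ` carrier (M (Suc 0)) = a_kernel (M 0) N \<epsilon>"
    using assms(6,7) c by (fastforce simp: in_a_kernel)
  moreover have "d (Suc n) ` carrier (M (Suc (Suc n))) = a_kernel (M (Suc n)) (M n) (d n)" for n
    using assms(8,9) c by (fastforce simp: in_a_kernel)
  ultimately show ?thesis
    using assms by (simp add: linear_resolution_def projective_graded_resolution_def)
qed

lemma linear_resolution_transfer:
  assumes L: "linear_resolution A Ag N H M G d \<epsilon>"
    and f: "f \<in> graded_hom A N H N' H'" and bij: "bij_betw f (carrier N) (carrier N')"
    and zero: "\<zero>\<^bsub>N\<^esub> \<in> carrier N" "f \<zero>\<^bsub>N\<^esub> = \<zero>\<^bsub>N'\<^esub>"
  shows "linear_resolution A Ag N' H' M G d (\<lambda>x. f (\<epsilon> x))"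
proof -
  note L' = linear_resolutionD[OF L]
  have z: "f x = \<zero>\<^bsub>N'\<^esub> \<longleftrightarrow> x = \<zero>\<^bsub>N\<^esub>" if "x \<in> carrier N" for x
    using inj_on_eq_iff[OF bij_betw_imp_inj_on[OF bij] that zero(1)] zero(2) by simp
  have "(\<lambda>x. f (\<epsilon> x)) ` carrier (M 0) = carrier N'"
    using L'(6) bij by (simp add: bij_betw_def flip: image_image)
  moreover have "\<epsilon> y \<in> carrier N" if "y \<in> carrier (M 0)" for y
    using that L'(6) by blast
  ultimately show ?thesis
    using L' z zero graded_hom_comp[OF L'(5) f] graded_hom_closed[OF L'(4)]
    by (intro linear_resolutionI) auto
qed

text \<open>Along an isomorphism of the resolved modules only the augmentation changes.\<close>

lemma linear_resolution_iso:
  assumes N: "left_module A N" and f: "f \<in> lmod_hom A N N'"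
    and bij: "bij_betw f (carrier N) (carrier N')" and zero: "f \<zero>\<^bsub>N\<^esub> = \<zero>\<^bsub>N'\<^esub>"
    and H: "\<And>n. H n \<subseteq> carrier N" "\<And>n. f ` H n = H' n"
  shows "(\<exists>\<epsilon>. linear_resolution A Ag N H M G d \<epsilon>) \<longleftrightarrow> (\<exists>\<epsilon>. linear_resolution A Ag N' H' M G d \<epsilon>)"
proof
  interpret N: left_module A N by (rule N)
  have "f \<in> graded_hom A N H N' H'" using f H(2) by (auto simp: graded_hom_def)
  thus "\<exists>\<epsilon>. linear_resolution A Ag N' H' M G d \<epsilon>" if "\<exists>\<epsilon>. linear_resolution A Ag N H M G d \<epsilon>"
    using that linear_resolution_transfer bij zero N.zero_closed by blast
  let ?g = "the_inv_into (carrier N) f"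
  have inj: "inj_on f (carrier N)" using bij by (rule bij_betw_imp_inj_on)
  have img: "f ` carrier N = carrier N'" using bij by (rule bij_betw_imp_surj_on)
  have gf: "?g (f x) = x" if "x \<in> carrier N" for x by (rule the_inv_into_f_f[OF inj that])
  have "?g \<in> lmod_hom A N' N"
  proof (rule lmod_homI)
    fix x assume "x \<in> carrier N'"
    hence "x \<in> f ` carrier N" using img by simp
    then obtain y where "y \<in> carrier N" "x = f y" by blast
    thus "?g x \<in> carrier N" using gf by simp
  next
    fix x x' assume "x \<in> carrier N'" "x' \<in> carrier N'"
    hence "x \<in> f ` carrier N" "x' \<in> f ` carrier N" using img by simp_all
    then obtain y y' where y: "y \<in> carrier N" "x = f y" "y' \<in> carrier N" "x' = f y'" by blast
    hence "x \<oplus>\<^bsub>N'\<^esub> x' = f (y \<oplus>\<^bsub>N\<^esub> y')" using lmod_homD(2)[OF f] by simp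
    thus "?g (x \<oplus>\<^bsub>N'\<^esub> x') = ?g x \<oplus>\<^bsub>N\<^esub> ?g x'" using y gf by simp
  next
    fix a x assume a: "a \<in> carrier A" and "x \<in> carrier N'"
    hence "x \<in> f ` carrier N" using img by simp
    then obtain y where y: "y \<in> carrier N" "x = f y" by blast
    hence "a \<odot>\<^bsub>N'\<^esub> x = f (a \<odot>\<^bsub>N\<^esub> y)" using lmod_homD(3)[OF f a] by simp
    thus "?g (a \<odot>\<^bsub>N'\<^esub> x) = a \<odot>\<^bsub>N\<^esub> ?g x" using y gf a N.smult_closed by simp
  qed
  moreover have "?g x \<in> H n" if "x \<in> H' n" for x n
  proof -
    have "x \<in> f ` H n" using that H(2) by simp
    then obtain y where "y \<in> H n" "x = f y" by blast
    thus ?thesis using gf H(1)[of n] by auto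
  qed
  ultimately have "?g \<in> graded_hom A N' H' N H" by (auto simp: graded_hom_def)
  moreover have "\<zero>\<^bsub>N'\<^esub> \<in> carrier N'" using lmod_homD(1)[OF f N.zero_closed] zero by simp
  moreover have "?g \<zero>\<^bsub>N'\<^esub> = \<zero>\<^bsub>N\<^esub>" using gf[OF N.zero_closed] zero by simp
  ultimately show "\<exists>\<epsilon>. linear_resolution A Ag N H M G d \<epsilon>" if "\<exists>\<epsilon>. linear_resolution A Ag N' H' M G d \<epsilon>"
    using that linear_resolution_transfer bij_betw_the_inv_into[OF bij] by blast
qed

text \<open>Elements of the generating component of a linear resolution are determined by their boundary:
  the kernel of the boundary map is the image of a module generated in the next degree, so it has no
  components in the degree of the generators.\<close>

lemma linear_resolution_bottom_inj:
  assumes A: "connected_ring A R Ag" and L: "linear_resolution A Ag N H M G d \<epsilon>"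
  shows "x \<in> G 0 0 \<Longrightarrow> \<epsilon> x = \<zero>\<^bsub>N\<^esub> \<Longrightarrow> x = \<zero>\<^bsub>M 0\<^esub>"
    and "x \<in> G (Suc n) (Suc n) \<Longrightarrow> d n x = \<zero>\<^bsub>M n\<^esub> \<Longrightarrow> x = \<zero>\<^bsub>M (Suc n)\<^esub>"
proof -
  note L' = linear_resolutionD[OF L]
  have *: "x = \<zero>\<^bsub>M n\<^esub>" if y: "y \<in> carrier (M (Suc n))" "d n y = x" and x: "x \<in> G n n" for n x y
  proof -
    have "x = homogeneous_part (M n) (G n) n (d n y)"
      using homogeneous_part_homogeneous[OF graded_moduleD(2,3)[OF L'(1)] x] y by simp
    also have "\<dots> = d n (homogeneous_part (M (Suc n)) (G (Suc n)) n y)"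
      by (rule graded_hom_homogeneous_part[OF L'(1) L'(1) L'(4) y(1), symmetric])
    also have "homogeneous_part (M (Suc n)) (G (Suc n)) n y = \<zero>\<^bsub>M (Suc n)\<^esub>"
      by (rule generated_in_degree_vanishing[OF A L'(1,11) _ y(1)]) simp
    also have "d n \<zero>\<^bsub>M (Suc n)\<^esub> = \<zero>\<^bsub>M n\<^esub>"
      by (rule lmod_hom_zero[OF L'(3) L'(3) graded_homD(1)[OF L'(4)]])
    finally show ?thesis .
  qed
  show "x \<in> G 0 0 \<Longrightarrow> \<epsilon> x = \<zero>\<^bsub>N\<^esub> \<Longrightarrow> x = \<zero>\<^bsub>M 0\<^esub>"
    using * L'(8) graded_moduleD(4)[OF L'(1)] by blast
  show "x \<in> G (Suc n) (Suc n) \<Longrightarrow> d n x = \<zero>\<^bsub>M n\<^esub> \<Longrightarrow> x = \<zero>\<^bsub>M (Suc n)\<^esub>"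
    using * L'(10) graded_moduleD(4)[OF L'(1)] by blast
qed

text \<open>The comparison theorem of homological algebra. In order to lift \<open>\<rho> n \<circ> d n\<close> along
  \<open>dL n\<close>, its values must be boundaries in \<open>L\<close>; this is the property carried along by the recursion.\<close>

lemma comparison_map:
  fixes A :: "('r, 'b) ring_scheme" and M L :: "nat \<Rightarrow> ('r, 'm) module" and N N' :: "('r, 'm) module"
  assumes A: "connected_ring A R Ag" and one: "\<one>\<^bsub>A\<^esub> \<noteq> \<zero>\<^bsub>A\<^esub>"
    and M: "linear_resolution A Ag N H M G d \<epsilon>"
    and L: "linear_resolution A Ag N' H' L GL dL \<eta>"
    and N': "graded_module A Ag N' H'" and f: "f \<in> graded_hom A N H N' H'"
  shows "\<exists>\<rho>. (\<forall>n. \<rho> n \<in> graded_hom A (M n) (G n) (L n) (GL n)) \<and>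
    (\<forall>x \<in> carrier (M 0). \<eta> (\<rho> 0 x) = f (\<epsilon> x)) \<and>
    (\<forall>n. \<forall>x \<in> carrier (M (Suc n)). dL n (\<rho> (Suc n) x) = \<rho> n (d n x))"
proof -
  note M' = linear_resolutionD[OF M] and L' = linear_resolutionD[OF L]
  define P where "P n \<rho> \<longleftrightarrow> \<rho> \<in> graded_hom A (M n) (G n) (L n) (GL n) \<and>
    (\<forall>x \<in> carrier (M (Suc n)). \<rho> (d n x) \<in> dL n ` carrier (L (Suc n))) \<and>
    (n = 0 \<longrightarrow> (\<forall>x \<in> carrier (M 0). \<eta> (\<rho> x) = f (\<epsilon> x)))" for n \<rho>
  have dc: "d n x \<in> carrier (M n)" if "x \<in> carrier (M (Suc n))" for n x
    using graded_hom_closed[OF M'(4) that] .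
  have fz: "f \<zero>\<^bsub>N\<^esub> = \<zero>\<^bsub>N'\<^esub>"
  proof -
    have "(\<lambda>x. f (\<epsilon> x)) \<zero>\<^bsub>M 0\<^esub> = \<zero>\<^bsub>N'\<^esub>"
      by (rule lmod_hom_zero[OF M'(3) graded_moduleD(1)[OF N'] graded_homD(1)[OF graded_hom_comp[OF M'(5) f]]])
    moreover have "\<epsilon> \<zero>\<^bsub>M 0\<^esub> = \<zero>\<^bsub>N\<^esub>"
    proof -
      have "\<zero>\<^bsub>M (Suc 0)\<^esub> \<in> carrier (M (Suc 0))"
        using left_moduleD(2)[OF M'(3)[of "Suc 0"]] by (simp add: abelian_group_def abelian_monoid.zero_closed)
      from M'(7)[OF this] lmod_hom_zero[OF M'(3) M'(3) graded_homD(1)[OF M'(4)]] show ?thesis by simp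
    qed
    ultimately show ?thesis by simp
  qed
  have "\<exists>k \<in> graded_hom A (M 0) (G 0) (L 0) (GL 0). \<forall>x \<in> carrier (M 0). \<eta> (k x) = f (\<epsilon> x)"
    using L'(6) graded_hom_closed[OF graded_hom_comp[OF M'(5) f]]
    by (intro projective_graded_lift[OF A one M'(2) M'(1) L'(1) N' L'(5) graded_hom_comp[OF M'(5) f]])
      auto
  then obtain k where k: "k \<in> graded_hom A (M 0) (G 0) (L 0) (GL 0)"
    "\<And>x. x \<in> carrier (M 0) \<Longrightarrow> \<eta> (k x) = f (\<epsilon> x)" by blast
  have "k (d 0 x) \<in> dL 0 ` carrier (L (Suc 0))" if "x \<in> carrier (M (Suc 0))" for x
  proof -
    have "\<exists>y \<in> carrier (L (Suc 0)). dL 0 y = k (d 0 x)"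
      using graded_hom_closed[OF k(1) dc[OF that]] k(2)[OF dc[OF that]] M'(7)[OF that] fz
      by (intro L'(8)) simp_all
    thus ?thesis by (metis image_eqI)
  qed
  hence "P 0 k" using k by (simp add: P_def)
  hence base: "\<exists>\<rho>. P 0 \<rho>" by blast
  have "\<exists>\<rho>'. P (Suc n) \<rho>' \<and> (\<forall>x \<in> carrier (M (Suc n)). dL n (\<rho>' x) = \<rho> (d n x))"
    if \<rho>: "P n \<rho>" for n \<rho>
  proof -
    have \<rho>1: "\<rho> \<in> graded_hom A (M n) (G n) (L n) (GL n)" using \<rho> by (simp add: P_def)
    have "\<exists>k \<in> graded_hom A (M (Suc n)) (G (Suc n)) (L (Suc n)) (GL (Suc n)).
        \<forall>x \<in> carrier (M (Suc n)). dL n (k x) = \<rho> (d n x)"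
      using \<rho> by (intro projective_graded_lift[OF A one M'(2) M'(1) L'(1) L'(1) L'(4)
          graded_hom_comp[OF M'(4) \<rho>1]]) (auto simp: P_def)
    then obtain k where k: "k \<in> graded_hom A (M (Suc n)) (G (Suc n)) (L (Suc n)) (GL (Suc n))"
      "\<And>x. x \<in> carrier (M (Suc n)) \<Longrightarrow> dL n (k x) = \<rho> (d n x)" by blast
    have "k (d (Suc n) x) \<in> dL (Suc n) ` carrier (L (Suc (Suc n)))"
      if "x \<in> carrier (M (Suc (Suc n)))" for x
    proof -
      have "\<exists>y \<in> carrier (L (Suc (Suc n))). dL (Suc n) y = k (d (Suc n) x)"
        using graded_hom_closed[OF k(1) dc[OF that]] k(2)[OF dc[OF that]] M'(9)[OF that]
          lmod_hom_zero[OF M'(3) L'(3) graded_homD(1)[OF \<rho>1]]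
        by (intro L'(10)) simp_all
      thus ?thesis by (metis image_eqI)
    qed
    hence "P (Suc n) k" using k(1) by (simp add: P_def)
    thus ?thesis using k(2) by blast
  qed
  from dependent_nat_choice[of P "\<lambda>n \<rho> \<rho>'. \<forall>x \<in> carrier (M (Suc n)). dL n (\<rho>' x) = \<rho> (d n x)",
      OF base this]
  obtain \<rho> where "\<And>n. P n (\<rho> n)"
    "\<And>n. \<forall>x \<in> carrier (M (Suc n)). dL n (\<rho> (Suc n) x) = \<rho> n (d n x)" by blast
  thus ?thesis by (intro exI[of _ \<rho>]) (simp add: P_def)
qed

text \<open>Linear resolutions are rigid. By induction on \<open>n\<close>, a generator of \<open>L n\<close> and its image have the same
  boundary, and generators are determined by their boundaries.\<close>

lemma chain_endomorphism_id:
  assumes A: "connected_ring A R Ag" and L: "linear_resolution A Ag N H L G d \<epsilon>"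
    and N: "left_module A N"
    and \<phi>: "\<And>n. \<phi> n \<in> graded_hom A (L n) (G n) (L n) (G n)"
    and aug: "\<And>x. x \<in> carrier (L 0) \<Longrightarrow> \<epsilon> (\<phi> 0 x) = \<epsilon> x"
    and chain: "\<And>n x. x \<in> carrier (L (Suc n)) \<Longrightarrow> d n (\<phi> (Suc n) x) = \<phi> n (d n x)"
    and x: "x \<in> carrier (L n)"
  shows "\<phi> n x = x"
  using x
proof (induction n arbitrary: x)
  note L' = linear_resolutionD[OF L]
  have ext: "\<phi> n x = x" if "\<And>y. y \<in> G n n \<Longrightarrow> \<phi> n y = y" "x \<in> carrier (L n)" for n x
  proof -
    have "(\<lambda>x. x) \<in> lmod_hom A (L n) (L n)" by (simp add: lmod_hom_def)
    from generated_by_hom_eq[OF L'(3) L'(3) graded_homD(1)[OF \<phi>] this L'(11) graded_moduleD(4)[OF L'(1)]]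
    show ?thesis using that by blast
  qed
  have diff: "\<phi> n y \<oplus>\<^bsub>L n\<^esub> \<ominus>\<^bsub>L n\<^esub> y \<in> G n n" if "y \<in> G n n" for n y
    using that graded_homD(2)[OF \<phi>] grade_closed(3,4)[OF graded_moduleD(2,3)[OF L'(1)]] by blast
  have diff0: "\<phi> n y = y" if "y \<in> G n n" "\<phi> n y \<oplus>\<^bsub>L n\<^esub> \<ominus>\<^bsub>L n\<^esub> y = \<zero>\<^bsub>L n\<^esub>" for n y
  proof -
    have "y \<in> carrier (L n)" using that(1) graded_moduleD(4)[OF L'(1)] by blast
    from eq_of_add_minus[OF graded_moduleD(2)[OF L'(1)] graded_hom_closed[OF \<phi> this] this that(2)]
    show ?thesis .
  qed
  {
    case 0
    show ?case
    proof (rule ext[OF diff0 0])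
      fix y assume y: "y \<in> G 0 0"
      hence yc: "y \<in> carrier (L 0)" using graded_moduleD(4)[OF L'(1)] by blast
      hence "\<epsilon> (\<phi> 0 y \<oplus>\<^bsub>L 0\<^esub> \<ominus>\<^bsub>L 0\<^esub> y) = \<epsilon> y \<oplus>\<^bsub>N\<^esub> \<ominus>\<^bsub>N\<^esub> \<epsilon> y"
        using lmod_hom_diff[OF L'(3) N graded_homD(1)[OF L'(5)]] aug
          graded_hom_closed[OF \<phi>] by simp
      also have "\<dots> = \<zero>\<^bsub>N\<^esub>"
        using abelian_group.r_neg[OF left_moduleD(2)[OF N]] graded_hom_closed[OF L'(5) yc] by blast
      finally show "\<phi> 0 y \<oplus>\<^bsub>L 0\<^esub> \<ominus>\<^bsub>L 0\<^esub> y = \<zero>\<^bsub>L 0\<^esub>"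
        using linear_resolution_bottom_inj(1)[OF A L diff[OF y]] by blast
    qed
  next
    case (Suc n)
    show ?case
    proof (rule ext[OF diff0 Suc.prems])
      fix y assume y: "y \<in> G (Suc n) (Suc n)"
      hence yc: "y \<in> carrier (L (Suc n))" using graded_moduleD(4)[OF L'(1)] by blast
      hence dy: "d n y \<in> carrier (L n)" by (rule graded_hom_closed[OF L'(4)])
      have "d n (\<phi> (Suc n) y \<oplus>\<^bsub>L (Suc n)\<^esub> \<ominus>\<^bsub>L (Suc n)\<^esub> y) = d n y \<oplus>\<^bsub>L n\<^esub> \<ominus>\<^bsub>L n\<^esub> d n y"
        using lmod_hom_diff[OF L'(3) L'(3) graded_homD(1)[OF L'(4)]] chain[OF yc] Suc.IH[OF dy] yc
          graded_hom_closed[OF \<phi>] by simp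
      also have "\<dots> = \<zero>\<^bsub>L n\<^esub>"
        using abelian_group.r_neg[OF left_moduleD(2)[OF L'(3)]] dy by blast
      finally show "\<phi> (Suc n) y \<oplus>\<^bsub>L (Suc n)\<^esub> \<ominus>\<^bsub>L (Suc n)\<^esub> y = \<zero>\<^bsub>L (Suc n)\<^esub>"
        using linear_resolution_bottom_inj(2)[OF A L diff[OF y]] by blast
    qed
  }
qed

section \<open>Splitting and adding linear resolutions\<close>

lemma projective_retract:
  fixes M X :: "('r, 'm) module"
  assumes M: "projective_module A M" and X: "left_module A X"
    and i: "i \<in> lmod_hom A X M" and p: "p \<in> lmod_hom A M X"
    and pi: "\<And>x. x \<in> carrier X \<Longrightarrow> p (i x) = x"
  shows "projective_module A X"
  unfolding projective_module_def
proof (intro conjI X allI impI)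
  fix N :: "('r, 'm \<Rightarrow> 'r) module" and L :: "('r, 'm) module" and g h
  assume N: "left_module A N" and L: "left_module A L" and g: "g \<in> lmod_hom A N L"
    and surj: "g ` carrier N = carrier L" and h: "h \<in> lmod_hom A X L"
  obtain k where k: "k \<in> lmod_hom A M N" "\<forall>x \<in> carrier M. g (k x) = h (p x)"
    using M N L g surj lmod_hom_comp[OF p h] unfolding projective_module_def by blast
  show "\<exists>k \<in> lmod_hom A X N. \<forall>x \<in> carrier X. g (k x) = h x"
    using lmod_hom_comp[OF i k(1)] k(2) lmod_homD(1)[OF i] pi
    by (intro bexI[of _ "\<lambda>x. k (i x)"]) auto
qed

lemma lmod_hom_sum:
  assumes N: "left_module A N" and f: "f \<in> lmod_hom A M N" and g: "g \<in> lmod_hom A M N"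
  shows "(\<lambda>x. f x \<oplus>\<^bsub>N\<^esub> g x) \<in> lmod_hom A M N"
proof -
  interpret N: left_module A N by (rule N)
  show ?thesis
    using lmod_homD[OF f] lmod_homD[OF g]
    by (intro lmod_homI) (auto simp: N.smult_r_distr N.M.a_ac)
qed

lemma projective_sum:
  fixes M1 M2 D :: "('r, 'm) module"
  assumes M1: "projective_module A M1" and M2: "projective_module A M2" and D: "left_module A D"
    and i: "ia \<in> lmod_hom A M1 D" "ib \<in> lmod_hom A M2 D"
    and p: "pa \<in> lmod_hom A D M1" "pb \<in> lmod_hom A D M2"
    and ip: "\<And>x. x \<in> carrier D \<Longrightarrow> ia (pa x) \<oplus>\<^bsub>D\<^esub> ib (pb x) = x"
  shows "projective_module A D"
  unfolding projective_module_def
proof (intro conjI D allI impI)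
  fix N :: "('r, 'm \<Rightarrow> 'r) module" and L :: "('r, 'm) module" and g h
  assume N: "left_module A N" and L: "left_module A L" and g: "g \<in> lmod_hom A N L"
    and surj: "g ` carrier N = carrier L" and h: "h \<in> lmod_hom A D L"
  obtain k1 where k1: "k1 \<in> lmod_hom A M1 N" "\<forall>x \<in> carrier M1. g (k1 x) = h (ia x)"
    using M1 N L g surj lmod_hom_comp[OF i(1) h] unfolding projective_module_def by blast
  obtain k2 where k2: "k2 \<in> lmod_hom A M2 N" "\<forall>x \<in> carrier M2. g (k2 x) = h (ib x)"
    using M2 N L g surj lmod_hom_comp[OF i(2) h] unfolding projective_module_def by blast
  have k: "(\<lambda>x. k1 (pa x) \<oplus>\<^bsub>N\<^esub> k2 (pb x)) \<in> lmod_hom A D N"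
    by (intro lmod_hom_sum N lmod_hom_comp[OF p(1) k1(1)] lmod_hom_comp[OF p(2) k2(1)])
  have "g (k1 (pa x) \<oplus>\<^bsub>N\<^esub> k2 (pb x)) = h x" if x: "x \<in> carrier D" for x
  proof -
    have c: "pa x \<in> carrier M1" "pb x \<in> carrier M2" using lmod_homD(1)[OF p(1) x] lmod_homD(1)[OF p(2) x] .
    have "g (k1 (pa x) \<oplus>\<^bsub>N\<^esub> k2 (pb x)) = h (ia (pa x)) \<oplus>\<^bsub>L\<^esub> h (ib (pb x))"
      using lmod_homD(2)[OF g lmod_homD(1)[OF k1(1) c(1)] lmod_homD(1)[OF k2(1) c(2)]] k1(2) k2(2) c by simp
    also have "\<dots> = h (ia (pa x) \<oplus>\<^bsub>D\<^esub> ib (pb x))"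
      using lmod_homD(2)[OF h lmod_homD(1)[OF i(1) c(1)] lmod_homD(1)[OF i(2) c(2)]] by simp
    finally show ?thesis using ip[OF x] by simp
  qed
  thus "\<exists>k \<in> lmod_hom A D N. \<forall>x \<in> carrier D. g (k x) = h x" by (intro bexI[OF _ k] ballI)
qed

text \<open>Lift \<open>\<pi>\<close> and \<open>\<iota>\<close> to chain maps \<open>\<rho>\<close> and \<open>\<sigma>\<close>. The composition \<open>\<rho> \<sigma>\<close> lifts the identity of \<open>N''\<close>,
  so it is the identity by rigidity. Hence \<open>1 - \<sigma> \<rho>\<close> is a projection of complexes onto the kernel of
  \<open>\<rho>\<close>, and the kernel inherits projectivity, exactness and generation in one degree from \<open>M\<close>.\<close>

lemma linear_resolution_summand:
  fixes A :: "('r, 'b) ring_scheme" and M L :: "nat \<Rightarrow> ('r, 'm) module" and N N'' :: "('r, 'm) module"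
  assumes A: "connected_ring A R Ag" and one: "\<one>\<^bsub>A\<^esub> \<noteq> \<zero>\<^bsub>A\<^esub>"
    and N: "graded_module A Ag N H" and N'': "graded_module A Ag N'' H''"
    and \<pi>: "\<pi> \<in> graded_hom A N H N'' H''" and \<iota>: "\<iota> \<in> graded_hom A N'' H'' N H"
    and \<pi>\<iota>: "\<And>x. x \<in> carrier N'' \<Longrightarrow> \<pi> (\<iota> x) = x"
    and M: "linear_resolution A Ag N H M G d \<epsilon>"
    and L: "linear_resolution A Ag N'' H'' L GL dL \<eta>"
  shows "\<exists>(X :: nat \<Rightarrow> ('r, 'm) module) GX. linear_resolution A Ag
    (N\<lparr>carrier := a_kernel N N'' \<pi>\<rparr>) (\<lambda>n. H n \<inter> a_kernel N N'' \<pi>) X GX d \<epsilon>"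
proof -
  note M' = linear_resolutionD[OF M] and L' = linear_resolutionD[OF L]
  obtain \<rho> where \<rho>: "\<And>n. \<rho> n \<in> graded_hom A (M n) (G n) (L n) (GL n)"
    "\<And>x. x \<in> carrier (M 0) \<Longrightarrow> \<eta> (\<rho> 0 x) = \<pi> (\<epsilon> x)"
    "\<And>n x. x \<in> carrier (M (Suc n)) \<Longrightarrow> dL n (\<rho> (Suc n) x) = \<rho> n (d n x)"
    using comparison_map[OF A one M L N'' \<pi>] by blast
  obtain \<sigma> where \<sigma>: "\<And>n. \<sigma> n \<in> graded_hom A (L n) (GL n) (M n) (G n)"
    "\<And>x. x \<in> carrier (L 0) \<Longrightarrow> \<epsilon> (\<sigma> 0 x) = \<iota> (\<eta> x)"
    "\<And>n x. x \<in> carrier (L (Suc n)) \<Longrightarrow> d n (\<sigma> (Suc n) x) = \<sigma> n (dL n x)"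
    using comparison_map[OF A one L M N \<iota>] by blast
  have c: "\<rho> n x \<in> carrier (L n)" if "x \<in> carrier (M n)" for n x
    by (rule graded_hom_closed[OF \<rho>(1) that])
  have c': "\<sigma> n x \<in> carrier (M n)" if "x \<in> carrier (L n)" for n x
    by (rule graded_hom_closed[OF \<sigma>(1) that])
  have dc: "d n x \<in> carrier (M n)" if "x \<in> carrier (M (Suc n))" for n x
    by (rule graded_hom_closed[OF M'(4) that])
  have dLc: "dL n x \<in> carrier (L n)" if "x \<in> carrier (L (Suc n))" for n x
    by (rule graded_hom_closed[OF L'(4) that])
  have \<epsilon>c: "\<epsilon> x \<in> carrier N" if "x \<in> carrier (M 0)" for x
    by (rule graded_hom_closed[OF M'(5) that])
  have \<eta>c: "\<eta> x \<in> carrier N''" if "x \<in> carrier (L 0)" for x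
    by (rule graded_hom_closed[OF L'(5) that])
  have \<rho>\<sigma>: "\<rho> n (\<sigma> n x) = x" if x: "x \<in> carrier (L n)" for n x
  proof (rule chain_endomorphism_id[OF A L graded_moduleD(1)[OF N''] _ _ _ x])
    show "(\<lambda>x. \<rho> n (\<sigma> n x)) \<in> graded_hom A (L n) (GL n) (L n) (GL n)" for n
      by (rule graded_hom_comp[OF \<sigma>(1) \<rho>(1)])
    show "\<eta> (\<rho> 0 (\<sigma> 0 x)) = \<eta> x" if "x \<in> carrier (L 0)" for x
      using \<rho>(2)[OF c'[OF that]] \<sigma>(2)[OF that] \<pi>\<iota>[OF \<eta>c[OF that]] by simp
    show "dL n (\<rho> (Suc n) (\<sigma> (Suc n) x)) = \<rho> n (\<sigma> n (dL n x))" if "x \<in> carrier (L (Suc n))" for n x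
      using \<rho>(3)[OF c'[OF that]] \<sigma>(3)[OF that] by simp
  qed
  define K where "K n = a_kernel (M n) (L n) (\<rho> n)" for n
  have K: "x \<in> K n \<longleftrightarrow> x \<in> carrier (M n) \<and> \<rho> n x = \<zero>\<^bsub>L n\<^esub>" for n x
    by (simp add: K_def in_a_kernel)
  define X where "X n = (M n)\<lparr>carrier := K n\<rparr>" for n
  have subK: "submodule (K n) A (M n)" for n
    unfolding K_def by (rule submodule_a_kernel[OF M'(3) L'(3) graded_homD(1)[OF \<rho>(1)]])
  have subN: "submodule (a_kernel N N'' \<pi>) A N"
    by (rule submodule_a_kernel[OF graded_moduleD(1)[OF N] graded_moduleD(1)[OF N''] graded_homD(1)[OF \<pi>]])
  have gX: "graded_module A Ag (X n) (\<lambda>m. G n m \<inter> K n)" for n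
    unfolding X_def
  proof (rule graded_submodule[OF A M'(1) subK])
    show "homogeneous_part (M n) (G n) m x \<in> K n" if "x \<in> K n" for m x
      using that graded_hom_homogeneous_part[OF M'(1) L'(1) \<rho>(1)]
        homogeneous_part_closed[OF graded_moduleD(2,3)[OF M'(1)]]
        homogeneous_part_zero[OF graded_moduleD(2,3)[OF L'(1)]] by (auto simp: K)
  qed
  \<comment> \<open>The projection of \<open>M n\<close> onto the kernel of \<open>\<rho> n\<close> along the image of \<open>\<sigma> n\<close>.\<close>
  define q where "q n x = x \<oplus>\<^bsub>M n\<^esub> \<ominus>\<^bsub>M n\<^esub> \<sigma> n (\<rho> n x)" for n x
  have qK: "q n x \<in> K n" if x: "x \<in> carrier (M n)" for n x
  proof -
    interpret Mn: left_module A "M n" by (rule M'(3))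
    interpret Ln: left_module A "L n" by (rule L'(3))
    have "\<rho> n (q n x) = \<rho> n x \<oplus>\<^bsub>L n\<^esub> \<ominus>\<^bsub>L n\<^esub> \<rho> n x"
      using lmod_hom_diff[OF M'(3) L'(3) graded_homD(1)[OF \<rho>(1)] x c'[OF c[OF x]]] \<rho>\<sigma>[OF c[OF x]]
      by (simp add: q_def)
    thus ?thesis using c[OF x] c'[OF c[OF x]] x by (simp add: K q_def Ln.r_neg)
  qed
  have q_id: "q n x = x" if x: "x \<in> K n" for n x
  proof -
    interpret Mn: left_module A "M n" by (rule M'(3))
    show ?thesis using that lmod_hom_zero[OF L'(3) M'(3) graded_homD(1)[OF \<sigma>(1)]]
      by (simp add: q_def K)
  qed
  have q_hom: "q n \<in> lmod_hom A (M n) (X n)" for n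
  proof -
    interpret Mn: left_module A "M n" by (rule M'(3))
    note \<rho>h = lmod_homD[OF graded_homD(1)[OF \<rho>(1)]] and \<sigma>h = lmod_homD[OF graded_homD(1)[OF \<sigma>(1)]]
    show ?thesis
    proof (intro lmod_homI)
      fix x y assume xy: "x \<in> carrier (M n)" "y \<in> carrier (M n)"
      show "q n (x \<oplus>\<^bsub>M n\<^esub> y) = q n x \<oplus>\<^bsub>X n\<^esub> q n y"
        using xy c c' \<rho>h(2) \<sigma>h(2) by (simp add: q_def X_def Mn.minus_add Mn.a_ac)
    next
      fix a x assume a: "a \<in> carrier A" and x: "x \<in> carrier (M n)"
      thus "q n (a \<odot>\<^bsub>M n\<^esub> x) = a \<odot>\<^bsub>X n\<^esub> q n x"
        using c[OF x] c'[OF c[OF x]] by (simp add: q_def X_def \<rho>h(3) \<sigma>h(3) Mn.smult_r_distr Mn.smult_minus_right)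
    qed (simp add: qK X_def)
  qed
  have pX: "projective_module A (X n)" for n
  proof (rule projective_retract[OF M'(2) graded_moduleD(1)[OF gX] _ q_hom])
    show "(\<lambda>x. x) \<in> lmod_hom A (X n) (M n)"
      by (intro lmod_homI) (auto simp: X_def K)
  qed (simp add: q_id X_def)
  have dX: "d n \<in> graded_hom A (X (Suc n)) (\<lambda>m. G (Suc n) m \<inter> K (Suc n)) (X n) (\<lambda>m. G n m \<inter> K n)" for n
  proof -
    have dK: "d n x \<in> K n" if "x \<in> K (Suc n)" for x
      using that \<rho>(3)[of x n] lmod_hom_zero[OF L'(3) L'(3) graded_homD(1)[OF L'(4)]] dc by (auto simp: K)
    show ?thesis
      using dK lmod_homD[OF graded_homD(1)[OF M'(4)[of n]]] graded_homD(2)[OF M'(4)[of n]]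
      by (auto simp: graded_hom_def X_def K intro!: lmod_homI)
  qed
  have \<epsilon>K: "\<epsilon> x \<in> a_kernel N N'' \<pi>" if "x \<in> K 0" for x
    using that \<rho>(2)[of x] \<epsilon>c lmod_hom_zero[OF L'(3) graded_moduleD(1)[OF N''] graded_homD(1)[OF L'(5)]]
    by (auto simp: in_a_kernel K)
  have zN: "\<sigma> n \<zero>\<^bsub>L n\<^esub> = \<zero>\<^bsub>M n\<^esub>" for n by (rule lmod_hom_zero[OF L'(3) M'(3) graded_homD(1)[OF \<sigma>(1)]])
  have "linear_resolution A Ag (N\<lparr>carrier := a_kernel N N'' \<pi>\<rparr>) (\<lambda>n. H n \<inter> a_kernel N N'' \<pi>)
    X (\<lambda>n m. G n m \<inter> K n) d \<epsilon>"
  proof (rule linear_resolutionI)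
    show "graded_module A Ag (X n) (\<lambda>m. G n m \<inter> K n)" "projective_module A (X n)"
      "d n \<in> graded_hom A (X (Suc n)) (\<lambda>m. G (Suc n) m \<inter> K (Suc n)) (X n) (\<lambda>m. G n m \<inter> K n)" for n
      by (rule gX pX dX)+
    show "\<epsilon> \<in> graded_hom A (X 0) (\<lambda>m. G 0 m \<inter> K 0)
        (N\<lparr>carrier := a_kernel N N'' \<pi>\<rparr>) (\<lambda>n. H n \<inter> a_kernel N N'' \<pi>)"
      using \<epsilon>K lmod_homD[OF graded_homD(1)[OF M'(5)]] graded_homD(2)[OF M'(5)]
      by (auto simp: graded_hom_def X_def K intro!: lmod_homI)
    have "\<exists>x \<in> K 0. \<epsilon> x = y" if y: "y \<in> a_kernel N N'' \<pi>" for y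
    proof -
      interpret N: left_module A N by (rule graded_moduleD(1)[OF N])
      from y have yc: "y \<in> carrier N" "\<pi> y = \<zero>\<^bsub>N''\<^esub>" by (auto simp: in_a_kernel)
      hence "y \<in> \<epsilon> ` carrier (M 0)" using M'(6) by simp
      then obtain x where x: "x \<in> carrier (M 0)" "\<epsilon> x = y" by auto
      have "\<epsilon> (q 0 x) = \<epsilon> x \<oplus>\<^bsub>N\<^esub> \<ominus>\<^bsub>N\<^esub> \<epsilon> (\<sigma> 0 (\<rho> 0 x))"
        unfolding q_def
        by (rule lmod_hom_diff[OF M'(3) graded_moduleD(1)[OF N] graded_homD(1)[OF M'(5)] x(1) c'[OF c[OF x(1)]]])
      also have "\<epsilon> (\<sigma> 0 (\<rho> 0 x)) = \<zero>\<^bsub>N\<^esub>"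
        using \<sigma>(2)[OF c[OF x(1)]] \<rho>(2)[OF x(1)] x(2) yc(2)
          lmod_hom_zero[OF graded_moduleD(1)[OF N''] graded_moduleD(1)[OF N] graded_homD(1)[OF \<iota>]] by simp
      finally show ?thesis using qK[OF x(1)] x yc by (intro bexI[of _ "q 0 x"]) auto
    qed
    thus "\<epsilon> ` carrier (X 0) = carrier (N\<lparr>carrier := a_kernel N N'' \<pi>\<rparr>)"
      using \<epsilon>K by (fastforce simp: X_def)
    \<comment> \<open>A preimage in \<open>M\<close> of an element of the kernel can be corrected to one in the kernel.\<close>
    have lift: "\<exists>x \<in> carrier (X (Suc n)). d n x = y"
      if y: "y \<in> K n" and x: "x \<in> carrier (M (Suc n))" "d n x = y" for n x y
    proof -
      interpret Mn: left_module A "M n" by (rule M'(3))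
      have "d n (q (Suc n) x) = d n x \<oplus>\<^bsub>M n\<^esub> \<ominus>\<^bsub>M n\<^esub> d n (\<sigma> (Suc n) (\<rho> (Suc n) x))"
        unfolding q_def
        by (rule lmod_hom_diff[OF M'(3) M'(3) graded_homD(1)[OF M'(4)] x(1) c'[OF c[OF x(1)]]])
      also have "d n (\<sigma> (Suc n) (\<rho> (Suc n) x)) = \<zero>\<^bsub>M n\<^esub>"
        using \<sigma>(3)[OF c[OF x(1)]] \<rho>(3)[OF x(1)] x(2) y by (simp add: K zN)
      finally have "d n (q (Suc n) x) = y" using x(2) y by (simp add: K)
      thus ?thesis using qK[OF x(1)] by (auto simp: X_def)
    qed
    show "\<epsilon> (d 0 x) = \<zero>\<^bsub>N\<lparr>carrier := a_kernel N N'' \<pi>\<rparr>\<^esub>" if "x \<in> carrier (X (Suc 0))" for x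
      using that M'(7) by (simp add: X_def K)
    show "\<exists>x \<in> carrier (X (Suc 0)). d 0 x = y"
      if "y \<in> carrier (X 0)" "\<epsilon> y = \<zero>\<^bsub>N\<lparr>carrier := a_kernel N N'' \<pi>\<rparr>\<^esub>" for y
      using that M'(8)[of y] lift[of y 0] by (auto simp: X_def K)
    show "d n (d (Suc n) x) = \<zero>\<^bsub>X n\<^esub>" if "x \<in> carrier (X (Suc (Suc n)))" for n x
      using that M'(9) by (simp add: X_def K)
    show "\<exists>x \<in> carrier (X (Suc (Suc n))). d (Suc n) x = y"
      if "y \<in> carrier (X (Suc n))" "d n y = \<zero>\<^bsub>X n\<^esub>" for n y
      using that M'(10)[of y n] lift[of y "Suc n"] by (auto simp: X_def K)
    show "generated_by A (X n) (G n n \<inter> K n)" for n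
    proof (rule generated_byI[OF graded_moduleD(1)[OF gX]])
      show "G n n \<inter> K n \<subseteq> carrier (X n)" by (simp add: X_def)
      fix J x assume J: "submodule J A (X n)" "G n n \<inter> K n \<subseteq> J" and x: "x \<in> carrier (X n)"
      have "q n y \<in> G n n" if "y \<in> G n n" for y
        using that graded_homD(2)[OF \<sigma>(1)] graded_homD(2)[OF \<rho>(1)]
          grade_closed(3,4)[OF graded_moduleD(2,3)[OF M'(1)]] by (simp add: q_def)
      hence "G n n \<subseteq> {x \<in> carrier (M n). q n x \<in> J}"
        using graded_moduleD(6)[OF M'(1)] qK J(2) by blast
      from generated_byD[OF M'(11) submodule_vimage[OF M'(3) graded_moduleD(1)[OF gX] q_hom J(1)] this]
      have "q n x \<in> J" using x by (auto simp: X_def K)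
      thus "x \<in> J" using x q_id by (simp add: X_def)
    qed
  qed
  thus ?thesis by (intro exI)
qed

text \<open>A pair of sequences is encoded as one sequence, so that a direct sum of modules has the same
  element type as its summands.\<close>

definition interleave :: "(nat \<Rightarrow> 's) \<Rightarrow> (nat \<Rightarrow> 's) \<Rightarrow> nat \<Rightarrow> 's" where
  "interleave f g i = (if even i then f (i div 2) else g (i div 2))"

definition evens :: "(nat \<Rightarrow> 's) \<Rightarrow> nat \<Rightarrow> 's" where "evens f i = f (2 * i)"

definition odds :: "(nat \<Rightarrow> 's) \<Rightarrow> nat \<Rightarrow> 's" where "odds f i = f (Suc (2 * i))"

lemma evens_interleave [simp]: "evens (interleave f g) = f"
  and odds_interleave [simp]: "odds (interleave f g) = g"
  by (auto simp: evens_def odds_def interleave_def)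

lemma interleave_evens_odds [simp]: "interleave (evens f) (odds f) = f"
  by (rule ext) (auto simp: evens_def odds_def interleave_def)

lemma interleave_eq_iff: "interleave f g = interleave f' g' \<longleftrightarrow> f = f' \<and> g = g'"
  by (metis evens_interleave odds_interleave)

definition direct_sum_module ::
    "('r, nat \<Rightarrow> 's) module \<Rightarrow> ('r, nat \<Rightarrow> 's) module \<Rightarrow> ('r, nat \<Rightarrow> 's) module" where
  "direct_sum_module M L = \<lparr>carrier = {f. evens f \<in> carrier M \<and> odds f \<in> carrier L},
     mult = undefined, one = undefined, zero = interleave \<zero>\<^bsub>M\<^esub> \<zero>\<^bsub>L\<^esub>,
     add = (\<lambda>f g. interleave (evens f \<oplus>\<^bsub>M\<^esub> evens g) (odds f \<oplus>\<^bsub>L\<^esub> odds g)),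
     smult = (\<lambda>a f. interleave (a \<odot>\<^bsub>M\<^esub> evens f) (a \<odot>\<^bsub>L\<^esub> odds f))\<rparr>"

definition direct_sum_grading :: "(nat \<Rightarrow> (nat \<Rightarrow> 's) set) \<Rightarrow> (nat \<Rightarrow> (nat \<Rightarrow> 's) set) \<Rightarrow> nat \<Rightarrow> (nat \<Rightarrow> 's) set"
  where "direct_sum_grading G H n = {f. evens f \<in> G n \<and> odds f \<in> H n}"

lemma left_module_direct_sum:
  assumes M: "left_module A M" and L: "left_module A L"
  shows "left_module A (direct_sum_module M L)"
proof -
  interpret M: left_module A M by (rule M)
  interpret L: left_module A L by (rule L)
  show ?thesis
  proof (intro left_module.intro abelian_groupI left_module_axioms.intro)
    show "ring A" by (rule M.R.ring_axioms)
    fix x assume "x \<in> carrier (direct_sum_module M L)"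
    thus "\<exists>y\<in>carrier (direct_sum_module M L). y \<oplus>\<^bsub>direct_sum_module M L\<^esub> x = \<zero>\<^bsub>direct_sum_module M L\<^esub>"
      by (intro bexI[of _ "interleave (\<ominus>\<^bsub>M\<^esub> evens x) (\<ominus>\<^bsub>L\<^esub> odds x)"])
        (auto simp: direct_sum_module_def M.M.l_neg L.M.l_neg)
  qed (auto simp: direct_sum_module_def M.M.a_ac L.M.a_ac M.smult_closed M.smult_l_distr M.smult_r_distr
      M.smult_assoc1 M.smult_one L.smult_closed L.smult_l_distr L.smult_r_distr L.smult_assoc1 L.smult_one)
qed

lemma direct_sum_homs:
  assumes M: "left_module A M" and L: "left_module A L"
  shows "(\<lambda>x. interleave x \<zero>\<^bsub>L\<^esub>) \<in> lmod_hom A M (direct_sum_module M L)"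
    "(\<lambda>x. interleave \<zero>\<^bsub>M\<^esub> x) \<in> lmod_hom A L (direct_sum_module M L)"
    "evens \<in> lmod_hom A (direct_sum_module M L) M"
    "odds \<in> lmod_hom A (direct_sum_module M L) L"
proof -
  interpret M: left_module A M by (rule M)
  interpret L: left_module A L by (rule L)
  show "(\<lambda>x. interleave x \<zero>\<^bsub>L\<^esub>) \<in> lmod_hom A M (direct_sum_module M L)"
    "(\<lambda>x. interleave \<zero>\<^bsub>M\<^esub> x) \<in> lmod_hom A L (direct_sum_module M L)"
    "evens \<in> lmod_hom A (direct_sum_module M L) M"
    "odds \<in> lmod_hom A (direct_sum_module M L) L"
    by (auto intro!: lmod_homI simp: direct_sum_module_def M.smult_zero_right L.smult_zero_right)
qed

lemma graded_module_direct_sum: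
  assumes M: "graded_module A Ag M G" and L: "graded_module A Ag L H"
  shows "graded_module A Ag (direct_sum_module M L) (direct_sum_grading G H)"
proof -
  note m = graded_moduleD[OF M] and l = graded_moduleD[OF L]
  let ?D = "direct_sum_module M L"
  have lm: "left_module A ?D" by (rule left_module_direct_sum[OF m(1) l(1)])
  have minus: "\<ominus>\<^bsub>?D\<^esub> x = interleave (\<ominus>\<^bsub>M\<^esub> evens x) (\<ominus>\<^bsub>L\<^esub> odds x)" if "x \<in> carrier ?D" for x
  proof -
    have "evens (\<ominus>\<^bsub>?D\<^esub> x) = \<ominus>\<^bsub>M\<^esub> evens x" "odds (\<ominus>\<^bsub>?D\<^esub> x) = \<ominus>\<^bsub>L\<^esub> odds x"
      using lmod_hom_minus[OF lm m(1) direct_sum_homs(3)[OF m(1) l(1)] that]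
        lmod_hom_minus[OF lm l(1) direct_sum_homs(4)[OF m(1) l(1)] that] .
    thus ?thesis by (metis interleave_evens_odds)
  qed
  have "internal_direct_sum ?D (direct_sum_grading G H)"
  proof (rule internal_direct_sumI[where
        c = "\<lambda>n x. interleave (homogeneous_part M G n (evens x)) (homogeneous_part L H n (odds x))"])
    show ab: "abelian_group ?D" by (rule left_moduleD(2)[OF lm])
    show "subgroup (direct_sum_grading G H n) (add_monoid ?D)" for n
    proof (rule additive_subgroupI[OF ab])
      show sub: "direct_sum_grading G H n \<subseteq> carrier ?D"
        using m(6) l(6) by (auto simp: direct_sum_grading_def direct_sum_module_def)
      show "\<ominus>\<^bsub>?D\<^esub> x \<in> direct_sum_grading G H n" if "x \<in> direct_sum_grading G H n" for x
        using that minus[of x] sub grade_closed(4)[OF m(2,3)] grade_closed(4)[OF l(2,3)]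
        by (auto simp: direct_sum_grading_def)
    qed (use grade_closed[OF m(2,3)] grade_closed[OF l(2,3)] in
        \<open>auto simp: direct_sum_grading_def direct_sum_module_def\<close>)
    fix x assume x: "x \<in> carrier ?D"
    hence xc: "evens x \<in> carrier M" "odds x \<in> carrier L" by (auto simp: direct_sum_module_def)
    show "finite {n. interleave (homogeneous_part M G n (evens x)) (homogeneous_part L H n (odds x)) \<noteq> \<zero>\<^bsub>?D\<^esub>}"
      using homogeneous_part_finite[OF m(2,3) xc(1)] homogeneous_part_finite[OF l(2,3) xc(2)]
      by (simp only: direct_sum_module_def interleave_eq_iff Collect_disj_eq de_Morgan_conj
          module.simps ring.simps finite_Un simp_thms)
    show "x = \<zero>\<^bsub>?D\<^esub>"
      if "\<And>n. interleave (homogeneous_part M G n (evens x)) (homogeneous_part L H n (odds x)) = \<zero>\<^bsub>?D\<^esub>"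
    proof -
      have "evens x = \<zero>\<^bsub>M\<^esub>" "odds x = \<zero>\<^bsub>L\<^esub>"
        using that homogeneous_part_eq_0[OF m(2,3) xc(1)] homogeneous_part_eq_0[OF l(2,3) xc(2)]
        by (auto simp: direct_sum_module_def interleave_eq_iff)
      hence "interleave (evens x) (odds x) = interleave \<zero>\<^bsub>M\<^esub> \<zero>\<^bsub>L\<^esub>" by simp
      thus ?thesis by (simp add: direct_sum_module_def)
    qed
  qed (auto simp: direct_sum_module_def direct_sum_grading_def homogeneous_part_in[OF m(2,3)]
      homogeneous_part_in[OF l(2,3)] homogeneous_part_add[OF m(2,3)] homogeneous_part_add[OF l(2,3)]
      homogeneous_part_homogeneous[OF m(2,3)] homogeneous_part_homogeneous[OF l(2,3)])
  moreover have "a \<odot>\<^bsub>?D\<^esub> x \<in> direct_sum_grading G H (p + n)"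
    if "a \<in> Ag p" "x \<in> direct_sum_grading G H n" for a x p n
    using that m(5) l(5) by (auto simp: direct_sum_module_def direct_sum_grading_def)
  ultimately show ?thesis using lm by (simp add: graded_module_def)
qed

lemma linear_resolution_direct_sum:
  fixes A :: "('r, 'b) ring_scheme" and M L :: "nat \<Rightarrow> ('r, nat \<Rightarrow> 's) module"
  assumes N': "left_module A N'" and N'': "left_module A N''" and N: "left_module A N"
    and i: "i \<in> graded_hom A N' H' N H" and j: "j \<in> graded_hom A N'' H'' N H"
    and span: "\<And>x. x \<in> carrier N \<Longrightarrow> \<exists>y \<in> carrier N'. \<exists>z \<in> carrier N''. x = i y \<oplus>\<^bsub>N\<^esub> j z"
    and indep: "\<And>y z. y \<in> carrier N' \<Longrightarrow> z \<in> carrier N'' \<Longrightarrow> i y \<oplus>\<^bsub>N\<^esub> j z = \<zero>\<^bsub>N\<^esub> \<Longrightarrow>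
      y = \<zero>\<^bsub>N'\<^esub> \<and> z = \<zero>\<^bsub>N''\<^esub>"
    and H: "\<And>n. subgroup (H n) (add_monoid N)"
    and M: "linear_resolution A Ag N' H' M G d \<epsilon>"
    and L: "linear_resolution A Ag N'' H'' L GL dL \<eta>"
  shows "\<exists>(D :: nat \<Rightarrow> ('r, nat \<Rightarrow> 's) module) GD dD \<theta>. linear_resolution A Ag N H D GD dD \<theta>"
proof -
  note M' = linear_resolutionD[OF M] and L' = linear_resolutionD[OF L]
  define D where "D n = direct_sum_module (M n) (L n)" for n
  define GD where "GD n = direct_sum_grading (G n) (GL n)" for n
  define dD where "dD n x = interleave (d n (evens x)) (dL n (odds x))" for n x
  define \<theta> where "\<theta> x = i (\<epsilon> (evens x)) \<oplus>\<^bsub>N\<^esub> j (\<eta> (odds x))" for x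
  have D: "x \<in> carrier (D n) \<longleftrightarrow> evens x \<in> carrier (M n) \<and> odds x \<in> carrier (L n)" for n x
    by (simp add: D_def direct_sum_module_def)
  have D0: "\<zero>\<^bsub>D n\<^esub> = interleave \<zero>\<^bsub>M n\<^esub> \<zero>\<^bsub>L n\<^esub>" for n
    by (simp add: D_def direct_sum_module_def)
  have gD: "graded_module A Ag (D n) (GD n)" for n
    unfolding D_def GD_def by (rule graded_module_direct_sum[OF M'(1) L'(1)])
  have homs: "(\<lambda>x. interleave x \<zero>\<^bsub>L n\<^esub>) \<in> lmod_hom A (M n) (D n)"
    "(\<lambda>x. interleave \<zero>\<^bsub>M n\<^esub> x) \<in> lmod_hom A (L n) (D n)"
    "evens \<in> lmod_hom A (D n) (M n)" "odds \<in> lmod_hom A (D n) (L n)" for n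
    unfolding D_def by (rule direct_sum_homs[OF M'(3) L'(3)])+
  have dh: "d n x \<in> carrier (M n)" if "x \<in> carrier (M (Suc n))" for n x
    by (rule graded_hom_closed[OF M'(4) that])
  have dLh: "dL n x \<in> carrier (L n)" if "x \<in> carrier (L (Suc n))" for n x
    by (rule graded_hom_closed[OF L'(4) that])
  have \<epsilon>c: "\<epsilon> x \<in> carrier N'" if "x \<in> carrier (M 0)" for x
    by (rule graded_hom_closed[OF M'(5) that])
  have \<eta>c: "\<eta> x \<in> carrier N''" if "x \<in> carrier (L 0)" for x
    by (rule graded_hom_closed[OF L'(5) that])
  interpret N: left_module A N by (rule N)
  have "linear_resolution A Ag N H D GD dD \<theta>"
  proof (rule linear_resolutionI[OF gD])
    show "projective_module A (D n)" for n
    proof (rule projective_sum[OF M'(2) L'(2) graded_moduleD(1)[OF gD] homs])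
      fix x assume "x \<in> carrier (D n)"
      thus "interleave (evens x) \<zero>\<^bsub>L n\<^esub> \<oplus>\<^bsub>D n\<^esub> interleave \<zero>\<^bsub>M n\<^esub> (odds x) = x"
        using abelian_monoid.r_zero[OF abelian_group.axioms(1)[OF left_moduleD(2)[OF M'(3)]]]
          abelian_monoid.l_zero[OF abelian_group.axioms(1)[OF left_moduleD(2)[OF L'(3)]]]
        by (simp add: D_def direct_sum_module_def)
    qed
    show "dD n \<in> graded_hom A (D (Suc n)) (GD (Suc n)) (D n) (GD n)" for n
      using lmod_homD[OF graded_homD(1)[OF M'(4)[of n]]] graded_homD(2)[OF M'(4)[of n]]
        lmod_homD[OF graded_homD(1)[OF L'(4)[of n]]] graded_homD(2)[OF L'(4)[of n]]
      by (auto simp: graded_hom_def dD_def D_def GD_def direct_sum_module_def direct_sum_grading_def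
          intro!: lmod_homI)
    have \<theta>h: "\<theta> \<in> lmod_hom A (D 0) N"
      unfolding \<theta>_def
      by (intro lmod_hom_sum N lmod_hom_comp[OF _ graded_homD(1)[OF i]] lmod_hom_comp[OF _ graded_homD(1)[OF j]]
          lmod_hom_comp[OF _ graded_homD(1)[OF M'(5)]] lmod_hom_comp[OF _ graded_homD(1)[OF L'(5)]] homs)
    have "\<theta> x \<in> H n" if "x \<in> GD 0 n" for x n
      using that graded_homD(2)[OF i] graded_homD(2)[OF j] graded_homD(2)[OF M'(5)] graded_homD(2)[OF L'(5)]
      by (auto simp: \<theta>_def GD_def direct_sum_grading_def
          intro!: additive_subgroupD(3)[OF N.M.abelian_group_axioms H])
    with \<theta>h show "\<theta> \<in> graded_hom A (D 0) (GD 0) N H" by (auto simp: graded_hom_def)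
    show "\<theta> ` carrier (D 0) = carrier N"
    proof (intro equalityI subsetI)
      fix x assume "x \<in> carrier N"
      then obtain y z where yz: "y \<in> carrier N'" "z \<in> carrier N''" "x = i y \<oplus>\<^bsub>N\<^esub> j z" using span by blast
      hence "y \<in> \<epsilon> ` carrier (M 0)" "z \<in> \<eta> ` carrier (L 0)" using M'(6) L'(6) by simp_all
      then obtain y' z' where "y' \<in> carrier (M 0)" "\<epsilon> y' = y" "z' \<in> carrier (L 0)" "\<eta> z' = z"
        by auto
      thus "x \<in> \<theta> ` carrier (D 0)"
        using yz(3) by (intro image_eqI[of _ _ "interleave y' z'"]) (auto simp: \<theta>_def D)
    qed (use lmod_homD(1)[OF \<theta>h] in auto)
    show "\<theta> (dD 0 x) = \<zero>\<^bsub>N\<^esub>" if "x \<in> carrier (D (Suc 0))" for x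
      using that M'(7) L'(7) lmod_hom_zero[OF N' N graded_homD(1)[OF i]]
        lmod_hom_zero[OF N'' N graded_homD(1)[OF j]] by (simp add: \<theta>_def dD_def D)
    show "\<exists>x \<in> carrier (D (Suc 0)). dD 0 x = y" if y: "y \<in> carrier (D 0)" "\<theta> y = \<zero>\<^bsub>N\<^esub>" for y
    proof -
      have "\<epsilon> (evens y) = \<zero>\<^bsub>N'\<^esub>" "\<eta> (odds y) = \<zero>\<^bsub>N''\<^esub>"
        using indep[OF \<epsilon>c \<eta>c] that by (auto simp: \<theta>_def D)
      then obtain a b where "a \<in> carrier (M (Suc 0))" "d 0 a = evens y" "b \<in> carrier (L (Suc 0))" "dL 0 b = odds y"
        using M'(8)[of "evens y"] L'(8)[of "odds y"] y by (auto simp: D)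
      thus ?thesis by (intro bexI[of _ "interleave a b"]) (auto simp: dD_def D)
    qed
    show "dD n (dD (Suc n) x) = \<zero>\<^bsub>D n\<^esub>" if "x \<in> carrier (D (Suc (Suc n)))" for n x
      using that M'(9) L'(9) by (simp add: dD_def D D0)
    show "\<exists>x \<in> carrier (D (Suc (Suc n))). dD (Suc n) x = y"
      if y: "y \<in> carrier (D (Suc n))" "dD n y = \<zero>\<^bsub>D n\<^esub>" for n y
    proof -
      have "d n (evens y) = \<zero>\<^bsub>M n\<^esub>" "dL n (odds y) = \<zero>\<^bsub>L n\<^esub>"
        using that by (auto simp: dD_def D0 interleave_eq_iff)
      then obtain a b where "a \<in> carrier (M (Suc (Suc n)))" "d (Suc n) a = evens y"
        "b \<in> carrier (L (Suc (Suc n)))" "dL (Suc n) b = odds y"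
        using M'(10)[of "evens y" n] L'(10)[of "odds y" n] y by (auto simp: D)
      thus ?thesis by (intro bexI[of _ "interleave a b"]) (auto simp: dD_def D)
    qed
    show "generated_by A (D n) (GD n n)" for n
    proof (rule generated_byI[OF graded_moduleD(1,4)[OF gD]])
      fix J x assume J: "submodule J A (D n)" "GD n n \<subseteq> J" and x: "x \<in> carrier (D n)"
      note z = grade_closed(2)[OF graded_moduleD(2,3)[OF M'(1)]] grade_closed(2)[OF graded_moduleD(2,3)[OF L'(1)]]
      have "G n n \<subseteq> {x \<in> carrier (M n). interleave x \<zero>\<^bsub>L n\<^esub> \<in> J}"
        "GL n n \<subseteq> {x \<in> carrier (L n). interleave \<zero>\<^bsub>M n\<^esub> x \<in> J}"
        using J(2) graded_moduleD(6)[OF M'(1)] graded_moduleD(6)[OF L'(1)] z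
        by (auto simp: GD_def direct_sum_grading_def intro!: subsetD[OF J(2)])
      hence "interleave (evens x) \<zero>\<^bsub>L n\<^esub> \<in> J" "interleave \<zero>\<^bsub>M n\<^esub> (odds x) \<in> J"
        using generated_byD[OF M'(11) submodule_vimage[OF M'(3) graded_moduleD(1)[OF gD] homs(1) J(1)], of "evens x"]
          generated_byD[OF L'(11) submodule_vimage[OF L'(3) graded_moduleD(1)[OF gD] homs(2) J(1)], of "odds x"] x
        by (auto simp: D)
      from submoduleD(3)[OF graded_moduleD(1)[OF gD] J(1) this] show "x \<in> J"
        using abelian_monoid.r_zero[OF abelian_group.axioms(1)[OF left_moduleD(2)[OF M'(3)]]]
          abelian_monoid.l_zero[OF abelian_group.axioms(1)[OF left_moduleD(2)[OF L'(3)]]] x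
        by (simp add: D_def direct_sum_module_def)
    qed
  qed
  thus ?thesis by (intro exI)
qed

section \<open>Graded posets\<close>

text \<open>The argument \<open>field_type\<close> fixes the ground field of the incidence ring, so that \<open>P\<close> and \<open>r\<close> determine
  this ring including its type.\<close>

locale finite_graded_poset =
  fixes P :: "'a set" and r :: "'a rel" and field_type :: "'k :: field itself"
  assumes graded: "graded_poset P r"
begin

lemma finite_P: "finite P"
  and r_sub: "r \<subseteq> P \<times> P"
  and r_refl: "x \<in> P \<Longrightarrow> (x, x) \<in> r"
  and r_antisym: "(x, y) \<in> r \<Longrightarrow> (y, x) \<in> r \<Longrightarrow> x = y"
  and r_trans: "(x, y) \<in> r \<Longrightarrow> (y, z) \<in> r \<Longrightarrow> (x, z) \<in> r"
  using graded by (auto simp: graded_poset_def partial_order_on_def preorder_on_def refl_on_def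
      dest: antisymD transD)

lemma r_in_P: "(x, y) \<in> r \<Longrightarrow> x \<in> P" "(x, y) \<in> r \<Longrightarrow> y \<in> P"
  using r_sub by auto

lemma finite_r: "finite r"
  using r_sub finite_P by (meson finite_SigmaI finite_subset)

lemma covering_path_in_r: "(x, y) \<in> covering r ^^ l \<Longrightarrow> x \<in> P \<Longrightarrow> (x, y) \<in> r"
proof (induction l arbitrary: y)
  case (Suc l)
  then obtain z where "(x, z) \<in> covering r ^^ l" "(z, y) \<in> covering r" by auto
  thus ?case using Suc r_trans by (auto simp: covering_def)
qed (auto intro: r_refl)

lemma covering_path_exists: "(x, y) \<in> r \<Longrightarrow> \<exists>l. (x, y) \<in> covering r ^^ l"
proof (induction "card {z. (x, z) \<in> r \<and> (z, y) \<in> r}" arbitrary: x y rule: less_induct)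
  case less
  consider "x = y" | "(x, y) \<in> covering r" |
    z where "x \<noteq> y" "(x, z) \<in> r" "(z, y) \<in> r" "z \<noteq> x" "z \<noteq> y"
    using less.prems unfolding covering_def by blast
  thus ?case
  proof cases
    case 1
    thus ?thesis by (intro exI[of _ 0]) auto
  next
    case 2
    thus ?thesis by (intro exI[of _ 1]) auto
  next
    case 3
    have fin: "finite {z. (x, z) \<in> r \<and> (z, y) \<in> r}"
      by (rule finite_subset[OF _ finite_P]) (auto intro: r_in_P)
    define I J K where "I = {z. (x, z) \<in> r \<and> (z, y) \<in> r}" and "J = {w. (x, w) \<in> r \<and> (w, z) \<in> r}"
      and "K = {w. (z, w) \<in> r \<and> (w, y) \<in> r}"
    have "y \<in> I" "x \<in> I" using less.prems r_refl r_in_P by (auto simp: I_def)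
    moreover have "y \<notin> J" "x \<notin> K" using 3 r_antisym[of y z] r_antisym[of x z] by (auto simp: J_def K_def)
    moreover have "J \<subseteq> I" unfolding I_def J_def using 3(3) r_trans by blast
    moreover have "K \<subseteq> I" unfolding I_def K_def using 3(2) r_trans by blast
    ultimately have "J \<subset> I" "K \<subset> I" by blast+
    note sub = this[unfolded I_def J_def K_def]
    from less.hyps[OF psubset_card_mono[OF fin sub(1)] 3(2)]
    obtain l where l: "(x, z) \<in> covering r ^^ l" by blast
    from less.hyps[OF psubset_card_mono[OF fin sub(2)] 3(3)]
    obtain m where m: "(z, y) \<in> covering r ^^ m" by blast
    have "(x, y) \<in> covering r ^^ (l + m)" using l m by (auto simp: relpow_add)
    thus ?thesis by blast
  qed
qed

abbreviation len :: "'a \<Rightarrow> 'a \<Rightarrow> nat" where "len \<equiv> interval_length r"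

lemma len_iff: "(x, y) \<in> r \<Longrightarrow> (x, y) \<in> covering r ^^ l \<longleftrightarrow> len x y = l"
proof -
  assume xy: "(x, y) \<in> r"
  have unique: "l = m" if "(x, y) \<in> covering r ^^ l" "(x, y) \<in> covering r ^^ m" for l m
    using that xy graded by (auto simp: graded_poset_def)
  obtain m where m: "(x, y) \<in> covering r ^^ m" using covering_path_exists[OF xy] by blast
  hence "len x y = m" unfolding interval_length_def using unique by (intro the_equality) auto
  thus ?thesis using m unique by auto
qed

lemma len_add: "(x, y) \<in> r \<Longrightarrow> (y, z) \<in> r \<Longrightarrow> len x z = len x y + len y z"
proof -
  assume xy: "(x, y) \<in> r" and yz: "(y, z) \<in> r"
  have "(x, z) \<in> covering r ^^ (len x y + len y z)"
    using len_iff[OF xy, of "len x y"] len_iff[OF yz, of "len y z"] by (auto simp: relpow_add)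
  thus ?thesis using len_iff[OF r_trans[OF xy yz]] by simp
qed

lemma len_0_iff: "(x, y) \<in> r \<Longrightarrow> len x y = 0 \<longleftrightarrow> x = y"
  using len_iff[of x y 0] by auto

lemma len_refl: "x \<in> P \<Longrightarrow> len x x = 0"
  using len_0_iff r_refl by blast

lemma len_covering: "(x, y) \<in> covering r \<Longrightarrow> len x y = 1"
  using len_iff[of x y 1] by (auto simp: covering_def)

lemma len_split:
  assumes "(x, y) \<in> r" "len x y = p + q"
  shows "\<exists>z. (x, z) \<in> r \<and> (z, y) \<in> r \<and> len x z = p \<and> len z y = q"
proof -
  have "(x, y) \<in> covering r ^^ (p + q)" using len_iff[OF assms(1)] assms(2) by simp
  then obtain z where z: "(x, z) \<in> covering r ^^ p" "(z, y) \<in> covering r ^^ q" by (auto simp: relpow_add)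
  hence xz: "(x, z) \<in> r" using covering_path_in_r r_in_P assms(1) by blast
  hence "(z, y) \<in> r" using z(2) covering_path_in_r r_in_P by blast
  thus ?thesis using xz z len_iff by blast
qed

end

section \<open>The incidence ring of a graded poset\<close>

type_synonym ('a, 'k) inc_module = "('a \<times> 'a \<Rightarrow> 'k, nat \<Rightarrow> 'a \<times> 'a \<Rightarrow> 'k) module"

definition single :: "'a \<times> 'a \<Rightarrow> 'k \<Rightarrow> 'a \<times> 'a \<Rightarrow> 'k :: field" where
  "single p c = (\<lambda>q. if q = p then c else 0)"

context finite_graded_poset
begin

abbreviation Inc :: "('a \<times> 'a \<Rightarrow> 'k) ring" where "Inc \<equiv> incidence_ring P r"

lemma incidence_simps:
  "f \<in> carrier Inc \<longleftrightarrow> (\<forall>p. p \<notin> r \<longrightarrow> f p = 0)"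
  "(f \<otimes>\<^bsub>Inc\<^esub> g) (x, y) = (\<Sum>z\<in>P. f (x, z) * g (z, y))"
  "\<zero>\<^bsub>Inc\<^esub> = (\<lambda>_. 0)"
  "f \<oplus>\<^bsub>Inc\<^esub> g = (\<lambda>p. f p + g p)"
  by (auto simp: incidence_ring_def incidence_span_def)

lemma incidence_supp: "f \<in> carrier Inc \<Longrightarrow> f (x, y) \<noteq> 0 \<Longrightarrow> (x, y) \<in> r"
  by (auto simp: incidence_simps)

lemma incidence_one: "\<one>\<^bsub>Inc\<^esub> = (\<lambda>p. if p \<in> Id_on P then 1 else (0 :: 'k))"
proof
  fix p :: "'a \<times> 'a"
  obtain a b where p: "p = (a, b)" by (cases p)
  have "(\<Sum>x\<in>P. incidence_unit x x p) = (\<Sum>x\<in>P. if x = a then if a = b then 1 else 0 else (0 :: 'k))"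
    by (rule sum.cong) (auto simp: incidence_unit_def p)
  thus "\<one>\<^bsub>Inc\<^esub> p = (if p \<in> Id_on P then 1 else (0 :: 'k))"
    using finite_P by (auto simp: incidence_ring_def p)
qed

lemma incidence_mult_closed:
  assumes "f \<in> carrier Inc" "g \<in> carrier Inc" shows "f \<otimes>\<^bsub>Inc\<^esub> g \<in> carrier Inc"
  unfolding incidence_simps
proof (intro allI impI)
  fix p :: "'a \<times> 'a" assume "p \<notin> r"
  moreover obtain x y where p: "p = (x, y)" by (cases p)
  ultimately have "f (x, z) = 0 \<or> g (z, y) = 0" for z using assms r_trans incidence_supp by blast
  thus "(f \<otimes>\<^bsub>Inc\<^esub> g) p = 0" by (auto simp: p incidence_simps intro!: sum.neutral)
qed

lemma incidence_ring_ring: "ring Inc"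
proof (rule ringI)
  show "abelian_group Inc"
  proof (rule abelian_groupI)
    fix x assume "x \<in> carrier Inc"
    thus "\<exists>y\<in>carrier Inc. y \<oplus>\<^bsub>Inc\<^esub> x = \<zero>\<^bsub>Inc\<^esub>"
      by (intro bexI[of _ "\<lambda>p. - x p"]) (auto simp: incidence_simps)
  qed (auto simp: incidence_simps algebra_simps)
  show "monoid Inc"
  proof (rule monoidI)
    show "\<one>\<^bsub>Inc\<^esub> \<in> carrier Inc"
      by (auto simp: incidence_simps incidence_one Id_on_iff r_refl)
  next
    fix f g h assume "f \<in> carrier Inc" "g \<in> carrier Inc" "h \<in> carrier Inc"
    show "f \<otimes>\<^bsub>Inc\<^esub> g \<otimes>\<^bsub>Inc\<^esub> h = f \<otimes>\<^bsub>Inc\<^esub> (g \<otimes>\<^bsub>Inc\<^esub> h)"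
    proof
      fix p :: "'a \<times> 'a"
      obtain x y where p: "p = (x, y)" by (cases p)
      have "(\<Sum>w\<in>P. (\<Sum>z\<in>P. f (x, z) * g (z, w)) * h (w, y)) =
        (\<Sum>w\<in>P. \<Sum>z\<in>P. f (x, z) * g (z, w) * h (w, y))" by (simp add: sum_distrib_right)
      also have "\<dots> = (\<Sum>z\<in>P. \<Sum>w\<in>P. f (x, z) * g (z, w) * h (w, y))" by (rule sum.swap)
      also have "\<dots> = (\<Sum>z\<in>P. f (x, z) * (\<Sum>w\<in>P. g (z, w) * h (w, y)))"
        by (simp add: sum_distrib_left mult.assoc)
      finally show "(f \<otimes>\<^bsub>Inc\<^esub> g \<otimes>\<^bsub>Inc\<^esub> h) p = (f \<otimes>\<^bsub>Inc\<^esub> (g \<otimes>\<^bsub>Inc\<^esub> h)) p"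
        by (simp add: p incidence_simps)
    qed
  next
    fix f assume f: "f \<in> carrier Inc"
    have "(\<Sum>z\<in>P. (if (x, z) \<in> Id_on P then 1 else 0) * f (z, y)) = f (x, y)" for x y
    proof -
      have "(\<Sum>z\<in>P. (if (x, z) \<in> Id_on P then 1 else 0) * f (z, y)) = (\<Sum>z\<in>P. if z = x then f (x, y) else 0)"
        by (rule sum.cong) auto
      thus ?thesis using finite_P incidence_supp[OF f, of x y] r_in_P by auto
    qed
    thus "\<one>\<^bsub>Inc\<^esub> \<otimes>\<^bsub>Inc\<^esub> f = f" by (auto simp: fun_eq_iff incidence_simps incidence_one)
    have "(\<Sum>z\<in>P. f (x, z) * (if (z, y) \<in> Id_on P then 1 else 0)) = f (x, y)" for x y
    proof -
      have "(\<Sum>z\<in>P. f (x, z) * (if (z, y) \<in> Id_on P then 1 else 0)) = (\<Sum>z\<in>P. if z = y then f (x, y) else 0)"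
        by (rule sum.cong) auto
      thus ?thesis using finite_P incidence_supp[OF f, of x y] r_in_P by auto
    qed
    thus "f \<otimes>\<^bsub>Inc\<^esub> \<one>\<^bsub>Inc\<^esub> = f" by (auto simp: fun_eq_iff incidence_simps incidence_one)
  qed (rule incidence_mult_closed)
qed (auto simp: fun_eq_iff incidence_simps sum.distrib algebra_simps)

lemma incidence_uminus: "f \<in> carrier Inc \<Longrightarrow> \<ominus>\<^bsub>Inc\<^esub> f = (\<lambda>p. - f p)"
  by (rule abelian_group.minus_equality[OF ring.is_abelian_group[OF incidence_ring_ring]])
    (auto simp: incidence_simps)

lemma incidence_span_subgroup:
  assumes "E \<subseteq> r"
  shows "subgroup (incidence_span E) (add_monoid Inc)"
proof (rule additive_subgroupI[OF ring.is_abelian_group[OF incidence_ring_ring]])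
  show sub: "incidence_span E \<subseteq> carrier Inc"
  proof
    fix f :: "'a \<times> 'a \<Rightarrow> 'k" assume "f \<in> incidence_span E"
    hence "p \<notin> E \<Longrightarrow> f p = 0" for p unfolding incidence_span_def by blast
    thus "f \<in> carrier Inc" using assms unfolding incidence_simps by blast
  qed
  show "\<ominus>\<^bsub>Inc\<^esub> f \<in> incidence_span E" if "f \<in> incidence_span E" for f
    using incidence_uminus[OF subsetD[OF sub that]] that by (auto simp: incidence_span_def)
qed (auto simp: incidence_simps incidence_span_def)

lemma incidence_span_subset_generate:
  fixes T :: "('a \<times> 'a \<Rightarrow> 'k) set"
  assumes E: "E \<subseteq> r" and T: "\<And>p c. p \<in> E \<Longrightarrow> single p c \<in> generate (add_monoid Inc) T"
  shows "incidence_span E \<subseteq> generate (add_monoid Inc) T"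
proof
  fix f :: "'a \<times> 'a \<Rightarrow> 'k" assume f: "f \<in> incidence_span E"
  have "(\<lambda>p. if p \<in> S then f p else 0) \<in> generate (add_monoid Inc) T" if "finite S" "S \<subseteq> E" for S
    using that
  proof (induction S rule: finite_induct)
    case empty
    show ?case using generate.one[of "add_monoid Inc" T] by (simp add: incidence_simps(3))
  next
    case (insert p S)
    have "(\<lambda>q. if q \<in> insert p S then f q else 0) = single p (f p) \<oplus>\<^bsub>Inc\<^esub> (\<lambda>q. if q \<in> S then f q else 0)"
      using insert.hyps by (auto simp: incidence_simps single_def)
    thus ?case using generate.eng[of "single p (f p)" "add_monoid Inc" T] insert T by simp
  qed
  from this[of E] have "(\<lambda>p. if p \<in> E then f p else 0) \<in> generate (add_monoid Inc) T"
    using finite_subset[OF E finite_r] by simp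
  moreover have "(\<lambda>p. if p \<in> E then f p else 0) = f" using f by (auto simp: incidence_span_def)
  ultimately show "f \<in> generate (add_monoid Inc) T" by simp
qed

lemma single_mult:
  assumes "y \<in> P"
  shows "single (x, y) c \<otimes>\<^bsub>Inc\<^esub> single (y, z) d = single (x, z) (c * d)"
proof
  fix p :: "'a \<times> 'a"
  obtain u v where p: "p = (u, v)" by (cases p)
  have "(\<Sum>w\<in>P. single (x, y) c (u, w) * single (y, z) d (w, v)) =
    (\<Sum>w\<in>P. if w = y then if u = x \<and> v = z then c * d else 0 else 0)"
    by (rule sum.cong) (auto simp: single_def)
  thus "(single (x, y) c \<otimes>\<^bsub>Inc\<^esub> single (y, z) d) p = single (x, z) (c * d) p"
    using assms finite_P by (auto simp: p incidence_simps single_def)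
qed

abbreviation Diag :: "('a \<times> 'a \<Rightarrow> 'k) set" where "Diag \<equiv> incidence_diag P"
abbreviation Cmp :: "nat \<Rightarrow> ('a \<times> 'a \<Rightarrow> 'k) set" where "Cmp \<equiv> incidence_component r"

lemma Id_on_sub_r: "Id_on P \<subseteq> r"
  by (auto simp: r_refl)

lemma Diag_iff: "f \<in> Diag \<longleftrightarrow> (\<forall>p. p \<notin> Id_on P \<longrightarrow> f p = 0)"
  by (simp add: incidence_diag_def incidence_span_def)

lemma Cmp_iff: "f \<in> Cmp n \<longleftrightarrow> (\<forall>x y. f (x, y) \<noteq> 0 \<longrightarrow> (x, y) \<in> r \<and> len x y = n)"
  by (auto simp: incidence_component_def incidence_span_def)

lemma Cmp_0: "Cmp 0 = Diag"
proof -
  have "{(x, y) \<in> r. len x y = 0} = Id_on P"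
    using len_0_iff len_refl r_refl r_in_P by (auto simp: Id_on_iff)
  thus ?thesis by (simp add: incidence_component_def incidence_diag_def)
qed

lemma diag_mult_left:
  assumes "f \<in> Diag" "g \<in> carrier Inc"
  shows "(f \<otimes>\<^bsub>Inc\<^esub> g) (x, y) = f (x, x) * g (x, y)"
proof -
  have "(\<Sum>z\<in>P. f (x, z) * g (z, y)) = (\<Sum>z\<in>P. if z = x then f (x, x) * g (x, y) else 0)"
    using assms(1) by (intro sum.cong) (auto simp: Diag_iff Id_on_iff)
  thus ?thesis using finite_P assms r_in_P by (auto simp: incidence_simps)
qed

lemma diag_subring: "subring Diag Inc"
proof (intro subring.intro submonoid.intro)
  show "subgroup Diag (add_monoid Inc)"
    unfolding incidence_diag_def by (rule incidence_span_subgroup[OF Id_on_sub_r])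
  from additive_subgroupD(1)[OF ring.is_abelian_group[OF incidence_ring_ring] this]
  show sub: "Diag \<subseteq> carrier Inc" .
  show "f \<otimes>\<^bsub>Inc\<^esub> g \<in> Diag" if "f \<in> Diag" "g \<in> Diag" for f g
    unfolding Diag_iff using that diag_mult_left[OF that(1) subsetD[OF sub that(2)]] by (auto simp: Diag_iff)
  show "\<one>\<^bsub>Inc\<^esub> \<in> Diag" by (simp add: incidence_one Diag_iff)
qed

text \<open>The diagonal ring is the sum of the one-dimensional ideals \<open>k e\<^bsub>x,x\<^esub>\<close>.\<close>

lemma diag_semisimple: "semisimple_ring (Inc\<lparr>carrier := Diag\<rparr>)"
proof -
  let ?R = "Inc\<lparr>carrier := Diag\<rparr>"
  let ?S = "\<Union>{I. simple_submodule I ?R (regular_module ?R)}"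
  have ring: "ring ?R" by (rule ring.subring_is_ring[OF incidence_ring_ring diag_subring])
  interpret R: ring ?R by (rule ring)
  have sub: "f \<in> carrier Inc" if "f \<in> Diag" for f
    using that Id_on_sub_r unfolding Diag_iff incidence_simps by blast
  have reg: "left_module ?R (regular_module ?R)"
  proof (intro left_module.intro ring abelian_groupI left_module_axioms.intro)
    fix x assume "x \<in> carrier (regular_module ?R)"
    thus "\<exists>y\<in>carrier (regular_module ?R). y \<oplus>\<^bsub>regular_module ?R\<^esub> x = \<zero>\<^bsub>regular_module ?R\<^esub>"
      using R.a_inv_closed R.l_neg by (intro bexI[of _ "\<ominus>\<^bsub>?R\<^esub> x"]) (auto simp: regular_module_def)
  qed (use R.a_closed R.zero_closed R.a_assoc R.a_comm R.l_zero R.m_closed R.m_assoc R.l_distr R.r_distr R.l_one in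
      \<open>simp_all add: regular_module_def\<close>)
  have simple: "simple_submodule {single (x, x) c | c. True} ?R (regular_module ?R)" if x: "x \<in> P" for x
  proof -
    let ?I = "{single (x, x) c | c. True} :: ('a \<times> 'a \<Rightarrow> 'k) set"
    have I_sub: "?I \<subseteq> Diag" using x by (auto simp: Diag_iff single_def)
    have mult: "a \<otimes>\<^bsub>Inc\<^esub> single (x, x) c = single (x, x) (a (x, x) * c)" if "a \<in> Diag" for a and c :: 'k
    proof
      fix p :: "'a \<times> 'a"
      obtain u v where p: "p = (u, v)" by (cases p)
      have D: "single (x, x) c \<in> Diag" using I_sub by blast
      show "(a \<otimes>\<^bsub>Inc\<^esub> single (x, x) c) p = single (x, x) (a (x, x) * c) p"
        using diag_mult_left[OF that sub[OF D], of u v] by (auto simp: p single_def)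
    qed
    have "submodule ?I ?R (regular_module ?R)"
    proof (rule submoduleI'[OF reg])
      show "\<zero>\<^bsub>regular_module ?R\<^esub> \<in> ?I"
        by (auto simp: regular_module_def incidence_simps single_def intro!: exI[of _ 0])
      show "f \<oplus>\<^bsub>regular_module ?R\<^esub> g \<in> ?I" if fg: "f \<in> ?I" "g \<in> ?I" for f g
      proof -
        from fg obtain c d where "f = single (x, x) c" "g = single (x, x) d" by blast
        hence "f \<oplus>\<^bsub>regular_module ?R\<^esub> g = single (x, x) (c + d)"
          by (auto simp: regular_module_def incidence_simps single_def)
        thus ?thesis by blast
      qed
      show "a \<odot>\<^bsub>regular_module ?R\<^esub> f \<in> ?I" if "a \<in> carrier ?R" "f \<in> ?I" for a f
        using that mult by (auto simp: regular_module_def)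
    qed (use I_sub in \<open>simp add: regular_module_def\<close>)
    moreover have "?I \<noteq> {\<zero>\<^bsub>regular_module ?R\<^esub>}"
    proof
      assume "?I = {\<zero>\<^bsub>regular_module ?R\<^esub>}"
      hence "single (x, x) (1 :: 'k) = (\<lambda>_. 0)" by (auto simp: regular_module_def incidence_simps)
      from fun_cong[OF this, of "(x, x)"] show False by (simp add: single_def)
    qed
    moreover have "K = {\<zero>\<^bsub>regular_module ?R\<^esub>} \<or> K = ?I"
      if K: "submodule K ?R (regular_module ?R)" "K \<subseteq> ?I" for K
    proof (cases "\<exists>f \<in> K. f \<noteq> \<zero>\<^bsub>regular_module ?R\<^esub>")
      case True
      then obtain c where c: "single (x, x) c \<in> K" "single (x, x) c \<noteq> (\<lambda>_. 0)"
        using K(2) by (auto simp: regular_module_def incidence_simps)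
      hence c0: "c \<noteq> 0" by (auto simp: single_def)
      have "single (x, x) d \<in> K" for d
      proof -
        have D: "single (x, x) (d / c) \<in> Diag" using I_sub by blast
        from submoduleD(5)[OF reg K(1) _ c(1), of "single (x, x) (d / c)"] D mult[OF D, of c] c0
        show ?thesis by (simp add: regular_module_def single_def)
      qed
      thus ?thesis using K(2) by blast
    next
      case False
      thus ?thesis using submoduleD(2)[OF reg K(1)] by blast
    qed
    ultimately show ?thesis unfolding simple_submodule_def by blast
  qed
  have gen_eq: "generate (add_monoid ?R) ?S = generate (add_monoid Inc) ?S"
  proof -
    have "?S \<subseteq> Diag"
      using submoduleD(1)[OF reg] unfolding simple_submodule_def by (fastforce simp: regular_module_def)
    from group.generate_consistent[OF abelian_group.a_group[OF ring.is_abelian_group[OF incidence_ring_ring]]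
        this subring.axioms(1)[OF diag_subring]]
    show ?thesis by simp
  qed
  have "Diag \<subseteq> generate (add_monoid Inc) ?S"
  proof (subst incidence_diag_def, rule incidence_span_subset_generate[OF Id_on_sub_r])
    fix p :: "'a \<times> 'a" and c :: 'k assume "p \<in> Id_on P"
    then obtain x where "x \<in> P" "p = (x, x)" by auto
    thus "single p c \<in> generate (add_monoid Inc) ?S" using simple by (intro generate.incl) blast
  qed
  moreover have "generate (add_monoid ?R) ?S \<subseteq> Diag"
  proof -
    have "?S \<subseteq> carrier (add_monoid ?R)"
      using submoduleD(1)[OF reg] unfolding simple_submodule_def by (fastforce simp: regular_module_def)
    from group.generate_incl[OF abelian_group.a_group[OF R.is_abelian_group] this] show ?thesis by simp
  qed
  ultimately show ?thesis unfolding semisimple_ring_def using ring gen_eq by auto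
qed

lemma Cmp_mult:
  assumes "a \<in> Cmp p" "b \<in> Cmp q" shows "a \<otimes>\<^bsub>Inc\<^esub> b \<in> Cmp (p + q)"
  unfolding Cmp_iff
proof (intro allI impI)
  fix x y assume "(a \<otimes>\<^bsub>Inc\<^esub> b) (x, y) \<noteq> 0"
  then obtain z where "a (x, z) * b (z, y) \<noteq> 0" unfolding incidence_simps by (meson sum.neutral)
  hence "(x, z) \<in> r" "len x z = p" "(z, y) \<in> r" "len z y = q" using assms by (auto simp: Cmp_iff)
  thus "(x, y) \<in> r \<and> len x y = p + q" using r_trans len_add by blast
qed

lemma Cmp_decomposition: "internal_direct_sum Inc Cmp"
proof (rule internal_direct_sumI[where c = "\<lambda>n f p. if len (fst p) (snd p) = n then f p else 0"])
  show "abelian_group Inc" by (rule ring.is_abelian_group[OF incidence_ring_ring])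
  show "subgroup (Cmp n) (add_monoid Inc)" for n
    unfolding incidence_component_def by (rule incidence_span_subgroup) auto
  show "finite {n. (\<lambda>p. if len (fst p) (snd p) = n then f p else 0) \<noteq> \<zero>\<^bsub>Inc\<^esub>}"
    if f: "f \<in> carrier Inc" for f
  proof (rule finite_subset)
    show "finite ((\<lambda>p. len (fst p) (snd p)) ` r)" using finite_r by simp
    show "{n. (\<lambda>p. if len (fst p) (snd p) = n then f p else 0) \<noteq> \<zero>\<^bsub>Inc\<^esub>} \<subseteq> (\<lambda>p. len (fst p) (snd p)) ` r"
    proof
      fix n assume "n \<in> {n. (\<lambda>p. if len (fst p) (snd p) = n then f p else 0) \<noteq> \<zero>\<^bsub>Inc\<^esub>}"
      then obtain p where "(if len (fst p) (snd p) = n then f p else 0) \<noteq> 0"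
        by (auto simp: incidence_simps fun_eq_iff)
      thus "n \<in> (\<lambda>p. len (fst p) (snd p)) ` r"
        using incidence_supp[OF f, of "fst p" "snd p"] by (intro image_eqI[of _ _ p]) (auto split: if_splits)
    qed
  qed
  show "f = \<zero>\<^bsub>Inc\<^esub>" if "\<And>n. (\<lambda>p. if len (fst p) (snd p) = n then f p else 0) = \<zero>\<^bsub>Inc\<^esub>"
    for f
  proof
    fix p show "f p = \<zero>\<^bsub>Inc\<^esub> p" using fun_cong[OF that[of "len (fst p) (snd p)"], of p] by (simp add: incidence_simps)
  qed
  show "(\<lambda>p. if len (fst p) (snd p) = m then f p else 0) = (if m = n then f else \<zero>\<^bsub>Inc\<^esub>)"
    if "f \<in> Cmp n" for m n and f
    using that by (fastforce simp: Cmp_iff incidence_simps)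
qed (auto simp: Cmp_iff incidence_simps)

lemma incidence_connected: "connected_ring Inc Diag Cmp"
  using incidence_ring_ring diag_subring diag_semisimple Cmp_decomposition Cmp_mult Cmp_0
  by (intro connected_ring.intro connected_ring_axioms.intro) auto

lemma incidence_strongly_graded: "strongly_graded Inc Cmp"
  unfolding strongly_graded_def
proof (intro allI equalityI)
  fix p q
  let ?T = "{a \<otimes>\<^bsub>Inc\<^esub> b | a b. a \<in> Cmp p \<and> b \<in> Cmp q} :: ('a \<times> 'a \<Rightarrow> 'k) set"
  have "subgroup (Cmp (p + q)) (add_monoid Inc)"
    unfolding incidence_component_def by (rule incidence_span_subgroup) auto
  thus "generate (add_monoid Inc) ?T \<subseteq> Cmp (p + q)"
    using Cmp_mult
    by (intro group.generate_subgroup_incl[OF abelian_group.a_group[OF ring.is_abelian_group[OF incidence_ring_ring]]])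
      blast+
  show "Cmp (p + q) \<subseteq> generate (add_monoid Inc) ?T"
    unfolding incidence_component_def[of r "p + q"]
  proof (rule incidence_span_subset_generate)
    fix e :: "'a \<times> 'a" and c :: 'k assume "e \<in> {(x, y) \<in> r. len x y = p + q}"
    then obtain x y where e: "e = (x, y)" "(x, y) \<in> r" "len x y = p + q" by blast
    from len_split[OF e(2,3)] obtain z where
      z: "(x, z) \<in> r" "(z, y) \<in> r" "len x z = p" "len z y = q" by blast
    have "single e c = single (x, z) c \<otimes>\<^bsub>Inc\<^esub> single (z, y) 1"
      using single_mult[of z x c y 1] z(1) r_in_P e(1) by simp
    moreover have "single (x, z) c \<in> Cmp p" "single (z, y) (1 :: 'k) \<in> Cmp q"
      using z by (auto simp: Cmp_iff single_def)
    ultimately show "single e c \<in> generate (add_monoid Inc) ?T" by (intro generate.incl) blast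
  qed auto
qed

end

section \<open>Base change along a corner\<close>

lemma projective_moduleD:
  fixes M L :: "('r, 'm) module" and N :: "('r, 'm \<Rightarrow> 'r) module"
  assumes "projective_module R M" "left_module R N" "left_module R L" "g \<in> lmod_hom R N L"
    "g ` carrier N = carrier L" "h \<in> lmod_hom R M L"
  obtains k where "k \<in> lmod_hom R M N" "\<And>x. x \<in> carrier M \<Longrightarrow> g (k x) = h x"
  using assms unfolding projective_module_def by blast

text \<open>Let \<open>e\<close> be an idempotent of \<open>A\<close> with \<open>A e = e A e\<close>, and \<open>B = A e\<close>, a ring with unit \<open>e\<close>. Then
  \<open>a \<mapsto> a e\<close> is a surjective ring homomorphism from \<open>A\<close> to \<open>B\<close> which fixes \<open>B\<close>. The
  condition on \<open>e\<close> is expressed by \<open>right_in_B\<close>: as \<open>e\<close> is the unit of \<open>B\<close>, membership of \<open>a e\<close> in \<open>B\<close>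
  gives \<open>a e = e (a e)\<close>. For an incidence ring and \<open>e = 1 - e\<^sub>t\<close>, the condition holds when \<open>t\<close> is
  maximal.\<close>

locale left_corner =
  fixes A :: "('r, 'b) ring_scheme" and R :: "'r set" and Ag :: "nat \<Rightarrow> 'r set"
    and B :: "('r, 'c) ring_scheme" and S :: "'r set" and Bg :: "nat \<Rightarrow> 'r set"
  assumes A: "connected_ring A R Ag" and B: "connected_ring B S Bg"
    and B_sub: "carrier B \<subseteq> carrier A"
    and B_add: "\<lbrakk>x \<in> carrier B; y \<in> carrier B\<rbrakk> \<Longrightarrow> x \<oplus>\<^bsub>B\<^esub> y = x \<oplus>\<^bsub>A\<^esub> y"
    and B_mult: "\<lbrakk>x \<in> carrier B; y \<in> carrier B\<rbrakk> \<Longrightarrow> x \<otimes>\<^bsub>B\<^esub> y = x \<otimes>\<^bsub>A\<^esub> y"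
    and right_in_B: "a \<in> carrier A \<Longrightarrow> a \<otimes>\<^bsub>A\<^esub> \<one>\<^bsub>B\<^esub> \<in> carrier B"
    and Bg_sub: "Bg p \<subseteq> Ag p"
    and right_in_Bg: "a \<in> Ag p \<Longrightarrow> a \<otimes>\<^bsub>A\<^esub> \<one>\<^bsub>B\<^esub> \<in> Bg p"
begin

interpretation A: ring A by (rule connected_ringD(1)[OF A])
interpretation B: ring B by (rule connected_ringD(1)[OF B])

lemma in_A: "x \<in> carrier B \<Longrightarrow> x \<in> carrier A"
  using B_sub by blast

lemma oneB_in_A: "\<one>\<^bsub>B\<^esub> \<in> carrier A"
  by (simp add: in_A)

lemma right_B: "b \<in> carrier B \<Longrightarrow> b \<otimes>\<^bsub>A\<^esub> \<one>\<^bsub>B\<^esub> = b"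
  using B_mult[of b "\<one>\<^bsub>B\<^esub>"] by simp

lemma left_B: "b \<in> carrier B \<Longrightarrow> \<one>\<^bsub>B\<^esub> \<otimes>\<^bsub>A\<^esub> b = b"
  using B_mult[of "\<one>\<^bsub>B\<^esub>" b] by simp

lemma right_mult:
  assumes "a \<in> carrier A" "a' \<in> carrier A"
  shows "(a \<otimes>\<^bsub>A\<^esub> a') \<otimes>\<^bsub>A\<^esub> \<one>\<^bsub>B\<^esub> = (a \<otimes>\<^bsub>A\<^esub> \<one>\<^bsub>B\<^esub>) \<otimes>\<^bsub>B\<^esub> (a' \<otimes>\<^bsub>A\<^esub> \<one>\<^bsub>B\<^esub>)"
proof -
  have "(a \<otimes>\<^bsub>A\<^esub> \<one>\<^bsub>B\<^esub>) \<otimes>\<^bsub>B\<^esub> (a' \<otimes>\<^bsub>A\<^esub> \<one>\<^bsub>B\<^esub>) = a \<otimes>\<^bsub>A\<^esub> (\<one>\<^bsub>B\<^esub> \<otimes>\<^bsub>A\<^esub> (a' \<otimes>\<^bsub>A\<^esub> \<one>\<^bsub>B\<^esub>))"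
    using assms right_in_B oneB_in_A by (simp add: B_mult A.m_assoc)
  thus ?thesis using left_B[OF right_in_B[OF assms(2)]] assms oneB_in_A by (simp add: A.m_assoc)
qed

text \<open>The \<open>A\<close>-modules on which \<open>e\<close> acts as the identity are the modules killed by \<open>1 - e\<close>. They are the
  \<open>B\<close>-modules: restriction of scalars to the subset \<open>B\<close> keeps the record, and \<open>inflate\<close> is the
  pull-back along \<open>a \<mapsto> a e\<close>.\<close>

definition unital :: "('r, 'm) module \<Rightarrow> bool" where
  "unital M \<longleftrightarrow> (\<forall>x \<in> carrier M. \<one>\<^bsub>B\<^esub> \<odot>\<^bsub>M\<^esub> x = x)"

definition inflate :: "('r, 'm) module \<Rightarrow> ('r, 'm) module" where
  "inflate M = M\<lparr>smult := \<lambda>a x. (a \<otimes>\<^bsub>A\<^esub> \<one>\<^bsub>B\<^esub>) \<odot>\<^bsub>M\<^esub> x\<rparr>"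

lemma inflate_simps [simp]:
  "carrier (inflate M) = carrier M" "\<zero>\<^bsub>inflate M\<^esub> = \<zero>\<^bsub>M\<^esub>" "add (inflate M) = add M"
  "a \<odot>\<^bsub>inflate M\<^esub> x = (a \<otimes>\<^bsub>A\<^esub> \<one>\<^bsub>B\<^esub>) \<odot>\<^bsub>M\<^esub> x"
  by (simp_all add: inflate_def)

lemma smult_right:
  assumes "left_module A M" "unital M" "a \<in> carrier A" "x \<in> carrier M"
  shows "(a \<otimes>\<^bsub>A\<^esub> \<one>\<^bsub>B\<^esub>) \<odot>\<^bsub>M\<^esub> x = a \<odot>\<^bsub>M\<^esub> x"
  using left_module.smult_assoc1[OF assms(1,3) oneB_in_A assms(4)] assms by (simp add: unital_def)

lemma left_module_restrict:
  assumes M: "left_module A M" and u: "unital M"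
  shows "left_module B M"
proof -
  interpret M: left_module A M by (rule M)
  show ?thesis
    using u by (intro left_module.intro B.ring_axioms M.M.abelian_group_axioms left_module_axioms.intro)
      (auto simp: unital_def in_A B_add B_mult M.smult_closed M.smult_l_distr M.smult_r_distr M.smult_assoc1)
qed

lemma left_module_inflate:
  assumes M: "left_module B M"
  shows "left_module A (inflate M)"
proof -
  interpret M: left_module B M by (rule M)
  have ab: "abelian_group (inflate M)"
    using M.M.abelian_group_axioms
    by (auto simp: abelian_group_def abelian_monoid_def abelian_group_axioms_def)
  show ?thesis
  proof (intro left_module.intro A.ring_axioms ab left_module_axioms.intro)
    fix a b x assume a: "a \<in> carrier A" and b: "b \<in> carrier A" and x: "x \<in> carrier (inflate M)"
    show "(a \<oplus>\<^bsub>A\<^esub> b) \<odot>\<^bsub>inflate M\<^esub> x = a \<odot>\<^bsub>inflate M\<^esub> x \<oplus>\<^bsub>inflate M\<^esub> b \<odot>\<^bsub>inflate M\<^esub> x"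
      using a b x oneB_in_A M.smult_l_distr[OF right_in_B[OF a] right_in_B[OF b]]
      by (simp add: A.l_distr B_add right_in_B)
    show "(a \<otimes>\<^bsub>A\<^esub> b) \<odot>\<^bsub>inflate M\<^esub> x = a \<odot>\<^bsub>inflate M\<^esub> (b \<odot>\<^bsub>inflate M\<^esub> x)"
      using a b x by (simp add: right_mult M.smult_assoc1 right_in_B)
  qed (auto simp: M.smult_closed M.smult_r_distr right_in_B oneB_in_A M.smult_one)
qed

lemma lmod_hom_restrict: "f \<in> lmod_hom A M N \<Longrightarrow> f \<in> lmod_hom B M N"
  using in_A by (auto simp: lmod_hom_def)

lemma lmod_hom_inflate: "f \<in> lmod_hom B M N \<Longrightarrow> f \<in> lmod_hom A (inflate M) (inflate N)"
  using right_in_B by (auto simp: lmod_hom_def)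

lemma lmod_hom_inflate_left:
  assumes "left_module A N" "unital N" "f \<in> lmod_hom B M N"
  shows "f \<in> lmod_hom A (inflate M) N"
proof (rule lmod_homI)
  fix a x assume a: "a \<in> carrier A" and x: "x \<in> carrier (inflate M)"
  hence "f ((a \<otimes>\<^bsub>A\<^esub> \<one>\<^bsub>B\<^esub>) \<odot>\<^bsub>M\<^esub> x) = (a \<otimes>\<^bsub>A\<^esub> \<one>\<^bsub>B\<^esub>) \<odot>\<^bsub>N\<^esub> f x"
    using lmod_homD(3)[OF assms(3) right_in_B] by simp
  thus "f (a \<odot>\<^bsub>inflate M\<^esub> x) = a \<odot>\<^bsub>N\<^esub> f x"
    using smult_right[OF assms(1,2) a] lmod_homD(1)[OF assms(3)] x by simp
qed (use lmod_homD[OF assms(3)] in auto)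

lemma lmod_hom_inflate_right:
  assumes "left_module A M" "unital M" "f \<in> lmod_hom B M N"
  shows "f \<in> lmod_hom A M (inflate N)"
proof (rule lmod_homI)
  fix a x assume a: "a \<in> carrier A" and x: "x \<in> carrier M"
  have "f ((a \<otimes>\<^bsub>A\<^esub> \<one>\<^bsub>B\<^esub>) \<odot>\<^bsub>M\<^esub> x) = (a \<otimes>\<^bsub>A\<^esub> \<one>\<^bsub>B\<^esub>) \<odot>\<^bsub>N\<^esub> f x"
    using lmod_homD(3)[OF assms(3) right_in_B[OF a] x] .
  thus "f (a \<odot>\<^bsub>M\<^esub> x) = a \<odot>\<^bsub>inflate N\<^esub> f x"
    using smult_right[OF assms(1,2) a x] by simp
qed (use lmod_homD[OF assms(3)] in auto)

text \<open>If \<open>e x = x\<close>, then \<open>a x = (a e) x\<close>, which \<open>e\<close> fixes because \<open>e (a e) = a e\<close>.\<close>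

lemma submodule_unital_part:
  assumes M: "left_module A M"
  shows "submodule {x \<in> carrier M. \<one>\<^bsub>B\<^esub> \<odot>\<^bsub>M\<^esub> x = x} A M"
proof -
  interpret M: left_module A M by (rule M)
  show ?thesis
  proof (rule submoduleI'[OF M])
    fix a x assume a: "a \<in> carrier A" and "x \<in> {x \<in> carrier M. \<one>\<^bsub>B\<^esub> \<odot>\<^bsub>M\<^esub> x = x}"
    hence x: "x \<in> carrier M" "\<one>\<^bsub>B\<^esub> \<odot>\<^bsub>M\<^esub> x = x" by auto
    have ax: "a \<odot>\<^bsub>M\<^esub> x = (a \<otimes>\<^bsub>A\<^esub> \<one>\<^bsub>B\<^esub>) \<odot>\<^bsub>M\<^esub> x"
      using a x oneB_in_A by (simp add: M.smult_assoc1)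
    have "\<one>\<^bsub>B\<^esub> \<odot>\<^bsub>M\<^esub> ((a \<otimes>\<^bsub>A\<^esub> \<one>\<^bsub>B\<^esub>) \<odot>\<^bsub>M\<^esub> x) = (\<one>\<^bsub>B\<^esub> \<otimes>\<^bsub>A\<^esub> (a \<otimes>\<^bsub>A\<^esub> \<one>\<^bsub>B\<^esub>)) \<odot>\<^bsub>M\<^esub> x"
      using M.smult_assoc1[OF oneB_in_A in_A[OF right_in_B[OF a]] x(1)] by simp
    hence "\<one>\<^bsub>B\<^esub> \<odot>\<^bsub>M\<^esub> (a \<odot>\<^bsub>M\<^esub> x) = a \<odot>\<^bsub>M\<^esub> x"
      using left_B[OF right_in_B[OF a]] ax by simp
    thus "a \<odot>\<^bsub>M\<^esub> x \<in> {x \<in> carrier M. \<one>\<^bsub>B\<^esub> \<odot>\<^bsub>M\<^esub> x = x}" using a x M.smult_closed by simp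
  qed (auto simp: M.smult_r_distr M.smult_zero_right oneB_in_A)
qed

lemma internal_direct_sum_inflate: "internal_direct_sum (inflate M) G \<longleftrightarrow> internal_direct_sum M G"
  by (simp add: internal_direct_sum_def finsum_def)

text \<open>A homomorphism from an inflated module takes values fixed by \<open>e\<close>. So a lifting problem over \<open>A\<close>
  restricts to the parts of \<open>N\<close> and \<open>L\<close> fixed by \<open>e\<close>, and becomes a lifting problem over \<open>B\<close>. It is still
  surjective, as \<open>g (e x) = e (g x)\<close>.\<close>

lemma projective_inflate:
  fixes M :: "('r, 'm) module"
  assumes M: "projective_module B M"
  shows "projective_module A (inflate M)"
  unfolding projective_module_def
proof (intro conjI allI impI)
  have Ml: "left_module B M" using M by (simp add: projective_module_def)
  thus "left_module A (inflate M)" by (rule left_module_inflate)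
  fix N :: "('r, 'm \<Rightarrow> 'r) module" and L :: "('r, 'm) module" and g h
  assume N: "left_module A N" and L: "left_module A L" and g: "g \<in> lmod_hom A N L"
    and surj: "g ` carrier N = carrier L" and h: "h \<in> lmod_hom A (inflate M) L"
  define Nu where "Nu = N\<lparr>carrier := {x \<in> carrier N. \<one>\<^bsub>B\<^esub> \<odot>\<^bsub>N\<^esub> x = x}\<rparr>"
  define Lu where "Lu = L\<lparr>carrier := {x \<in> carrier L. \<one>\<^bsub>B\<^esub> \<odot>\<^bsub>L\<^esub> x = x}\<rparr>"
  have Nu: "left_module B Nu" and Lu: "left_module B Lu"
    unfolding Nu_def Lu_def
    by (intro left_module_restrict left_module_submodule submodule_unital_part N L; simp add: unital_def)+
  have gl: "g \<in> lmod_hom B Nu Lu"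
    using lmod_homD[OF g] oneB_in_A in_A by (intro lmod_homI) (auto simp: Nu_def Lu_def simp flip: lmod_homD(3)[OF g])
  have "g ` carrier Nu = carrier Lu"
  proof (intro equalityI subsetI)
    fix y assume "y \<in> carrier Lu"
    hence y: "y \<in> carrier L" "\<one>\<^bsub>B\<^esub> \<odot>\<^bsub>L\<^esub> y = y" by (auto simp: Lu_def)
    have "y \<in> g ` carrier N" using y surj by simp
    then obtain x where x: "x \<in> carrier N" "y = g x" by auto
    have "\<one>\<^bsub>B\<^esub> \<odot>\<^bsub>N\<^esub> x \<in> carrier Nu"
      using x(1) left_module.smult_closed[OF N oneB_in_A x(1)]
        left_module.smult_assoc1[OF N oneB_in_A oneB_in_A x(1)] left_B[of "\<one>\<^bsub>B\<^esub>"] by (simp add: Nu_def)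
    moreover have "g (\<one>\<^bsub>B\<^esub> \<odot>\<^bsub>N\<^esub> x) = y" using lmod_homD(3)[OF g oneB_in_A x(1)] x(2) y(2) by simp
    ultimately show "y \<in> g ` carrier Nu" by blast
  qed (use lmod_homD(1)[OF gl] in auto)
  moreover have "h \<in> lmod_hom B M Lu"
  proof (rule lmod_homI)
    fix b x assume b: "b \<in> carrier B" and x: "x \<in> carrier M"
    show "h (b \<odot>\<^bsub>M\<^esub> x) = b \<odot>\<^bsub>Lu\<^esub> h x"
      using lmod_homD(3)[OF h in_A[OF b], of x] x b by (simp add: Lu_def right_B)
  next
    fix x assume x: "x \<in> carrier M"
    show "h x \<in> carrier Lu"
      using lmod_homD(1)[OF h, of x] lmod_homD(3)[OF h oneB_in_A, of x] x
        left_module.smult_one[OF Ml x] by (simp add: Lu_def right_B)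
  qed (use lmod_homD(2)[OF h] in \<open>simp add: Lu_def\<close>)
  ultimately obtain k where k: "k \<in> lmod_hom B M Nu" "\<And>x. x \<in> carrier M \<Longrightarrow> g (k x) = h x"
    using projective_moduleD[OF M Nu Lu gl] by metis
  have "left_module A Nu"
    unfolding Nu_def by (rule left_module_submodule[OF N submodule_unital_part[OF N]])
  moreover have "unital Nu" by (simp add: unital_def Nu_def)
  ultimately have "k \<in> lmod_hom A (inflate M) Nu" using k(1) by (intro lmod_hom_inflate_left)
  hence "k \<in> lmod_hom A (inflate M) N"
    by (auto simp: lmod_hom_def Nu_def)
  thus "\<exists>k \<in> lmod_hom A (inflate M) N. \<forall>x \<in> carrier (inflate M). g (k x) = h x"
    using k(2) by (intro bexI) auto
qed

lemma projective_restrict: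
  fixes M :: "('r, 'm) module"
  assumes M: "projective_module A M" and u: "unital M"
  shows "projective_module B M"
  unfolding projective_module_def
proof (intro conjI allI impI)
  have Ml: "left_module A M" using M by (simp add: projective_module_def)
  thus "left_module B M" using u by (rule left_module_restrict)
  fix N :: "('r, 'm \<Rightarrow> 'r) module" and L :: "('r, 'm) module" and g h
  assume N: "left_module B N" and L: "left_module B L" and g: "g \<in> lmod_hom B N L"
    and surj: "g ` carrier N = carrier L" and h: "h \<in> lmod_hom B M L"
  have "g ` carrier (inflate N) = carrier (inflate L)" using surj by simp
  from projective_moduleD[OF M left_module_inflate[OF N] left_module_inflate[OF L] lmod_hom_inflate[OF g]
    this lmod_hom_inflate_right[OF Ml u h]]
  obtain k where k: "k \<in> lmod_hom A M (inflate N)" "\<And>x. x \<in> carrier M \<Longrightarrow> g (k x) = h x" by metis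
  have "k \<in> lmod_hom B M N"
    using lmod_hom_restrict[OF k(1)] right_B by (simp add: lmod_hom_def)
  thus "\<exists>k \<in> lmod_hom B M N. \<forall>x \<in> carrier M. g (k x) = h x" using k(2) by blast
qed

lemma linear_resolution_inflate:
  assumes M: "linear_resolution B Bg N H M G d \<epsilon>" and N: "left_module A N" and u: "unital N"
  shows "linear_resolution A Ag N H (\<lambda>n. inflate (M n)) G d \<epsilon>"
proof -
  note M' = linear_resolutionD[OF M]
  have gM: "graded_module A Ag (inflate (M n)) (G n)" for n
    using left_module_inflate[OF M'(3)] graded_moduleD(3,5)[OF M'(1)] right_in_Bg
    by (simp add: graded_module_def internal_direct_sum_inflate)
  show ?thesis
  proof (rule linear_resolutionI)
    show "graded_module A Ag (inflate (M n)) (G n)" "projective_module A (inflate (M n))"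
      "d n \<in> graded_hom A (inflate (M (Suc n))) (G (Suc n)) (inflate (M n)) (G n)" for n
      using gM projective_inflate[OF M'(2)] M'(4)[of n] lmod_hom_inflate by (auto simp: graded_hom_def)
    show "\<epsilon> \<in> graded_hom A (inflate (M 0)) (G 0) N H"
      using M'(5) lmod_hom_inflate_left[OF N u] by (auto simp: graded_hom_def)
    show "generated_by A (inflate (M n)) (G n n)" for n
    proof (rule generated_byI[OF graded_moduleD(1,4)[OF gM]])
      fix K x assume K: "submodule K A (inflate (M n))" and G: "G n n \<subseteq> K" and x: "x \<in> carrier (inflate (M n))"
      note K' = submoduleD[OF left_module_inflate[OF M'(3)] K]
      have "submodule K B (M n)"
      proof (rule submoduleI'[OF M'(3)])
        fix b y assume "b \<in> carrier B" "y \<in> K"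
        thus "b \<odot>\<^bsub>M n\<^esub> y \<in> K" using K'(5)[of b y] by (simp add: in_A right_B)
      qed (use K'(1-3) in simp_all)
      from generated_byD[OF M'(11) this G] show "x \<in> K" using x by simp
    qed
  qed (use M'(6-10) in auto)
qed

text \<open>If \<open>x\<close> is a generator, then so is \<open>e x - x\<close>, since \<open>e\<close> has degree \<open>0\<close>. Its boundary vanishes by induction, and
  generators are determined by their boundaries.\<close>

lemma linear_resolution_unital:
  assumes M: "linear_resolution A Ag N H M G d \<epsilon>" and N: "left_module A N" and u: "unital N"
  shows "unital (M n)"
proof (induction n)
  note M' = linear_resolutionD[OF M]
  have ext: "unital (M n)" if "\<And>x. x \<in> G n n \<Longrightarrow> \<one>\<^bsub>B\<^esub> \<odot>\<^bsub>M n\<^esub> x = x" for n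
  proof -
    have "G n n \<subseteq> {x \<in> carrier (M n). \<one>\<^bsub>B\<^esub> \<odot>\<^bsub>M n\<^esub> x = x}"
      using that graded_moduleD(6)[OF M'(1)] by blast
    from generated_byD[OF M'(11) submodule_unital_part[OF M'(3)] this] show ?thesis
      by (auto simp: unital_def)
  qed
  have one: "\<one>\<^bsub>B\<^esub> \<in> Ag 0"
  proof -
    interpret CA: connected_ring A R Ag by (rule A)
    have "\<one>\<^bsub>A\<^esub> \<in> Ag 0" using CA.grade_zero CA.subring_R by (simp add: subring_def submonoid.one_closed)
    from right_in_Bg[OF this] Bg_sub oneB_in_A show ?thesis by auto
  qed
  have diff: "\<one>\<^bsub>B\<^esub> \<odot>\<^bsub>M n\<^esub> x \<oplus>\<^bsub>M n\<^esub> \<ominus>\<^bsub>M n\<^esub> x \<in> G n n" if "x \<in> G n n" for n x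
    using that graded_moduleD(5)[OF M'(1) one] grade_closed(3,4)[OF graded_moduleD(2,3)[OF M'(1)]] by fastforce
  have diff0: "\<one>\<^bsub>B\<^esub> \<odot>\<^bsub>M n\<^esub> x = x" if "x \<in> G n n" "\<one>\<^bsub>B\<^esub> \<odot>\<^bsub>M n\<^esub> x \<oplus>\<^bsub>M n\<^esub> \<ominus>\<^bsub>M n\<^esub> x = \<zero>\<^bsub>M n\<^esub>" for n x
  proof -
    have "x \<in> carrier (M n)" by (rule graded_moduleD(6)[OF M'(1) that(1)])
    from eq_of_add_minus[OF graded_moduleD(2)[OF M'(1)] left_module.smult_closed[OF M'(3) oneB_in_A this] this that(2)]
    show ?thesis .
  qed
  have hom: "f (\<one>\<^bsub>B\<^esub> \<odot>\<^bsub>M n\<^esub> x \<oplus>\<^bsub>M n\<^esub> \<ominus>\<^bsub>M n\<^esub> x) = \<zero>\<^bsub>L\<^esub>"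
    if L: "left_module A L" "unital L" and f: "f \<in> lmod_hom A (M n) L" and x: "x \<in> G n n" for f L n x
  proof -
    interpret L: left_module A L by (rule L(1))
    have xc: "x \<in> carrier (M n)" by (rule graded_moduleD(6)[OF M'(1) x])
    have "f (\<one>\<^bsub>B\<^esub> \<odot>\<^bsub>M n\<^esub> x \<oplus>\<^bsub>M n\<^esub> \<ominus>\<^bsub>M n\<^esub> x) = \<one>\<^bsub>B\<^esub> \<odot>\<^bsub>L\<^esub> f x \<oplus>\<^bsub>L\<^esub> \<ominus>\<^bsub>L\<^esub> f x"
      using lmod_hom_diff[OF M'(3) L(1) f left_module.smult_closed[OF M'(3) oneB_in_A xc] xc]
        lmod_homD(3)[OF f oneB_in_A xc] by simp
    also have "\<dots> = \<zero>\<^bsub>L\<^esub>"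
      using L(2) lmod_homD(1)[OF f xc] by (simp add: unital_def L.r_neg)
    finally show ?thesis .
  qed
  {
    case 0
    show ?case
      using linear_resolution_bottom_inj(1)[OF A M diff hom[OF N u graded_homD(1)[OF M'(5)]]] diff0
      by (intro ext) blast
  next
    case (Suc n)
    show ?case
      using linear_resolution_bottom_inj(2)[OF A M diff hom[OF M'(3) Suc graded_homD(1)[OF M'(4)]]] diff0
      by (intro ext) blast
  }
qed

lemma linear_resolution_restrict:
  assumes M: "linear_resolution A Ag N H M G d \<epsilon>" and N: "left_module A N" and u: "unital N"
  shows "linear_resolution B Bg N H M G d \<epsilon>"
proof -
  note M' = linear_resolutionD[OF M]
  note uM = linear_resolution_unital[OF M N u]
  have gM: "graded_module B Bg (M n) (G n)" for n
    using left_module_restrict[OF M'(3) uM] graded_moduleD(3,5)[OF M'(1)] subsetD[OF Bg_sub]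
    by (simp add: graded_module_def)
  show ?thesis
  proof (rule linear_resolutionI)
    show "graded_module B Bg (M n) (G n)" "projective_module B (M n)"
      "d n \<in> graded_hom B (M (Suc n)) (G (Suc n)) (M n) (G n)" for n
      using gM projective_restrict[OF M'(2) uM] M'(4)[of n] lmod_hom_restrict by (auto simp: graded_hom_def)
    show "\<epsilon> \<in> graded_hom B (M 0) (G 0) N H"
      using M'(5) lmod_hom_restrict by (auto simp: graded_hom_def)
    show "generated_by B (M n) (G n n)" for n
    proof (rule generated_byI[OF graded_moduleD(1,4)[OF gM]])
      fix K x assume K: "submodule K B (M n)" and G: "G n n \<subseteq> K" and x: "x \<in> carrier (M n)"
      note K' = submoduleD[OF left_module_restrict[OF M'(3) uM] K]
      have "submodule K A (M n)"
      proof (rule submoduleI'[OF M'(3) K'(1-3)])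
        fix a y assume a: "a \<in> carrier A" and y: "y \<in> K"
        hence "y \<in> carrier (M n)" using K'(1) by blast
        from K'(5)[OF right_in_B[OF a] y] smult_right[OF M'(3) uM a this] show "a \<odot>\<^bsub>M n\<^esub> y \<in> K" by simp
      qed
      from generated_byD[OF M'(11) this G x] show "x \<in> K" .
    qed
  qed (use M'(6-10) in auto)
qed

end

section \<open>Sums of indecomposable projectives\<close>

text \<open>The module \<open>\<Oplus>\<^bsub>i \<in> I\<^esub> A e\<^bsub>y i, y i\<^esub>\<close>, which is projective. The coordinate with index \<open>i\<close> is a function supported
  on the pairs \<open>(x, y i)\<close> with \<open>x \<le> y i\<close>.\<close>

definition proj_module :: "'a set \<Rightarrow> 'a rel \<Rightarrow> nat set \<Rightarrow> (nat \<Rightarrow> 'a) \<Rightarrow>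
    ('a, 'k :: field) inc_module" where
  "proj_module P r I y = \<lparr>carrier = {\<phi>. \<forall>i x z. \<phi> i (x, z) \<noteq> 0 \<longrightarrow> i \<in> I \<and> z = y i \<and> (x, z) \<in> r},
     mult = undefined, one = undefined, zero = (\<lambda>i p. 0), add = (\<lambda>\<phi> \<psi> i p. \<phi> i p + \<psi> i p),
     smult = (\<lambda>a \<phi> i. a \<otimes>\<^bsub>incidence_ring P r\<^esub> \<phi> i)\<rparr>"

text \<open>The generators are placed in degree \<open>s\<close>.\<close>

definition proj_grading :: "'a rel \<Rightarrow> nat set \<Rightarrow> (nat \<Rightarrow> 'a) \<Rightarrow> nat \<Rightarrow> nat \<Rightarrow>
    (nat \<Rightarrow> 'a \<times> 'a \<Rightarrow> 'k :: field) set" where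
  "proj_grading r I y s n = {\<phi>. \<forall>i x z. \<phi> i (x, z) \<noteq> 0 \<longrightarrow>
     i \<in> I \<and> z = y i \<and> (x, z) \<in> r \<and> interval_length r x z + s = n}"

definition proj_generator :: "(nat \<Rightarrow> 'a) \<Rightarrow> nat \<Rightarrow> nat \<Rightarrow> 'a \<times> 'a \<Rightarrow> 'k :: field" where
  "proj_generator y i = (\<lambda>j. if j = i then single (y i, y i) 1 else (\<lambda>p. 0))"

context finite_graded_poset
begin

abbreviation Proj :: "nat set \<Rightarrow> (nat \<Rightarrow> 'a) \<Rightarrow> ('a, 'k) inc_module" where
  "Proj \<equiv> proj_module P r"

lemma proj_carrier_iff: "\<phi> \<in> carrier (Proj I y) \<longleftrightarrow>
    (\<forall>i x z. \<phi> i (x, z) \<noteq> 0 \<longrightarrow> i \<in> I \<and> z = y i \<and> (x, z) \<in> r)"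
  by (simp add: proj_module_def)

lemma proj_carrierD:
  assumes "\<phi> \<in> carrier (Proj I y)" "\<phi> i (x, z) \<noteq> 0"
  shows "i \<in> I" "z = y i" "(x, z) \<in> r"
  using assms unfolding proj_carrier_iff by blast+

lemma proj_gradingD:
  assumes "\<phi> \<in> proj_grading r I y s n" "\<phi> i (x, z) \<noteq> 0"
  shows "i \<in> I" "z = y i" "(x, z) \<in> r" "len x z + s = n"
  using assms unfolding proj_grading_def by blast+

lemma proj_simps [simp]:
  "\<zero>\<^bsub>Proj I y\<^esub> = (\<lambda>i p. 0)"
  "\<phi> \<oplus>\<^bsub>Proj I y\<^esub> \<psi> = (\<lambda>i p. \<phi> i p + \<psi> i p)"
  "a \<odot>\<^bsub>Proj I y\<^esub> \<phi> = (\<lambda>i. a \<otimes>\<^bsub>Inc\<^esub> \<phi> i)"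
  by (simp_all add: proj_module_def)

lemma proj_in_Inc: "\<phi> \<in> carrier (Proj I y) \<Longrightarrow> \<phi> i \<in> carrier Inc"
  by (auto simp: proj_carrier_iff incidence_simps)

lemma proj_left_module: "left_module Inc (Proj I y)"
proof -
  interpret A: ring Inc by (rule incidence_ring_ring)
  let ?M = "Proj I y"
  show ?thesis
  proof (intro left_module.intro A.ring_axioms abelian_groupI left_module_axioms.intro)
    fix \<phi> assume "\<phi> \<in> carrier ?M"
    thus "\<exists>\<psi>\<in>carrier ?M. \<psi> \<oplus>\<^bsub>?M\<^esub> \<phi> = \<zero>\<^bsub>?M\<^esub>"
      by (intro bexI[of _ "\<lambda>i p. - \<phi> i p"]) (auto simp: proj_carrier_iff)
  next
    fix \<phi> \<psi> assume "\<phi> \<in> carrier ?M" "\<psi> \<in> carrier ?M"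
    thus "\<phi> \<oplus>\<^bsub>?M\<^esub> \<psi> \<in> carrier ?M" by (simp add: proj_carrier_iff) (metis add.right_neutral)
  next
    fix a \<phi> assume a: "a \<in> carrier Inc" and \<phi>: "\<phi> \<in> carrier ?M"
    show "a \<odot>\<^bsub>?M\<^esub> \<phi> \<in> carrier ?M"
      unfolding proj_carrier_iff
    proof (intro allI impI)
      fix i x z assume "(a \<odot>\<^bsub>?M\<^esub> \<phi>) i (x, z) \<noteq> 0"
      hence nz: "(a \<otimes>\<^bsub>Inc\<^esub> \<phi> i) (x, z) \<noteq> 0" by simp
      then obtain w where "a (x, w) * \<phi> i (w, z) \<noteq> 0" unfolding incidence_simps by (meson sum.neutral)
      thus "i \<in> I \<and> z = y i \<and> (x, z) \<in> r"
        using proj_carrierD(1,2)[OF \<phi>, where i = i and x = w and z = z] incidence_supp[OF incidence_mult_closed[OF a proj_in_Inc[OF \<phi>]] nz]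
        by auto
    qed
  next
    fix \<phi> assume \<phi>: "\<phi> \<in> carrier ?M"
    show "\<one>\<^bsub>Inc\<^esub> \<odot>\<^bsub>?M\<^esub> \<phi> = \<phi>" by (simp add: proj_in_Inc[OF \<phi>])
  next
    fix a b \<phi> assume ab: "a \<in> carrier Inc" "b \<in> carrier Inc"
      and \<phi>: "\<phi> \<in> carrier ?M"
    show "(a \<otimes>\<^bsub>Inc\<^esub> b) \<odot>\<^bsub>?M\<^esub> \<phi> = a \<odot>\<^bsub>?M\<^esub> (b \<odot>\<^bsub>?M\<^esub> \<phi>)"
      by (simp add: A.m_assoc[OF ab proj_in_Inc[OF \<phi>]])
  qed (auto simp: proj_carrier_iff fun_eq_iff incidence_simps(2,4) algebra_simps sum.distrib)
qed

lemma proj_uminus: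
  assumes "\<phi> \<in> carrier (Proj I y)"
  shows "\<ominus>\<^bsub>Proj I y\<^esub> \<phi> = (\<lambda>i p. - \<phi> i p)"
  by (rule abelian_group.minus_equality[OF left_moduleD(2)[OF proj_left_module]])
    (use assms in \<open>auto simp: proj_carrier_iff\<close>)

lemma proj_graded_module:
  assumes "finite I"
  shows "graded_module Inc Cmp (Proj I y) (proj_grading r I y s)"
proof -
  let ?M = "Proj I y"
  let ?G = "proj_grading r I y s :: nat \<Rightarrow> (nat \<Rightarrow> 'a \<times> 'a \<Rightarrow> 'k) set"
  have G_iff: "\<phi> \<in> ?G n \<longleftrightarrow> \<phi> \<in> carrier ?M \<and> (\<forall>i x z. \<phi> i (x, z) \<noteq> 0 \<longrightarrow> len x z + s = n)" for \<phi> n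
    by (auto simp: proj_grading_def proj_carrier_iff)
  have "internal_direct_sum ?M ?G"
  proof (rule internal_direct_sumI[where c = "\<lambda>n \<phi> i p. if len (fst p) (snd p) + s = n then \<phi> i p else 0"])
    show ab: "abelian_group ?M" by (rule left_moduleD(2)[OF proj_left_module])
    show "subgroup (?G n) (add_monoid ?M)" for n
    proof (rule additive_subgroupI[OF ab])
      show "?G n \<subseteq> carrier ?M" using G_iff by blast
      show "\<ominus>\<^bsub>?M\<^esub> \<phi> \<in> ?G n" if "\<phi> \<in> ?G n" for \<phi>
        using that proj_uminus[of \<phi> I y] by (auto simp: G_iff proj_carrier_iff)
      show "\<phi> \<oplus>\<^bsub>?M\<^esub> \<psi> \<in> ?G n" if "\<phi> \<in> ?G n" "\<psi> \<in> ?G n" for \<phi> \<psi>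
        using that unfolding proj_grading_def proj_simps mem_Collect_eq by (metis add.right_neutral)
    qed (simp add: proj_grading_def)
    show "finite {n. (\<lambda>i p. if len (fst p) (snd p) + s = n then \<phi> i p else 0) \<noteq> \<zero>\<^bsub>?M\<^esub>}"
      if \<phi>: "\<phi> \<in> carrier ?M" for \<phi>
    proof (rule finite_subset)
      show "finite ((\<lambda>p. len (fst p) (snd p) + s) ` r)" using finite_r by simp
      show "{n. (\<lambda>i p. if len (fst p) (snd p) + s = n then \<phi> i p else 0) \<noteq> \<zero>\<^bsub>?M\<^esub>} \<subseteq>
          (\<lambda>p. len (fst p) (snd p) + s) ` r"
      proof
        fix n assume "n \<in> {n. (\<lambda>i p. if len (fst p) (snd p) + s = n then \<phi> i p else 0) \<noteq> \<zero>\<^bsub>?M\<^esub>}"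
        then obtain i x z where "(if len x z + s = n then \<phi> i (x, z) else 0) \<noteq> 0"
          by (auto simp: fun_eq_iff)
        thus "n \<in> (\<lambda>p. len (fst p) (snd p) + s) ` r"
          using proj_carrierD(3)[OF \<phi>, where i = i and x = x and z = z] by (intro image_eqI[of _ _ "(x, z)"]) (auto split: if_splits)
      qed
    qed
    show "\<phi> = \<zero>\<^bsub>?M\<^esub>" if "\<And>n. (\<lambda>i p. if len (fst p) (snd p) + s = n then \<phi> i p else 0) = \<zero>\<^bsub>?M\<^esub>" for \<phi>
    proof (intro ext)
      fix i p show "\<phi> i p = \<zero>\<^bsub>?M\<^esub> i p"
        using fun_cong[OF fun_cong[OF that[of "len (fst p) (snd p) + s"], of i], of p] by simp
    qed
    show "(\<lambda>i p. if len (fst p) (snd p) + s = m then \<phi> i p else 0) = (if m = n then \<phi> else \<zero>\<^bsub>?M\<^esub>)"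
      if "\<phi> \<in> ?G n" for m n \<phi>
      using that by (fastforce simp: proj_grading_def fun_eq_iff)
    show "(\<lambda>i p. if len (fst p) (snd p) + s = n then (\<phi> \<oplus>\<^bsub>?M\<^esub> \<psi>) i p else 0) =
        (\<lambda>i p. if len (fst p) (snd p) + s = n then \<phi> i p else 0) \<oplus>\<^bsub>?M\<^esub>
        (\<lambda>i p. if len (fst p) (snd p) + s = n then \<psi> i p else 0)" for n \<phi> \<psi>
      by (auto simp: fun_eq_iff)
  qed (auto simp: proj_grading_def proj_carrier_iff)
  moreover have "a \<odot>\<^bsub>?M\<^esub> \<phi> \<in> ?G (p + n)" if a: "a \<in> Cmp p" and \<phi>: "\<phi> \<in> ?G n" for a \<phi> p n
    unfolding G_iff
  proof (intro conjI allI impI)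
    have "a \<in> carrier Inc" using connected_ringD(4)[OF incidence_connected] a by blast
    thus "a \<odot>\<^bsub>?M\<^esub> \<phi> \<in> carrier ?M" using left_module.smult_closed[OF proj_left_module] \<phi> G_iff by blast
    fix i x z assume "(a \<odot>\<^bsub>?M\<^esub> \<phi>) i (x, z) \<noteq> 0"
    hence "(a \<otimes>\<^bsub>Inc\<^esub> \<phi> i) (x, z) \<noteq> 0" by simp
    then obtain w where "a (x, w) * \<phi> i (w, z) \<noteq> 0" unfolding incidence_simps by (meson sum.neutral)
    hence "(x, w) \<in> r" "len x w = p" "(w, z) \<in> r" "len w z + s = n"
      using a proj_gradingD(3,4)[OF \<phi>] by (auto simp: Cmp_iff)
    thus "len x z + s = p + n" using len_add by fastforce
  qed
  ultimately show ?thesis using proj_left_module by (simp add: graded_module_def)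
qed

lemma proj_generator_in: "i \<in> I \<Longrightarrow> y i \<in> P \<Longrightarrow> proj_generator y i \<in> carrier (Proj I y)"
  "i \<in> I \<Longrightarrow> y i \<in> P \<Longrightarrow> proj_generator y i \<in> proj_grading r I y s s"
  by (auto simp: proj_generator_def single_def proj_carrier_iff proj_grading_def r_refl len_refl split: if_splits)

lemma proj_smult_generator:
  assumes \<phi>: "\<phi> \<in> carrier (Proj I y)" and y: "y i \<in> P"
  shows "\<phi> i \<odot>\<^bsub>Proj I y\<^esub> proj_generator y i = (\<lambda>j. if j = i then \<phi> i else (\<lambda>p. 0))"
proof (intro ext)
  fix j and p :: "'a \<times> 'a"
  obtain x z where p: "p = (x, z)" by (cases p)
  have "(\<Sum>w\<in>P. \<phi> i (x, w) * single (y i, y i) 1 (w, z)) = (\<Sum>w\<in>P. if w = y i then \<phi> i (x, z) else 0)"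
    using proj_carrierD(2)[OF \<phi>] by (intro sum.cong) (auto simp: single_def)
  also have "\<dots> = \<phi> i (x, z)" using y finite_P by simp
  finally show "(\<phi> i \<odot>\<^bsub>Proj I y\<^esub> proj_generator y i) j p = (if j = i then \<phi> i else (\<lambda>p. 0)) p"
    by (auto simp: proj_generator_def p incidence_simps)
qed

lemma proj_generated:
  assumes I: "finite I" and y: "\<And>i. i \<in> I \<Longrightarrow> y i \<in> P"
  shows "generated_by Inc (Proj I y) (proj_grading r I y s s)"
proof (rule generated_byI[OF proj_left_module])
  let ?M = "Proj I y"
  show "proj_grading r I y s s \<subseteq> carrier ?M"
    using graded_moduleD(4)[OF proj_graded_module[OF I]] .
  fix K \<phi> assume K: "submodule K Inc ?M" and G: "proj_grading r I y s s \<subseteq> K" and \<phi>: "\<phi> \<in> carrier ?M"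
  note K' = submoduleD[OF proj_left_module K]
  have "(\<lambda>i. if i \<in> S then \<phi> i else (\<lambda>p. 0)) \<in> K" if "S \<subseteq> I" for S
    using finite_subset[OF that I] that
  proof (induction S rule: finite_induct)
    case empty
    thus ?case using K'(2) by simp
  next
    case (insert i S)
    have "(\<lambda>j. if j = i then \<phi> i else (\<lambda>p. 0)) \<in> K"
      using K'(5)[OF proj_in_Inc[OF \<phi>], of "proj_generator y i" i] proj_smult_generator[OF \<phi> y, of i]
        subsetD[OF G proj_generator_in(2)] insert.prems y by auto
    from K'(3)[OF this insert.IH] insert.prems
    have "(\<lambda>j p. (if j = i then \<phi> i else (\<lambda>p. 0)) p + (if j \<in> S then \<phi> j else (\<lambda>p. 0)) p) \<in> K" by simp
    moreover have "(\<lambda>j p. (if j = i then \<phi> i else (\<lambda>p. 0)) p + (if j \<in> S then \<phi> j else (\<lambda>p. 0)) p) =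
        (\<lambda>j. if j \<in> insert i S then \<phi> j else (\<lambda>p. 0))"
      using insert.hyps by (auto simp: fun_eq_iff)
    ultimately show ?case by simp
  qed
  from this[of I] have "(\<lambda>i. if i \<in> I then \<phi> i else (\<lambda>p. 0)) \<in> K" by simp
  moreover have "(\<lambda>i. if i \<in> I then \<phi> i else (\<lambda>p. 0)) = \<phi>"
    using \<phi> by (force simp: fun_eq_iff proj_carrier_iff)
  ultimately show "\<phi> \<in> K" by simp
qed

lemma incidence_mult_zero: "(a \<otimes>\<^bsub>Inc\<^esub> (\<lambda>p. 0)) p = 0"
  by (cases p) (simp add: incidence_simps)

text \<open>A homomorphism from \<open>A e\<^bsub>y,y\<^esub>\<close> is determined by the image of the generator, and this image can be
  lifted.\<close>

lemma proj_projective: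
  assumes I: "finite I" and y: "\<And>i. i \<in> I \<Longrightarrow> y i \<in> P"
  shows "projective_module Inc (Proj I y)"
  using I y
proof (induction I rule: finite_induct)
  case empty
  let ?M = "Proj {} y"
  have zero: "\<phi> = (\<lambda>i p. 0)" if "\<phi> \<in> carrier ?M" for \<phi>
    using that by (force simp: proj_carrier_iff fun_eq_iff)
  show ?case
    unfolding projective_module_def
  proof (intro conjI proj_left_module allI impI)
    fix N :: "('a \<times> 'a \<Rightarrow> 'k, (nat \<Rightarrow> 'a \<times> 'a \<Rightarrow> 'k) \<Rightarrow> 'a \<times> 'a \<Rightarrow> 'k) module"
      and L :: "('a, 'k) inc_module" and g h
    assume N: "left_module Inc N" and L: "left_module Inc L" and g: "g \<in> lmod_hom Inc N L"
      and h: "h \<in> lmod_hom Inc ?M L"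
    interpret N: left_module Inc N by (rule N)
    have "(\<lambda>_. \<zero>\<^bsub>N\<^esub>) \<in> lmod_hom Inc ?M N" by (intro lmod_homI) (auto simp: N.smult_zero_right)
    moreover have "g \<zero>\<^bsub>N\<^esub> = h \<phi>" if "\<phi> \<in> carrier ?M" for \<phi>
      using lmod_hom_zero[OF N L g] lmod_hom_zero[OF proj_left_module L h] zero[OF that] by simp
    ultimately show "\<exists>k \<in> lmod_hom Inc ?M N. \<forall>\<phi> \<in> carrier ?M. g (k \<phi>) = h \<phi>" by (intro bexI ballI)
  qed
next
  case (insert i I)
  let ?M = "Proj {i} y"
  have yi: "y i \<in> P" using insert.prems by simp
  have "projective_module Inc ?M"
    unfolding projective_module_def
  proof (intro conjI proj_left_module allI impI)
    fix N :: "('a \<times> 'a \<Rightarrow> 'k, (nat \<Rightarrow> 'a \<times> 'a \<Rightarrow> 'k) \<Rightarrow> 'a \<times> 'a \<Rightarrow> 'k) module"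
      and L :: "('a, 'k) inc_module" and g h
    assume N: "left_module Inc N" and L: "left_module Inc L" and g: "g \<in> lmod_hom Inc N L"
      and surj: "g ` carrier N = carrier L" and h: "h \<in> lmod_hom Inc ?M L"
    interpret N: left_module Inc N by (rule N)
    have gen: "proj_generator y i \<in> carrier ?M" using proj_generator_in(1)[of i "{i}" y] yi by simp
    have "h (proj_generator y i) \<in> g ` carrier N" using lmod_homD(1)[OF h gen] surj by simp
    then obtain n where n: "n \<in> carrier N" "g n = h (proj_generator y i)" by auto
    have "(\<lambda>\<phi>. \<phi> i \<odot>\<^bsub>N\<^esub> n) \<in> lmod_hom Inc ?M N"
    proof (rule lmod_homI)
      fix \<phi> \<psi> assume c: "\<phi> \<in> carrier ?M" "\<psi> \<in> carrier ?M"
      have "(\<phi> \<oplus>\<^bsub>?M\<^esub> \<psi>) i = \<phi> i \<oplus>\<^bsub>Inc\<^esub> \<psi> i" by (simp add: incidence_simps)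
      thus "(\<phi> \<oplus>\<^bsub>?M\<^esub> \<psi>) i \<odot>\<^bsub>N\<^esub> n = \<phi> i \<odot>\<^bsub>N\<^esub> n \<oplus>\<^bsub>N\<^esub> \<psi> i \<odot>\<^bsub>N\<^esub> n"
        using N.smult_l_distr[OF proj_in_Inc[OF c(1)] proj_in_Inc[OF c(2)] n(1)] by simp
    next
      fix a \<phi> assume a: "a \<in> carrier Inc" and c: "\<phi> \<in> carrier ?M"
      show "(a \<odot>\<^bsub>?M\<^esub> \<phi>) i \<odot>\<^bsub>N\<^esub> n = a \<odot>\<^bsub>N\<^esub> (\<phi> i \<odot>\<^bsub>N\<^esub> n)"
        using N.smult_assoc1[OF a proj_in_Inc[OF c] n(1)] by simp
    qed (use N.smult_closed proj_in_Inc n(1) in blast)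
    moreover have "g (\<phi> i \<odot>\<^bsub>N\<^esub> n) = h \<phi>" if c: "\<phi> \<in> carrier ?M" for \<phi>
    proof -
      have "g (\<phi> i \<odot>\<^bsub>N\<^esub> n) = h (\<phi> i \<odot>\<^bsub>?M\<^esub> proj_generator y i)"
        using lmod_homD(3)[OF g proj_in_Inc[OF c] n(1)] lmod_homD(3)[OF h proj_in_Inc[OF c] gen] n(2) by simp
      also have "\<phi> i \<odot>\<^bsub>?M\<^esub> proj_generator y i = \<phi>"
        unfolding proj_smult_generator[OF c yi] using c by (force simp: proj_carrier_iff fun_eq_iff)
      finally show ?thesis .
    qed
    ultimately show "\<exists>k \<in> lmod_hom Inc ?M N. \<forall>\<phi> \<in> carrier ?M. g (k \<phi>) = h \<phi>" by (intro bexI ballI)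
  qed
  moreover have "projective_module Inc (Proj I y)"
    using insert by simp
  ultimately show ?case
  proof (rule projective_sum[OF _ _ proj_left_module, where ia = "\<lambda>\<phi>. \<phi>" and ib = "\<lambda>\<phi>. \<phi>" and
        pa = "\<lambda>\<phi> j. if j = i then \<phi> j else (\<lambda>p. 0)" and pb = "\<lambda>\<phi> j. if j \<in> I then \<phi> j else (\<lambda>p. 0)"])
    show "(\<lambda>\<phi> j. if j = i then \<phi> j else (\<lambda>p. 0)) \<in> lmod_hom Inc (Proj (insert i I) y) ?M"
      by (rule lmod_homI) (auto simp: proj_carrier_iff fun_eq_iff incidence_mult_zero split: if_splits)
    show "(\<lambda>\<phi> j. if j \<in> I then \<phi> j else (\<lambda>p. 0)) \<in> lmod_hom Inc (Proj (insert i I) y)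
        (Proj I y)"
      by (rule lmod_homI) (auto simp: proj_carrier_iff fun_eq_iff incidence_mult_zero split: if_splits)
    show "(\<lambda>j. if j = i then \<phi> j else (\<lambda>p. 0)) \<oplus>\<^bsub>Proj (insert i I) y\<^esub>
        (\<lambda>j. if j \<in> I then \<phi> j else (\<lambda>p. 0)) = \<phi>"
      if "\<phi> \<in> carrier (Proj (insert i I) y)" for \<phi>
      using that insert.hyps by (force simp: proj_carrier_iff fun_eq_iff)
  qed (auto intro!: lmod_homI simp: proj_carrier_iff)
qed

text \<open>Right multiplication by the matrix with entries \<open>\<kappa> i j e\<^bsub>y i, z j\<^esub>\<close>. When
  non-zero entries occur only at coverings, it raises lengths by one, and the shifts \<open>Suc s\<close> and
  \<open>s\<close> of the gradings compensate for this.\<close>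

definition matrix_map :: "nat set \<Rightarrow> (nat \<Rightarrow> 'a) \<Rightarrow> nat set \<Rightarrow> (nat \<Rightarrow> 'a) \<Rightarrow> (nat \<Rightarrow> nat \<Rightarrow> 'k :: field) \<Rightarrow>
    (nat \<Rightarrow> 'a \<times> 'a \<Rightarrow> 'k) \<Rightarrow> nat \<Rightarrow> 'a \<times> 'a \<Rightarrow> 'k" where
  "matrix_map I y J z \<kappa> \<phi> = (\<lambda>j (x, w). if j \<in> J \<and> w = z j then \<Sum>i\<in>I. \<kappa> i j * \<phi> i (x, y i) else 0)"

lemma matrix_map_hom:
  assumes cov: "\<And>i j. i \<in> I \<Longrightarrow> j \<in> J \<Longrightarrow> \<kappa> i j \<noteq> 0 \<Longrightarrow> (y i, z j) \<in> covering r"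
  shows "matrix_map I y J z \<kappa> \<in> graded_hom Inc
    (Proj I y) (proj_grading r I y (Suc s)) (Proj J z) (proj_grading r J z s)"
proof -
  have supp: "\<exists>i \<in> I. \<phi> i (x, y i) \<noteq> 0 \<and> (y i, z j) \<in> covering r \<and> j \<in> J \<and> w = z j"
    if "matrix_map I y J z \<kappa> \<phi> j (x, w) \<noteq> 0" for \<phi> j x w
  proof -
    have j: "j \<in> J" "w = z j" and "(\<Sum>i\<in>I. \<kappa> i j * \<phi> i (x, y i)) \<noteq> 0"
      using that by (auto simp: matrix_map_def split: if_splits)
    then obtain i where "i \<in> I" "\<kappa> i j * \<phi> i (x, y i) \<noteq> 0" by (meson sum.neutral)
    thus ?thesis using cov j by auto
  qed
  have cov_r: "(u, v) \<in> r" if "(u, v) \<in> covering r" for u v using that by (simp add: covering_def)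
  show ?thesis
    unfolding graded_hom_def
  proof (intro CollectI conjI allI lmod_homI image_subsetI)
    fix \<phi> assume \<phi>: "\<phi> \<in> carrier (Proj I y)"
    show "matrix_map I y J z \<kappa> \<phi> \<in> carrier (Proj J z)"
      unfolding proj_carrier_iff
    proof (intro allI impI)
      fix j x w assume "matrix_map I y J z \<kappa> \<phi> j (x, w) \<noteq> 0"
      from supp[OF this] obtain i where i: "i \<in> I" "\<phi> i (x, y i) \<noteq> 0" "(y i, z j) \<in> covering r" "j \<in> J" "w = z j"
        by blast
      hence "(x, y i) \<in> r" using proj_carrierD(3)[OF \<phi>] by blast
      thus "j \<in> J \<and> w = z j \<and> (x, w) \<in> r" using i r_trans cov_r by blast
    qed
  next
    fix \<phi> :: "nat \<Rightarrow> 'a \<times> 'a \<Rightarrow> 'k" and n assume \<phi>: "\<phi> \<in> proj_grading r I y (Suc s) n"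
    show "matrix_map I y J z \<kappa> \<phi> \<in> proj_grading r J z s n"
      unfolding proj_grading_def
    proof (intro CollectI allI impI)
      fix j x w assume "matrix_map I y J z \<kappa> \<phi> j (x, w) \<noteq> 0"
      from supp[OF this] obtain i where i: "i \<in> I" "\<phi> i (x, y i) \<noteq> 0" "(y i, z j) \<in> covering r" "j \<in> J" "w = z j"
        by blast
      hence x: "(x, y i) \<in> r" "len x (y i) + Suc s = n" using proj_gradingD(3,4)[OF \<phi>] by blast+
      have "len x (z j) = len x (y i) + 1" using len_add[OF x(1) cov_r[OF i(3)]] len_covering[OF i(3)] by simp
      thus "j \<in> J \<and> w = z j \<and> (x, w) \<in> r \<and> len x w + s = n" using i x r_trans[OF x(1) cov_r[OF i(3)]] by auto
    qed
  next
    fix \<phi> \<psi>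
    show "matrix_map I y J z \<kappa> (\<phi> \<oplus>\<^bsub>Proj I y\<^esub> \<psi>) =
        matrix_map I y J z \<kappa> \<phi> \<oplus>\<^bsub>Proj J z\<^esub> matrix_map I y J z \<kappa> \<psi>"
      by (auto simp: fun_eq_iff matrix_map_def algebra_simps sum.distrib)
  next
    fix \<phi> and b :: "'a \<times> 'a \<Rightarrow> 'k"
    have "(\<Sum>i\<in>I. \<kappa> i j * (\<Sum>w\<in>P. b (x, w) * \<phi> i (w, y i))) =
        (\<Sum>w\<in>P. b (x, w) * (\<Sum>i\<in>I. \<kappa> i j * \<phi> i (w, y i)))" for x j
    proof -
      have "(\<Sum>i\<in>I. \<kappa> i j * (\<Sum>w\<in>P. b (x, w) * \<phi> i (w, y i))) =
          (\<Sum>i\<in>I. \<Sum>w\<in>P. b (x, w) * (\<kappa> i j * \<phi> i (w, y i)))"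
        by (simp add: sum_distrib_left mult.left_commute)
      also have "\<dots> = (\<Sum>w\<in>P. \<Sum>i\<in>I. b (x, w) * (\<kappa> i j * \<phi> i (w, y i)))" by (rule sum.swap)
      finally show ?thesis by (simp add: sum_distrib_left)
    qed
    thus "matrix_map I y J z \<kappa> (b \<odot>\<^bsub>Proj I y\<^esub> \<phi>) =
        b \<odot>\<^bsub>Proj J z\<^esub> matrix_map I y J z \<kappa> \<phi>"
      by (auto simp: fun_eq_iff matrix_map_def incidence_simps)
  qed
qed

end

section \<open>The semisimple quotient\<close>

text \<open>The module \<open>\<Oplus>\<^bsub>x \<in> Q\<^esub> k e\<^bsub>x,x\<^esub>\<close>, on which an element of an incidence ring acts through its diagonal. The
  record does not depend on the ambient poset, so it serves for \<open>A\<close> and \<open>B\<close> at the same time. The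
  elements are stored at index \<open>0\<close> of a sequence, in order to have the type of the elements of the
  resolving modules; \<open>comparison_map\<close> needs this.\<close>

definition diag_module :: "'a set \<Rightarrow> ('a, 'k :: field) inc_module" where
  "diag_module Q = \<lparr>carrier = {\<phi>. \<forall>i p. \<phi> i p \<noteq> 0 \<longrightarrow> i = 0 \<and> p \<in> Id_on Q},
     mult = undefined, one = undefined, zero = (\<lambda>i p. 0), add = (\<lambda>\<phi> \<psi> i p. \<phi> i p + \<psi> i p),
     smult = (\<lambda>a \<phi> i p. a p * \<phi> i p)\<rparr>"

definition diag_grading :: "'a set \<Rightarrow> nat \<Rightarrow> (nat \<Rightarrow> 'a \<times> 'a \<Rightarrow> 'k :: field) set" where
  "diag_grading Q n = (if n = 0 then carrier (diag_module Q) else {\<lambda>i p. 0})"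

lemma diag_carrier_iff: "\<phi> \<in> carrier (diag_module Q) \<longleftrightarrow> (\<forall>i p. \<phi> i p \<noteq> 0 \<longrightarrow> i = 0 \<and> p \<in> Id_on Q)"
  by (simp add: diag_module_def)

lemma diag_simps [simp]:
  "\<zero>\<^bsub>diag_module Q\<^esub> = (\<lambda>i p. 0)"
  "\<phi> \<oplus>\<^bsub>diag_module Q\<^esub> \<psi> = (\<lambda>i p. \<phi> i p + \<psi> i p)"
  "a \<odot>\<^bsub>diag_module Q\<^esub> \<phi> = (\<lambda>i p. a p * \<phi> i p)"
  by (simp_all add: diag_module_def)

lemma diag_carrierD: "\<phi> \<in> carrier (diag_module Q) \<Longrightarrow> \<phi> i p \<noteq> 0 \<Longrightarrow> i = 0 \<and> (\<exists>x \<in> Q. p = (x, x))"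
  unfolding diag_carrier_iff by blast

context finite_graded_poset
begin

lemma mult_on_diag:
  assumes "a \<in> carrier Inc" "b \<in> carrier Inc" "x \<in> P"
  shows "(a \<otimes>\<^bsub>Inc\<^esub> b) (x, x) = a (x, x) * b (x, x)"
proof -
  have "(\<Sum>z\<in>P. a (x, z) * b (z, x)) = (\<Sum>z\<in>P. if z = x then a (x, x) * b (x, x) else 0)"
    using incidence_supp[OF assms(1)] incidence_supp[OF assms(2)] r_antisym
    by (intro sum.cong) (auto, blast)
  thus ?thesis using assms(3) finite_P by (simp add: incidence_simps)
qed

lemma diag_left_module:
  assumes Q: "Q \<subseteq> P"
  shows "left_module Inc (diag_module Q)"
proof -
  let ?M = "diag_module Q :: ('a, 'k) inc_module"
  show ?thesis
  proof (intro left_module.intro incidence_ring_ring abelian_groupI left_module_axioms.intro)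
    fix \<phi> assume "\<phi> \<in> carrier ?M"
    thus "\<exists>\<psi>\<in>carrier ?M. \<psi> \<oplus>\<^bsub>?M\<^esub> \<phi> = \<zero>\<^bsub>?M\<^esub>"
      by (intro bexI[of _ "\<lambda>i p. - \<phi> i p"]) (auto simp: diag_carrier_iff)
  next
    fix \<phi> \<psi> assume "\<phi> \<in> carrier ?M" "\<psi> \<in> carrier ?M"
    thus "\<phi> \<oplus>\<^bsub>?M\<^esub> \<psi> \<in> carrier ?M" unfolding diag_carrier_iff diag_simps by (metis add.right_neutral)
  next
    fix a b \<phi> assume ab: "a \<in> carrier Inc" "b \<in> carrier Inc"
      and \<phi>: "\<phi> \<in> carrier ?M"
    have "(a \<otimes>\<^bsub>Inc\<^esub> b) p * \<phi> i p = a p * (b p * \<phi> i p)" for i p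
    proof (cases "\<phi> i p = 0")
      case False
      then obtain x where "x \<in> Q" "p = (x, x)" using diag_carrierD[OF \<phi>] by blast
      thus ?thesis using mult_on_diag[OF ab] Q by auto
    qed simp
    thus "(a \<otimes>\<^bsub>Inc\<^esub> b) \<odot>\<^bsub>?M\<^esub> \<phi> = a \<odot>\<^bsub>?M\<^esub> (b \<odot>\<^bsub>?M\<^esub> \<phi>)" by (simp only: diag_simps)
  next
    fix \<phi> assume \<phi>: "\<phi> \<in> carrier ?M"
    have "\<one>\<^bsub>Inc\<^esub> p * \<phi> i p = \<phi> i p" for i p
      using diag_carrierD[OF \<phi>, of i p] Q by (cases "\<phi> i p = 0") (auto simp: incidence_one)
    thus "\<one>\<^bsub>Inc\<^esub> \<odot>\<^bsub>?M\<^esub> \<phi> = \<phi>" by (simp only: diag_simps)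
  qed (auto simp: diag_carrier_iff incidence_simps algebra_simps)
qed

lemma Cmp_pos_diag: "a \<in> Cmp p \<Longrightarrow> 0 < p \<Longrightarrow> x \<in> P \<Longrightarrow> a (x, x) = 0"
  using len_refl[of x] by (force simp: Cmp_iff)

lemma diag_graded_module:
  assumes Q: "Q \<subseteq> P"
  shows "graded_module Inc Cmp (diag_module Q) (diag_grading Q)"
proof -
  let ?M = "diag_module Q :: ('a, 'k) inc_module"
  note M = diag_left_module[OF Q]
  interpret M: left_module Inc ?M by (rule M)
  have "internal_direct_sum ?M (diag_grading Q)"
  proof (rule internal_direct_sumI[where c = "\<lambda>n \<phi>. if n = 0 then \<phi> else (\<lambda>i p. 0)"])
    show ab: "abelian_group ?M" by (rule left_moduleD(2)[OF M])
    show "subgroup (diag_grading Q n) (add_monoid ?M)" for n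
    proof (cases "n = 0")
      case True
      thus ?thesis using M.M.a_group group.subgroup_self by (fastforce simp: diag_grading_def)
    next
      case False
      hence "diag_grading Q n = {\<zero>\<^bsub>?M\<^esub>}" by (simp add: diag_grading_def)
      thus ?thesis using submodule.axioms(1)[OF submodule_zero[OF M]] by (simp only:)
    qed
    show "finite {n. (if n = 0 then \<phi> else (\<lambda>i p. 0)) \<noteq> \<zero>\<^bsub>?M\<^esub>}" for \<phi>
      by (rule finite_subset[of _ "{0}"]) auto
    show "\<phi> = \<zero>\<^bsub>?M\<^esub>" if "\<And>n. (if n = 0 then \<phi> else (\<lambda>i p. 0)) = \<zero>\<^bsub>?M\<^esub>" for \<phi> and n :: nat
      using that[of 0] by simp
  qed (auto simp: diag_grading_def split: if_splits)
  moreover have "a \<odot>\<^bsub>?M\<^esub> \<phi> \<in> diag_grading Q (p + n)"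
    if a: "a \<in> Cmp p" and \<phi>: "\<phi> \<in> diag_grading Q n" for a \<phi> p n
  proof (cases "p = 0")
    case True
    have "a \<in> carrier Inc" using connected_ringD(4)[OF incidence_connected] a by blast
    thus ?thesis using M.smult_closed[of a \<phi>] \<phi> True by (auto simp: diag_grading_def split: if_splits)
  next
    case False
    have \<phi>c: "\<phi> \<in> carrier ?M" using \<phi> by (auto simp: diag_grading_def diag_carrier_iff split: if_splits)
    have "a p' * \<phi> i p' = 0" for i p'
      using Cmp_pos_diag[OF a] False diag_carrierD[OF \<phi>c, of i p'] Q by (cases "\<phi> i p' = 0") auto
    hence "a \<odot>\<^bsub>?M\<^esub> \<phi> = (\<lambda>i p. 0)" by (simp only: diag_simps)
    thus ?thesis using False by (simp add: diag_grading_def)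
  qed
  ultimately show ?thesis using M by (simp add: graded_module_def)
qed

lemma positive_part_eq: "positive_part Inc Cmp = incidence_span (r - Id)"
proof (rule equalityI)
  let ?T = "\<Union>n \<in> {0<..}. Cmp n"
  note grp = abelian_group.a_group[OF ring.is_abelian_group[OF incidence_ring_ring]]
  have "?T \<subseteq> incidence_span (r - Id)"
  proof
    fix f :: "'a \<times> 'a \<Rightarrow> 'k" assume "f \<in> ?T"
    then obtain n where n: "0 < n" "f \<in> Cmp n" by auto
    have "f (x, y) = 0" if "(x, y) \<notin> r - Id" for x y
    proof (rule ccontr)
      assume nz: "f (x, y) \<noteq> 0"
      hence "(x, y) \<in> r" using n by (auto simp: Cmp_iff)
      with that nz Cmp_pos_diag[OF n(2,1), of x] r_in_P(1) show False by auto
    qed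
    thus "f \<in> incidence_span (r - Id)" by (auto simp: incidence_span_def)
  qed
  thus "positive_part Inc Cmp \<subseteq> incidence_span (r - Id)"
    unfolding positive_part_def
    by (rule group.generate_subgroup_incl[OF grp _ incidence_span_subgroup]) auto
  show "incidence_span (r - Id) \<subseteq> positive_part Inc Cmp"
    unfolding positive_part_def
  proof (rule incidence_span_subset_generate)
    fix p :: "'a \<times> 'a" and c :: 'k assume p: "p \<in> r - Id"
    obtain x y where xy: "p = (x, y)" by (cases p)
    have "single p c \<in> Cmp (len x y)" using p xy by (auto simp: Cmp_iff single_def)
    moreover have "0 < len x y" using p xy len_0_iff[of x y] by auto
    ultimately show "single p c \<in> generate (add_monoid Inc) ?T" by (intro generate.incl) auto
  qed auto
qed

lemma positive_part_iff:
  "f \<in> positive_part Inc Cmp \<longleftrightarrow> f \<in> carrier Inc \<and> (\<forall>x \<in> P. f (x, x) = 0)"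
  unfolding positive_part_eq incidence_span_def incidence_simps
  by (auto simp: r_refl) (metis r_in_P(1))

lemma positive_part_ideal: "ideal (positive_part Inc Cmp) Inc"
proof (rule idealI[OF incidence_ring_ring])
  show "subgroup (positive_part Inc Cmp) (add_monoid Inc)"
    unfolding positive_part_eq by (rule incidence_span_subgroup) auto
qed (auto simp: positive_part_iff incidence_mult_closed mult_on_diag)

lemma coset_eq_iff:
  fixes a b :: "'a \<times> 'a \<Rightarrow> 'k :: field"
  assumes "a \<in> carrier Inc" "b \<in> carrier Inc"
  shows "positive_part Inc Cmp +>\<^bsub>Inc\<^esub> a = positive_part Inc Cmp +>\<^bsub>Inc\<^esub> b \<longleftrightarrow> (\<forall>x \<in> P. a (x, x) = b (x, x))"
proof -
  interpret ring Inc by (rule incidence_ring_ring)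
  interpret I: ideal "positive_part Inc Cmp" Inc by (rule positive_part_ideal)
  let ?I = "positive_part Inc Cmp"
  have "a \<in> ?I +>\<^bsub>Inc\<^esub> b \<longleftrightarrow> (\<forall>x \<in> P. a (x, x) = b (x, x))"
  proof
    assume "a \<in> ?I +>\<^bsub>Inc\<^esub> b"
    then obtain h where "h \<in> ?I" "a = h \<oplus>\<^bsub>Inc\<^esub> b" by (auto simp: a_r_coset_def')
    thus "\<forall>x \<in> P. a (x, x) = b (x, x)" by (auto simp: positive_part_iff incidence_simps(4))
  next
    assume "\<forall>x \<in> P. a (x, x) = b (x, x)"
    hence "(\<lambda>p. a p - b p) \<in> ?I" using assms by (auto simp: positive_part_iff incidence_simps(1))
    moreover have "a = (\<lambda>p. a p - b p) \<oplus>\<^bsub>Inc\<^esub> b" by (simp add: incidence_simps(4))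
    ultimately show "a \<in> ?I +>\<^bsub>Inc\<^esub> b" unfolding a_r_coset_def' by blast
  qed
  moreover have "?I +>\<^bsub>Inc\<^esub> a = ?I +>\<^bsub>Inc\<^esub> b \<longleftrightarrow> a \<in> ?I +>\<^bsub>Inc\<^esub> b"
    using I.a_repr_independence'[of a b] I.a_repr_independenceD[OF assms(1), of b] assms(2) by metis
  ultimately show ?thesis by simp
qed

text \<open>The remaining requirements in the definition of a Koszul ring hold for every graded poset, and
  \<open>A/A\<^sub>+\<close> is the diagonal module, because two elements of \<open>A\<close> are congruent modulo \<open>A\<^sub>+\<close> when they have
  the same diagonal.\<close>

lemma koszul_iff_linear_resolution:
  "koszul_ring Inc Diag Cmp \<longleftrightarrow>
    (\<exists>(M :: nat \<Rightarrow> ('a, 'k) inc_module) G d \<epsilon>.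
      linear_resolution Inc Cmp (diag_module P) (diag_grading P) M G d \<epsilon>)"
proof -
  let ?A = Inc and ?D = "diag_module P :: ('a, 'k) inc_module"
  let ?I = "positive_part ?A Cmp"
  let ?N = "quotient_module ?A ?I"
  interpret ring ?A by (rule incidence_ring_ring)
  interpret I: ideal ?I ?A by (rule positive_part_ideal)
  define f where "f \<phi> = ?I +>\<^bsub>?A\<^esub> \<phi> 0" for \<phi> :: "nat \<Rightarrow> 'a \<times> 'a \<Rightarrow> 'k"
  have \<phi>0: "\<phi> 0 \<in> carrier ?A" if "\<phi> \<in> carrier ?D" for \<phi>
  proof -
    have "\<phi> 0 p = 0" if "p \<notin> r" for p
      using diag_carrierD[OF \<open>\<phi> \<in> carrier ?D\<close>, of 0 p] that r_refl by blast
    thus ?thesis by (simp add: incidence_simps)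
  qed
  have D_of: "\<exists>\<phi> \<in> carrier ?D. ?I +>\<^bsub>?A\<^esub> a = f \<phi>" if "a \<in> carrier ?A" for a
  proof -
    let ?\<phi> = "\<lambda>i p. if i = (0 :: nat) \<and> p \<in> Id_on P then a p else 0"
    have c: "?\<phi> \<in> carrier ?D" by (simp add: diag_carrier_iff)
    have "?I +>\<^bsub>?A\<^esub> a = f ?\<phi>"
      unfolding f_def using coset_eq_iff[OF that \<phi>0[OF c]] by (simp add: Id_on_iff)
    with c show ?thesis by blast
  qed
  have hom: "f \<in> lmod_hom ?A ?D ?N"
  proof (rule lmod_homI)
    show "f \<phi> \<in> carrier ?N" if "\<phi> \<in> carrier ?D" for \<phi>
      using \<phi>0[OF that] by (auto simp: f_def quotient_module_def FactRing_def A_RCOSETS_def')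
    show "f (\<phi> \<oplus>\<^bsub>?D\<^esub> \<psi>) = f \<phi> \<oplus>\<^bsub>?N\<^esub> f \<psi>" if "\<phi> \<in> carrier ?D" "\<psi> \<in> carrier ?D" for \<phi> \<psi>
      using I.a_rcos_sum[OF \<phi>0[OF that(1)] \<phi>0[OF that(2)]]
      by (simp add: f_def quotient_module_def FactRing_def incidence_simps)
    show "f (a \<odot>\<^bsub>?D\<^esub> \<phi>) = a \<odot>\<^bsub>?N\<^esub> f \<phi>" if a: "a \<in> carrier ?A" and \<phi>: "\<phi> \<in> carrier ?D" for a \<phi>
    proof -
      have "?I +>\<^bsub>?A\<^esub> (a \<odot>\<^bsub>?D\<^esub> \<phi>) 0 = ?I +>\<^bsub>?A\<^esub> (a \<otimes>\<^bsub>?A\<^esub> \<phi> 0)"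
        using mult_on_diag[OF a \<phi>0[OF \<phi>]]
          coset_eq_iff[OF \<phi>0[OF left_module.smult_closed[OF diag_left_module[OF subset_refl] a \<phi>]] m_closed[OF a \<phi>0[OF \<phi>]]]
        by simp
      thus ?thesis
        using I.rcoset_mult_add[OF a \<phi>0[OF \<phi>]] by (simp add: f_def quotient_module_def FactRing_def)
    qed
  qed
  have "inj_on f (carrier ?D)"
  proof (rule inj_onI)
    fix \<phi> \<psi> assume c: "\<phi> \<in> carrier ?D" "\<psi> \<in> carrier ?D" and "f \<phi> = f \<psi>"
    hence eq: "\<forall>x \<in> P. \<phi> 0 (x, x) = \<psi> 0 (x, x)"
      using coset_eq_iff[OF \<phi>0[OF c(1)] \<phi>0[OF c(2)]] by (simp add: f_def)
    show "\<phi> = \<psi>"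
    proof (intro ext)
      fix i p show "\<phi> i p = \<psi> i p"
        using diag_carrierD[OF c(1), of i p] diag_carrierD[OF c(2), of i p] eq by metis
    qed
  qed
  moreover have "carrier ?N \<subseteq> f ` carrier ?D"
    using D_of by (fastforce simp: quotient_module_def FactRing_def A_RCOSETS_def')
  ultimately have bij: "bij_betw f (carrier ?D) (carrier ?N)"
    using lmod_homD(1)[OF hom] by (auto simp: bij_betw_def)
  have zero: "f \<zero>\<^bsub>?D\<^esub> = \<zero>\<^bsub>?N\<^esub>"
  proof -
    have "f \<zero>\<^bsub>?D\<^esub> = ?I +>\<^bsub>?A\<^esub> \<zero>\<^bsub>?A\<^esub>" by (simp add: f_def incidence_simps(3))
    also have "\<dots> = ?I" by (rule a_coset_join2[OF zero_closed I.a_subgroup]) simp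
    finally show ?thesis by (simp add: quotient_module_def FactRing_def)
  qed
  have grade: "f ` diag_grading P n = (\<lambda>a. ?I +>\<^bsub>?A\<^esub> a) ` Cmp n" for n
  proof (cases "n = 0")
    case True
    have "f \<phi> \<in> (\<lambda>a. ?I +>\<^bsub>?A\<^esub> a) ` Cmp 0" if "\<phi> \<in> carrier ?D" for \<phi>
    proof -
      have "\<phi> 0 \<in> Cmp 0" unfolding Cmp_0 Diag_iff using diag_carrierD[OF that, of 0] by blast
      thus ?thesis by (simp add: f_def)
    qed
    moreover have "?I +>\<^bsub>?A\<^esub> a \<in> f ` carrier ?D" if "a \<in> Cmp 0" for a
    proof -
      have "a \<in> carrier ?A" using connected_ringD(4)[OF incidence_connected] that by blast
      from D_of[OF this] show ?thesis by blast
    qed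
    ultimately show ?thesis using True by (auto simp: diag_grading_def)
  next
    case False
    have "f (\<lambda>i p. 0) = ?I +>\<^bsub>?A\<^esub> a" if "a \<in> Cmp n" for a
    proof -
      have a: "a \<in> carrier ?A" using connected_ringD(4)[OF incidence_connected] that by blast
      have "(\<lambda>p. 0) \<in> carrier ?A" by (simp add: incidence_simps(1))
      from coset_eq_iff[OF this a] Cmp_pos_diag[OF that] False show ?thesis by (simp add: f_def)
    qed
    moreover have "(\<lambda>p. 0) \<in> Cmp n" by (simp add: Cmp_iff)
    ultimately show ?thesis using False by (auto simp: diag_grading_def)
  qed
  have sub: "diag_grading P n \<subseteq> carrier ?D" for n by (auto simp: diag_grading_def diag_carrier_iff)
  have iso: "(\<exists>\<epsilon>. linear_resolution ?A Cmp ?N (\<lambda>n. (\<lambda>a. ?I +>\<^bsub>?A\<^esub> a) ` Cmp n) M G d \<epsilon>) \<longleftrightarrow>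
      (\<exists>\<epsilon>. linear_resolution ?A Cmp ?D (diag_grading P) M G d \<epsilon>)"
    for M :: "nat \<Rightarrow> ('a, 'k) inc_module" and G d
    by (rule linear_resolution_iso[where f = f, OF diag_left_module[OF subset_refl] hom bij zero sub grade, symmetric])
  have "connected_ring ?A Diag Cmp" "strongly_graded ?A Cmp"
    by (rule incidence_connected incidence_strongly_graded)+
  thus ?thesis
    unfolding koszul_ring_def linear_resolution_def[symmetric] iso by simp
qed

end

section \<open>Adjoining a maximal element\<close>

locale poset_with_maximal = finite_graded_poset P r field_type
  for P :: "'a set" and r :: "'a rel" and field_type :: "'k :: field itself" +
  fixes t :: 'a
  assumes maximal: "maximal_in P r t"
    and dagger: "dagger P r {u. (u, t) \<in> covering r}"
begin

lemma t_in: "t \<in> P" and t_max: "(t, x) \<in> r \<Longrightarrow> x = t"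
  using maximal r_in_P by (auto simp: maximal_in_def)

lemma covering_in_r: "(x, y) \<in> covering r \<Longrightarrow> (x, y) \<in> r"
  and covering_neq: "(x, y) \<in> covering r \<Longrightarrow> x \<noteq> y"
  by (auto simp: covering_def)

lemma below_predecessor:
  assumes "(x, t) \<in> r" "x \<noteq> t"
  shows "\<exists>u. (x, u) \<in> r \<and> (u, t) \<in> covering r"
proof -
  have "len x t = (len x t - 1) + 1" using len_0_iff[OF assms(1)] assms(2) by simp
  from len_split[OF assms(1) this] obtain u where "(x, u) \<in> r" "(u, t) \<in> r" "len u t = 1" by blast
  thus ?thesis using len_iff[of u t 1] by auto
qed

text \<open>This is how \<open>(\<dagger>)\<close> is used. If there is at most one predecessor, the conditions on \<open>s\<close> are vacuous
  and any element will do.\<close>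

lemma predecessors_enumerated:
  obtains m :: nat and u :: "nat \<Rightarrow> 'a" and s :: 'a where
    "bij_betw u {..<m} {u. (u, t) \<in> covering r}"
    "\<And>i. i < m \<Longrightarrow> 1 < m \<Longrightarrow> (s, u i) \<in> covering r"
    "\<And>i j x. i < m \<Longrightarrow> j < m \<Longrightarrow> i \<noteq> j \<Longrightarrow> (x, u i) \<in> r \<Longrightarrow> (x, u j) \<in> r \<Longrightarrow> (x, s) \<in> r"
proof -
  let ?F = "{u. (u, t) \<in> covering r}"
  have "finite ?F" by (rule finite_subset[OF _ finite_P]) (auto dest: covering_in_r intro: r_in_P)
  from ex_bij_betw_nat_finite[OF this] obtain u m where u: "bij_betw u {..<m::nat} ?F"
    by (auto simp: atLeast0LessThan)
  have uF: "u i \<in> ?F" if "i < m" for i using bij_betwE[OF u] that by blast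
  have inj: "u i \<noteq> u j" if "i < m" "j < m" "i \<noteq> j" for i j
    using bij_betw_imp_inj_on[OF u] that by (auto simp: inj_on_def)
  show ?thesis
  proof (cases "1 < m")
    case False
    show ?thesis by (rule that[OF u, of t]) (use False in auto)
  next
    case True
    hence "\<not> is_singleton ?F" using inj[of 0 1] uF[of 0] uF[of 1] by (metis One_nat_def is_singletonE less_trans singletonD zero_less_one zero_neq_one)
    then obtain s where s: "\<And>v. v \<in> ?F \<Longrightarrow> (s, v) \<in> covering r"
      "\<And>v w. v \<in> ?F \<Longrightarrow> w \<in> ?F \<Longrightarrow> v \<noteq> w \<Longrightarrow> is_infimum P r s {v, w}"
      using dagger unfolding dagger_def by blast
    show ?thesis
    proof (rule that[OF u, of s])
      show "(s, u i) \<in> covering r" if "i < m" for i using s(1)[OF uF[OF that]] .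
      show "(x, s) \<in> r" if "i < m" "j < m" "i \<noteq> j" "(x, u i) \<in> r" "(x, u j) \<in> r" for i j x
        using s(2)[OF uF[OF that(1)] uF[OF that(2)] inj[OF that(1-3)]] that(4,5) r_in_P(1)[OF that(4)]
        by (auto simp: is_infimum_def)
    qed
  qed
qed

text \<open>With \<open>m\<close> predecessors \<open>u 0, \<dots>, u (m - 1)\<close>, the resolution is
  \<open>0 \<rightarrow> (A e\<^sub>s)\<^bsup>m-1\<^esup> \<rightarrow> \<Oplus>\<^sub>i A e\<^bsub>u i\<^esub> \<rightarrow> A e\<^sub>t\<close>, where the first term is \<open>0\<close> if
  \<open>m \<le> 1\<close>. At an element \<open>x\<close>, the last map is the sum of the coordinates
  with \<open>x \<le> u i\<close>. If \<open>x \<le> s\<close>, its kernel is spanned by the differences of the basis vectors \<open>i\<close> and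
  \<open>0\<close>, for \<open>1 \<le> i < m\<close>. Otherwise, \<open>x\<close> is below at most one \<open>u i\<close> and the kernel is \<open>0\<close>.\<close>

lemma simple_linear_resolution:
  "\<exists>(L :: nat \<Rightarrow> ('a, 'k :: field) inc_module) G d \<epsilon>.
     linear_resolution Inc Cmp (diag_module {t}) (diag_grading {t}) L G d \<epsilon>"
proof -
  obtain m :: nat and u s where u: "bij_betw u {..<m} {u. (u, t) \<in> covering r}"
    and s_cov: "\<And>i. i < m \<Longrightarrow> 1 < m \<Longrightarrow> (s, u i) \<in> covering r"
    and s_inf: "\<And>i j x. i < m \<Longrightarrow> j < m \<Longrightarrow> i \<noteq> j \<Longrightarrow> (x, u i) \<in> r \<Longrightarrow> (x, u j) \<in> r \<Longrightarrow> (x, s) \<in> r"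
    by (rule predecessors_enumerated) blast
  have u_cov: "(u i, t) \<in> covering r" if "i < m" for i using bij_betwE[OF u] that by blast
  define I :: "nat \<Rightarrow> nat set" where
    "I n = (if n = 0 then {0} else if n = 1 then {..<m} else if n = 2 then {1..<m} else {})" for n
  define y :: "nat \<Rightarrow> nat \<Rightarrow> 'a" where
    "y n = (if n = 0 then (\<lambda>_. t) else if n = 1 then u else (\<lambda>_. s))" for n
  \<comment> \<open>The boundary maps: all entries are \<open>1\<close> in degree \<open>0\<close>; in degree \<open>1\<close>, the \<open>i\<close>-th generator goes to
    the difference of the generators \<open>i\<close> and \<open>0\<close>.\<close>
  define \<kappa> :: "nat \<Rightarrow> nat \<Rightarrow> nat \<Rightarrow> 'k" where
    "\<kappa> n i j = (if n = 0 then 1 else if j = i then 1 else if j = 0 then - 1 else 0)" for n i j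
  define L :: "nat \<Rightarrow> ('a, 'k) inc_module" where "L n = proj_module P r (I n) (y n)" for n
  define G :: "nat \<Rightarrow> nat \<Rightarrow> (nat \<Rightarrow> 'a \<times> 'a \<Rightarrow> 'k) set" where "G n = proj_grading r (I n) (y n) n" for n
  define d where "d n = matrix_map (I (Suc n)) (y (Suc n)) (I n) (y n) (\<kappa> n)" for n
  define \<epsilon> :: "(nat \<Rightarrow> 'a \<times> 'a \<Rightarrow> 'k) \<Rightarrow> nat \<Rightarrow> 'a \<times> 'a \<Rightarrow> 'k" where
    "\<epsilon> \<phi> = (\<lambda>i p. if i = 0 \<and> p = (t, t) then \<phi> 0 (t, t) else 0)" for \<phi>
  have finI: "finite (I n)" for n by (simp add: I_def)
  have yP: "y n i \<in> P" if "i \<in> I n" for n i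
    using that t_in u_cov s_cov covering_in_r r_in_P by (fastforce simp: I_def y_def split: if_splits)
  have gL: "graded_module Inc Cmp (L n) (G n)" for n
    unfolding L_def G_def by (rule proj_graded_module[OF finI])
  have cov: "(y (Suc n) i, y n j) \<in> covering r" if "i \<in> I (Suc n)" "j \<in> I n" for n i j
    using that u_cov s_cov by (fastforce simp: I_def y_def split: if_splits)
  have dh: "d n \<in> graded_hom Inc (L (Suc n)) (G (Suc n)) (L n) (G n)" for n
    unfolding d_def L_def G_def by (rule matrix_map_hom[OF cov])
  have d0: "d 0 \<phi> = (\<lambda>j (x, w). if j = 0 \<and> w = t then \<Sum>i<m. \<phi> i (x, u i) else 0)" for \<phi>
    by (auto simp: fun_eq_iff d_def matrix_map_def I_def y_def \<kappa>_def)
  have d1: "d (Suc 0) \<phi> = (\<lambda>j (x, w). if j < m \<and> w = u j then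
      if j = 0 then - (\<Sum>i\<in>{1..<m}. \<phi> i (x, s)) else \<phi> j (x, s) else 0)" for \<phi>
  proof -
    have "(\<Sum>i\<in>{1..<m}. \<kappa> 1 i j * \<phi> i (x, s)) = (if j = 0 then - (\<Sum>i\<in>{1..<m}. \<phi> i (x, s)) else \<phi> j (x, s))"
      if "j < m" for j x
    proof (cases "j = 0")
      case True
      thus ?thesis by (auto simp: \<kappa>_def sum_negf[symmetric] intro!: sum.cong)
    next
      case False
      have "(\<Sum>i\<in>{1..<m}. \<kappa> 1 i j * \<phi> i (x, s)) = (\<Sum>i\<in>{1..<m}. if i = j then \<phi> j (x, s) else 0)"
        using False by (intro sum.cong) (auto simp: \<kappa>_def)
      thus ?thesis using False that by simp
    qed
    thus ?thesis by (auto simp: fun_eq_iff d_def matrix_map_def I_def y_def numeral_2_eq_2)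
  qed
  have L0D: "i = 0" "w = t" "(x, w) \<in> r" if "\<phi> \<in> carrier (L 0)" "\<phi> i (x, w) \<noteq> 0" for \<phi> i x w
    using proj_carrierD[OF that[unfolded L_def]] by (auto simp: I_def y_def)
  have L1D: "i < m" "w = u i" "(x, w) \<in> r" if "\<phi> \<in> carrier (L 1)" "\<phi> i (x, w) \<noteq> 0" for \<phi> i x w
    using proj_carrierD[OF that[unfolded L_def]] by (auto simp: I_def y_def)
  have L2D: "i \<in> {1..<m}" "w = s" "(x, w) \<in> r" if "\<phi> \<in> carrier (L 2)" "\<phi> i (x, w) \<noteq> 0" for \<phi> i x w
    using proj_carrierD[OF that[unfolded L_def]] by (auto simp: I_def y_def)
  have L3: "\<phi> = (\<lambda>i p. 0)" if "\<phi> \<in> carrier (L n)" "2 < n" for \<phi> n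
  proof (intro ext)
    fix i p show "\<phi> i p = 0"
      using proj_carrierD(1)[OF that(1)[unfolded L_def], of i "fst p" "snd p"] that(2) by (auto simp: I_def)
  qed
  have Lz: "\<zero>\<^bsub>L n\<^esub> = (\<lambda>i p. 0)" "(\<lambda>i p. 0) \<in> carrier (L n)" for n
    by (auto simp: L_def proj_carrier_iff)
  have "linear_resolution Inc Cmp (diag_module {t}) (diag_grading {t}) L G d \<epsilon>"
  proof (rule linear_resolutionI)
    show "graded_module Inc Cmp (L n) (G n)" "d n \<in> graded_hom Inc (L (Suc n)) (G (Suc n)) (L n) (G n)" for n
      by (rule gL dh)+
    show "projective_module Inc (L n)" for n
      unfolding L_def by (rule proj_projective[OF finI yP])
    show "generated_by Inc (L n) (G n n)" for n
      unfolding L_def G_def by (rule proj_generated[OF finI yP])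
    show "\<epsilon> \<in> graded_hom Inc (L 0) (G 0) (diag_module {t}) (diag_grading {t})"
      unfolding graded_hom_def
    proof (intro CollectI conjI allI lmod_homI image_subsetI)
      show "\<epsilon> \<phi> \<in> carrier (diag_module {t})" for \<phi>
        by (simp add: \<epsilon>_def diag_carrier_iff Id_onI)
      show "\<epsilon> (\<phi> \<oplus>\<^bsub>L 0\<^esub> \<psi>) = \<epsilon> \<phi> \<oplus>\<^bsub>diag_module {t}\<^esub> \<epsilon> \<psi>" for \<phi> \<psi>
        by (auto simp: \<epsilon>_def L_def fun_eq_iff)
      show "\<epsilon> (a \<odot>\<^bsub>L 0\<^esub> \<phi>) = a \<odot>\<^bsub>diag_module {t}\<^esub> \<epsilon> \<phi>"
        if a: "a \<in> carrier Inc" and \<phi>: "\<phi> \<in> carrier (L 0)" for a \<phi>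
        using mult_on_diag[OF a proj_in_Inc[OF \<phi>[unfolded L_def]] t_in] by (auto simp: \<epsilon>_def L_def fun_eq_iff)
      show "\<epsilon> \<phi> \<in> diag_grading {t} n" if \<phi>: "\<phi> \<in> G 0 n" for \<phi> n
      proof (cases "n = 0")
        case True
        thus ?thesis by (simp add: \<epsilon>_def diag_grading_def diag_carrier_iff Id_onI)
      next
        case False
        have "\<phi> 0 (t, t) = 0"
          using proj_gradingD(4)[OF \<phi>[unfolded G_def], of 0 t t] False len_refl[OF t_in] by auto
        thus ?thesis using False by (auto simp: \<epsilon>_def diag_grading_def fun_eq_iff)
      qed
    qed
    show "\<epsilon> ` carrier (L 0) = carrier (diag_module {t})"
    proof (intro equalityI subsetI)
      fix \<psi> :: "nat \<Rightarrow> 'a \<times> 'a \<Rightarrow> 'k" assume \<psi>: "\<psi> \<in> carrier (diag_module {t})"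
      have eq: "\<epsilon> \<psi> = \<psi>"
      proof (intro ext)
        fix i p show "\<epsilon> \<psi> i p = \<psi> i p" using diag_carrierD[OF \<psi>, of i p] by (auto simp: \<epsilon>_def)
      qed
      have "\<psi> \<in> carrier (L 0)"
        unfolding L_def proj_carrier_iff using diag_carrierD[OF \<psi>] t_in r_refl by (fastforce simp: I_def y_def)
      thus "\<psi> \<in> \<epsilon> ` carrier (L 0)" using image_eqI[of \<psi> \<epsilon> \<psi>] eq by metis
    qed (auto simp: \<epsilon>_def diag_carrier_iff split: if_splits)
    show "\<epsilon> (d 0 \<phi>) = \<zero>\<^bsub>diag_module {t}\<^esub>" if \<phi>: "\<phi> \<in> carrier (L (Suc 0))" for \<phi>
    proof -
      have "\<phi> i (t, u i) = 0" if "i < m" for i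
      proof (rule ccontr)
        assume "\<phi> i (t, u i) \<noteq> 0"
        hence "(t, u i) \<in> r" using L1D(3) \<phi> by simp
        thus False using t_max covering_neq u_cov[OF that] by blast
      qed
      thus ?thesis by (auto simp: \<epsilon>_def d0 fun_eq_iff)
    qed
    show "\<exists>\<phi> \<in> carrier (L (Suc 0)). d 0 \<phi> = \<psi>"
      if \<psi>: "\<psi> \<in> carrier (L 0)" and 0: "\<epsilon> \<psi> = \<zero>\<^bsub>diag_module {t}\<^esub>" for \<psi>
    proof -
      have tt: "\<psi> 0 (t, t) = 0" using fun_cong[OF fun_cong[OF 0, of 0], of "(t, t)"] by (simp add: \<epsilon>_def)
      have "\<exists>i. i < m \<and> (x, u i) \<in> r" if "(x, t) \<in> r" "x \<noteq> t" for x
        using below_predecessor[OF that] bij_betw_imp_surj_on[OF u] by (metis (no_types, lifting) imageE lessThan_iff mem_Collect_eq)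
      then obtain c where c: "\<And>x. (x, t) \<in> r \<Longrightarrow> x \<noteq> t \<Longrightarrow> c x < m \<and> (x, u (c x)) \<in> r" by metis
      \<comment> \<open>Put the value at \<open>x\<close> on one chosen predecessor \<open>u (c x)\<close> above \<open>x\<close>.\<close>
      define \<phi> where "\<phi> = (\<lambda>i (x, w). if (x, t) \<in> r \<and> x \<noteq> t \<and> i = c x \<and> w = u i then \<psi> 0 (x, t) else 0)"
      have "\<phi> \<in> carrier (L (Suc 0))"
        using c by (auto simp: L_def proj_carrier_iff \<phi>_def I_def y_def split: if_splits)
      moreover have "d 0 \<phi> = \<psi>"
      proof (intro ext, clarify)
        fix j x w
        have "(\<Sum>i<m. \<phi> i (x, u i)) = \<psi> 0 (x, t)"
        proof (cases "(x, t) \<in> r \<and> x \<noteq> t")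
          case True
          hence "(\<Sum>i<m. \<phi> i (x, u i)) = (\<Sum>i<m. if i = c x then \<psi> 0 (x, t) else 0)"
            by (intro sum.cong) (auto simp: \<phi>_def)
          thus ?thesis using c True by simp
        next
          case False
          hence "\<psi> 0 (x, t) = 0" using tt L0D(3)[OF \<psi>, of 0 x t] by auto
          thus ?thesis by (auto simp: \<phi>_def intro!: sum.neutral)
        qed
        thus "d 0 \<phi> j (x, w) = \<psi> j (x, w)" using L0D(1,2)[OF \<psi>, of j x w] by (auto simp: d0)
      qed
      ultimately show ?thesis by blast
    qed
    show "d n (d (Suc n) \<phi>) = \<zero>\<^bsub>L n\<^esub>" if \<phi>: "\<phi> \<in> carrier (L (Suc (Suc n)))" for n \<phi>
    proof (cases "n = 0")
      case True
      have "(\<Sum>j<m. d 1 \<phi> j (x, u j)) = 0" for x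
      proof (cases "m = 0")
        case False
        hence "{..<m} = insert 0 {1..<m}" by auto
        hence "(\<Sum>j<m. d 1 \<phi> j (x, u j)) = d 1 \<phi> 0 (x, u 0) + (\<Sum>j\<in>{1..<m}. d 1 \<phi> j (x, u j))" by simp
        also have "(\<Sum>j\<in>{1..<m}. d 1 \<phi> j (x, u j)) = (\<Sum>j\<in>{1..<m}. \<phi> j (x, s))"
          by (intro sum.cong) (auto simp: d1)
        finally show ?thesis using False by (simp add: d1)
      qed simp
      thus ?thesis using True by (auto simp: d0 Lz fun_eq_iff)
    next
      case False
      hence "\<phi> = (\<lambda>i p. 0)" using L3[OF \<phi>] by simp
      thus ?thesis by (auto simp: d_def matrix_map_def Lz fun_eq_iff)
    qed
    show "\<exists>\<phi> \<in> carrier (L (Suc (Suc n))). d (Suc n) \<phi> = \<psi>"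
      if \<psi>: "\<psi> \<in> carrier (L (Suc n))" and 0: "d n \<psi> = \<zero>\<^bsub>L n\<^esub>" for n \<psi>
    proof -
      consider "n = 0" | "n = 1" | "1 < n" by linarith
      thus ?thesis
      proof cases
        case 1
        have \<psi>1: "\<psi> \<in> carrier (L 1)" using \<psi> 1 by simp
        have sum0: "(\<Sum>i<m. \<psi> i (x, u i)) = 0" for x
          using fun_cong[OF fun_cong[OF 0, of 0], of "(x, t)"] 1 by (simp add: d0 Lz)
        have off: "\<psi> j (x, u j) = 0" if j: "j < m" "1 < m" and x: "(x, s) \<notin> r" for j x
        proof (rule ccontr)
          assume nz: "\<psi> j (x, u j) \<noteq> 0"
          have "\<psi> i (x, u i) = 0" if "i < m" "i \<noteq> j" for i
            using s_inf[OF that(1) j(1) that(2), of x] L1D(3)[OF \<psi>1, of i x "u i"] L1D(3)[OF \<psi>1 nz] x by blast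
          hence "(\<Sum>i<m. \<psi> i (x, u i)) = (\<Sum>i<m. if i = j then \<psi> j (x, u j) else 0)"
            by (intro sum.cong) auto
          thus False using sum0 nz j(1) by simp
        qed
        \<comment> \<open>The coordinates with index at least \<open>1\<close> give the preimage; index \<open>0\<close> then fits, as the sum is \<open>0\<close>.\<close>
        define \<phi> where "\<phi> = (\<lambda>i (x, w). if i \<in> {1..<m} \<and> w = s \<and> (x, s) \<in> r then \<psi> i (x, u i) else 0)"
        have "\<phi> \<in> carrier (L (Suc (Suc n)))"
          using 1 by (auto simp: L_def proj_carrier_iff \<phi>_def I_def y_def split: if_splits)
        moreover have "d (Suc n) \<phi> = \<psi>"
        proof (intro ext, clarify)
          fix j x w
          have \<phi>\<psi>: "\<phi> i (x, s) = \<psi> i (x, u i)" if "i \<in> {1..<m}" for i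
            using off[of i x] that by (auto simp: \<phi>_def)
          have "- (\<Sum>i\<in>{1..<m}. \<phi> i (x, s)) = \<psi> 0 (x, u 0)" if "0 < m"
          proof -
            have "{..<m} = insert 0 {1..<m}" using that by auto
            hence "\<psi> 0 (x, u 0) + (\<Sum>i\<in>{1..<m}. \<psi> i (x, u i)) = 0" using sum0[of x] by simp
            moreover have "(\<Sum>i\<in>{1..<m}. \<phi> i (x, s)) = (\<Sum>i\<in>{1..<m}. \<psi> i (x, u i))"
              by (rule sum.cong[OF refl \<phi>\<psi>])
            ultimately show ?thesis by (simp add: add_eq_0_iff)
          qed
          thus "d (Suc n) \<phi> j (x, w) = \<psi> j (x, w)"
            using 1 \<phi>\<psi>[of j] L1D(1,2)[OF \<psi>1, of j x w] by (auto simp: d1[unfolded One_nat_def])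
        qed
        ultimately show ?thesis by blast
      next
        case 2
        have \<psi>2: "\<psi> \<in> carrier (L 2)" using \<psi> 2 by (simp add: numeral_2_eq_2)
        have "\<psi> j (x, w) = 0" for j x w
        proof (rule ccontr)
          assume nz: "\<psi> j (x, w) \<noteq> 0"
          have "j \<in> {1..<m}" "w = s" using L2D[OF \<psi>2 nz] by auto
          thus False using fun_cong[OF fun_cong[OF 0, of j], of "(x, u j)"] 2 nz by (auto simp: d1 Lz)
        qed
        hence "\<psi> = (\<lambda>i p. 0)" by (auto simp: fun_eq_iff)
        hence "d (Suc n) (\<lambda>i p. 0) = \<psi>" by (auto simp: d_def matrix_map_def fun_eq_iff)
        thus ?thesis using Lz(2) by blast
      next
        case 3
        hence "\<psi> = (\<lambda>i p. 0)" using L3[OF \<psi>] by simp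
        hence "d (Suc n) (\<lambda>i p. 0) = \<psi>" by (auto simp: d_def matrix_map_def fun_eq_iff)
        thus ?thesis using Lz(2) by blast
      qed
    qed
  qed
  thus ?thesis by blast
qed

abbreviation Q :: "'a set" where "Q \<equiv> P - {t}"
abbreviation rQ :: "'a rel" where "rQ \<equiv> Restr r Q"

text \<open>An element below an element of \<open>Q\<close> is different from \<open>t\<close>, since \<open>t\<close> is maximal. So passing to \<open>Q\<close> creates no
  new coverings.\<close>

lemma covering_rQ: "covering rQ \<subseteq> covering r"
proof clarify
  fix x y assume xy: "(x, y) \<in> covering rQ"
  have "z \<in> Q" if "(x, z) \<in> r" "(z, y) \<in> r" for z
    using xy that t_max[of y] r_in_P(2)[OF that(1)] by (auto simp: covering_def)
  thus "(x, y) \<in> covering r" using xy by (auto simp: covering_def)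
qed

lemma rQ_path: "(x, y) \<in> covering rQ ^^ l \<Longrightarrow> (x, y) \<in> covering r ^^ l"
proof (induction l arbitrary: y)
  case (Suc l)
  then obtain z where "(x, z) \<in> covering rQ ^^ l" "(z, y) \<in> covering rQ" by auto
  thus ?case using Suc.IH covering_rQ by auto
qed simp

lemma graded_Q: "graded_poset Q rQ"
proof -
  have "partial_order_on Q rQ"
    unfolding partial_order_on_def preorder_on_def
  proof (intro conjI refl_onI transI antisymI)
    show "(x, z) \<in> rQ" if "(x, y) \<in> rQ" "(y, z) \<in> rQ" for x y z using that r_trans[of x y z] by auto
    show "x = y" if "(x, y) \<in> rQ" "(y, x) \<in> rQ" for x y using that r_antisym[of x y] by auto
  qed (auto intro: r_refl)
  moreover have "l = m" if "(x, y) \<in> rQ" "(x, y) \<in> covering rQ ^^ l" "(x, y) \<in> covering rQ ^^ m" for x y l m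
    using that(1) rQ_path[OF that(2)] rQ_path[OF that(3)] len_iff[of x y] by auto
  ultimately show ?thesis using finite_P by (auto simp: graded_poset_def)
qed

sublocale Q: finite_graded_poset Q rQ field_type
  by unfold_locales (rule graded_Q)

lemma len_Q: "(x, y) \<in> rQ \<Longrightarrow> Q.len x y = len x y"
  using Q.len_iff[of x y "Q.len x y"] rQ_path[of x y "Q.len x y"] len_iff[of x y "Q.len x y"] by auto

lemma mult_one_Q:
  assumes "a \<in> carrier Inc"
  shows "(a \<otimes>\<^bsub>Inc\<^esub> \<one>\<^bsub>Q.Inc\<^esub>) (x, y) = (if y \<in> Q then a (x, y) else 0)"
proof -
  have "(\<Sum>z\<in>P. a (x, z) * (if (z, y) \<in> Id_on Q then 1 else 0)) = (\<Sum>z\<in>P. if z = y then if y \<in> Q then a (x, y) else 0 else 0)"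
    by (rule sum.cong) auto
  thus ?thesis using finite_P by (simp add: incidence_simps Q.incidence_one)
qed

text \<open>The unit of \<open>B\<close> is \<open>e = 1 - e\<^sub>t\<close>, and multiplying by it on the right deletes the column of \<open>t\<close>. As \<open>t\<close>
  is maximal, the row of \<open>t\<close> is then zero, too.\<close>

lemma corner: "left_corner Inc Diag Cmp Q.Inc Q.Diag Q.Cmp"
proof (rule left_corner.intro)
  show "connected_ring Inc Diag Cmp" by (rule incidence_connected)
  show "connected_ring Q.Inc Q.Diag Q.Cmp" by (rule Q.incidence_connected)
  show "carrier Q.Inc \<subseteq> carrier Inc"
    by (auto simp: incidence_simps Q.incidence_simps)
  show "a \<oplus>\<^bsub>Q.Inc\<^esub> b = a \<oplus>\<^bsub>Inc\<^esub> b" for a b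
    by (simp add: incidence_simps Q.incidence_simps)
  show "a \<otimes>\<^bsub>Q.Inc\<^esub> b = a \<otimes>\<^bsub>Inc\<^esub> b" if "a \<in> carrier Q.Inc" for a b
  proof
    fix p :: "'a \<times> 'a"
    obtain x y where p: "p = (x, y)" by (cases p)
    have "a (x, t) = 0" using Q.incidence_supp[OF that, of x t] by auto
    hence "(\<Sum>z\<in>P. a (x, z) * b (z, y)) = (\<Sum>z\<in>Q. a (x, z) * b (z, y))"
      using finite_P by (intro sum.mono_neutral_right) auto
    thus "(a \<otimes>\<^bsub>Q.Inc\<^esub> b) p = (a \<otimes>\<^bsub>Inc\<^esub> b) p"
      by (simp add: p incidence_simps Q.incidence_simps)
  qed
  have in_rQ: "(x, y) \<in> rQ" if "(x, y) \<in> r" "y \<in> Q" for x y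
    using that t_max r_in_P by blast
  show "a \<otimes>\<^bsub>Inc\<^esub> \<one>\<^bsub>Q.Inc\<^esub> \<in> carrier Q.Inc" if a: "a \<in> carrier Inc" for a
  proof -
    have "(a \<otimes>\<^bsub>Inc\<^esub> \<one>\<^bsub>Q.Inc\<^esub>) (x, y) = 0" if "(x, y) \<notin> rQ" for x y
      unfolding mult_one_Q[OF a] using that incidence_supp[OF a, of x y] in_rQ[of x y] by auto
    thus ?thesis unfolding Q.incidence_simps by auto
  qed
  show "Q.Cmp p \<subseteq> Cmp p" for p
  proof
    fix a :: "'a \<times> 'a \<Rightarrow> 'k" assume "a \<in> Q.Cmp p"
    hence "(x, y) \<in> rQ \<and> Q.len x y = p" if "a (x, y) \<noteq> 0" for x y using that unfolding Q.Cmp_iff by blast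
    thus "a \<in> Cmp p" unfolding Cmp_iff using len_Q by (metis IntD1)
  qed
  show "a \<otimes>\<^bsub>Inc\<^esub> \<one>\<^bsub>Q.Inc\<^esub> \<in> Q.Cmp p" if a: "a \<in> Cmp p" for p and a
    unfolding Q.Cmp_iff
  proof (intro allI impI)
    fix x y assume nz: "(a \<otimes>\<^bsub>Inc\<^esub> \<one>\<^bsub>Q.Inc\<^esub>) (x, y) \<noteq> 0"
    have "a \<in> carrier Inc" using connected_ringD(4)[OF incidence_connected] a by blast
    from mult_one_Q[OF this, of x y] nz have "y \<in> Q" "a (x, y) \<noteq> 0" by (auto split: if_splits)
    moreover from this(2) a have "(x, y) \<in> r" "len x y = p" by (auto simp: Cmp_iff)
    ultimately have "(x, y) \<in> rQ" "len x y = p" using in_rQ by blast+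
    thus "(x, y) \<in> rQ \<and> Q.len x y = p" using len_Q by simp
  qed
qed

lemma koszul_iff:
  "koszul_ring Inc Diag Cmp \<longleftrightarrow>
   koszul_ring Q.Inc Q.Diag Q.Cmp"
proof -
  let ?A = Inc and ?B = Q.Inc
  let ?DP = "diag_module P :: ('a, 'k) inc_module" and ?DQ = "diag_module Q :: ('a, 'k) inc_module"
    and ?Dt = "diag_module {t} :: ('a, 'k) inc_module"
  interpret corner: left_corner ?A Diag Cmp ?B Q.Diag Q.Cmp by (rule corner)
  have sub: "Q \<subseteq> P" "{t} \<subseteq> P" using t_in by auto
  obtain L G d \<eta> where L: "linear_resolution ?A Cmp ?Dt (diag_grading {t})
      (L :: nat \<Rightarrow> ('a, 'k) inc_module) G d \<eta>"
    using simple_linear_resolution by blast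
  have "\<one>\<^bsub>?A\<^esub> (t, t) \<noteq> \<zero>\<^bsub>?A\<^esub> (t, t)" using t_in by (simp add: incidence_one incidence_simps Id_on_iff)
  hence one: "\<one>\<^bsub>?A\<^esub> \<noteq> \<zero>\<^bsub>?A\<^esub>" by metis
  have inc: "(\<lambda>\<phi>. \<phi>) \<in> graded_hom ?A (diag_module S) (diag_grading S) ?DP (diag_grading P)" if "S \<subseteq> P" for S
  proof -
    have "carrier (diag_module S) \<subseteq> carrier ?DP" unfolding diag_carrier_iff subset_iff using that by blast
    thus ?thesis by (auto simp: graded_hom_def diag_grading_def intro!: lmod_homI split: if_splits)
  qed
  \<comment> \<open>The projections of \<open>R\<close> onto its part at \<open>t\<close> and onto \<open>S\<close>.\<close>
  define \<pi> :: "(nat \<Rightarrow> 'a \<times> 'a \<Rightarrow> 'k) \<Rightarrow> nat \<Rightarrow> 'a \<times> 'a \<Rightarrow> 'k" where "\<pi> \<phi> = (\<lambda>i p. if p = (t, t) then \<phi> i p else 0)" for \<phi>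
  define \<pi>' :: "(nat \<Rightarrow> 'a \<times> 'a \<Rightarrow> 'k) \<Rightarrow> nat \<Rightarrow> 'a \<times> 'a \<Rightarrow> 'k" where "\<pi>' \<phi> = (\<lambda>i p. if p = (t, t) then 0 else \<phi> i p)" for \<phi>
  have \<pi>c: "\<pi> \<phi> \<in> carrier ?Dt" "\<pi>' \<phi> \<in> carrier ?DQ" if "\<phi> \<in> carrier ?DP" for \<phi>
    using that unfolding diag_carrier_iff \<pi>_def \<pi>'_def by auto
  have \<pi>: "\<pi> \<in> graded_hom ?A ?DP (diag_grading P) ?Dt (diag_grading {t})"
    using \<pi>c(1) by (auto simp: graded_hom_def diag_grading_def \<pi>_def fun_eq_iff intro!: lmod_homI split: if_splits)
  have \<pi>_id: "\<pi> \<phi> = \<phi>" if "\<phi> \<in> carrier ?Dt" for \<phi>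
  proof (intro ext)
    fix i p show "\<pi> \<phi> i p = \<phi> i p" using diag_carrierD[OF that, of i p] by (auto simp: \<pi>_def)
  qed
  have kernel: "a_kernel ?DP ?Dt \<pi> = carrier ?DQ"
  proof (intro equalityI subsetI)
    fix \<phi> assume "\<phi> \<in> a_kernel ?DP ?Dt \<pi>"
    hence \<phi>: "\<phi> \<in> carrier ?DP" "\<pi> \<phi> = (\<lambda>i p. 0)" by (auto simp: in_a_kernel)
    have "\<pi>' \<phi> = \<phi>"
    proof (intro ext)
      fix i p show "\<pi>' \<phi> i p = \<phi> i p" using fun_cong[OF fun_cong[OF \<phi>(2), of i], of p] by (auto simp: \<pi>_def \<pi>'_def)
    qed
    thus "\<phi> \<in> carrier ?DQ" using \<pi>c(2)[OF \<phi>(1)] by simp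
  next
    fix \<phi> assume \<phi>: "\<phi> \<in> carrier ?DQ"
    have "\<phi> i (t, t) = 0" for i using diag_carrierD[OF \<phi>, of i "(t, t)"] by auto
    hence "\<pi> \<phi> = (\<lambda>i p. 0)" by (auto simp: \<pi>_def fun_eq_iff)
    thus "\<phi> \<in> a_kernel ?DP ?Dt \<pi>" using graded_hom_closed[OF inc[OF sub(1)] \<phi>] by (simp add: in_a_kernel)
  qed
  have DQ: "?DP\<lparr>carrier := carrier ?DQ\<rparr> = ?DQ" by (simp add: diag_module_def)
  have gQ: "(\<lambda>n. diag_grading P n \<inter> carrier ?DQ) = diag_grading Q"
    using graded_hom_closed[OF inc[OF sub(1)]] by (auto simp: diag_grading_def diag_carrier_iff fun_eq_iff)
  have to_Q: "\<exists>(M :: nat \<Rightarrow> ('a, 'k) inc_module) G d \<epsilon>.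
      linear_resolution ?A Cmp ?DQ (diag_grading Q) M G d \<epsilon>"
    if M: "linear_resolution ?A Cmp ?DP (diag_grading P) M H e \<epsilon>"
    for M :: "nat \<Rightarrow> ('a, 'k) inc_module" and H e \<epsilon>
    using linear_resolution_summand[OF incidence_connected one diag_graded_module[OF subset_refl]
        diag_graded_module[OF sub(2)] \<pi> inc[OF sub(2)] \<pi>_id M L] unfolding kernel DQ gQ by blast
  have to_P: "\<exists>(M :: nat \<Rightarrow> ('a, 'k) inc_module) G d \<epsilon>.
      linear_resolution ?A Cmp ?DP (diag_grading P) M G d \<epsilon>"
    if M: "linear_resolution ?A Cmp ?DQ (diag_grading Q) M H e \<epsilon>"
    for M :: "nat \<Rightarrow> ('a, 'k) inc_module" and H e \<epsilon>
  proof (rule linear_resolution_direct_sum[OF diag_left_module[OF sub(1)] diag_left_module[OF sub(2)]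
        diag_left_module[OF subset_refl] inc[OF sub(1)] inc[OF sub(2)] _ _ _ M L])
    show "\<exists>\<psi>\<in>carrier ?DQ. \<exists>\<chi>\<in>carrier ?Dt. \<phi> = \<psi> \<oplus>\<^bsub>?DP\<^esub> \<chi>" if "\<phi> \<in> carrier ?DP" for \<phi>
      using \<pi>c[OF that] by (intro bexI[of _ "\<pi>' \<phi>"] bexI[of _ "\<pi> \<phi>"]) (auto simp: \<pi>_def \<pi>'_def fun_eq_iff)
    show "\<psi> = \<zero>\<^bsub>?DQ\<^esub> \<and> \<chi> = \<zero>\<^bsub>?Dt\<^esub>"
      if \<psi>: "\<psi> \<in> carrier ?DQ" and \<chi>: "\<chi> \<in> carrier ?Dt" and 0: "\<psi> \<oplus>\<^bsub>?DP\<^esub> \<chi> = \<zero>\<^bsub>?DP\<^esub>" for \<psi> \<chi>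
    proof -
      have "\<psi> i p = 0 \<and> \<chi> i p = 0" for i p
        using fun_cong[OF fun_cong[OF 0, of i], of p] diag_carrierD[OF \<psi>, of i p] diag_carrierD[OF \<chi>, of i p]
        by (cases "\<psi> i p = 0"; cases "\<chi> i p = 0") auto
      thus ?thesis by (auto simp: fun_eq_iff)
    qed
    show "subgroup (diag_grading P n) (add_monoid ?DP)" for n
      by (rule grade_subgroup[OF graded_moduleD(2,3)[OF diag_graded_module[OF subset_refl]]])
  qed
  have "corner.unital ?DQ"
    unfolding corner.unital_def
  proof
    fix \<phi> assume \<phi>: "\<phi> \<in> carrier ?DQ"
    have "\<one>\<^bsub>?B\<^esub> p * \<phi> i p = \<phi> i p" for i p
      using diag_carrierD[OF \<phi>, of i p] by (cases "\<phi> i p = 0") (auto simp: Q.incidence_one)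
    thus "\<one>\<^bsub>?B\<^esub> \<odot>\<^bsub>?DQ\<^esub> \<phi> = \<phi>" by (simp only: diag_simps)
  qed
  note base = corner.linear_resolution_inflate[OF _ diag_left_module[OF sub(1)] this]
    corner.linear_resolution_restrict[OF _ diag_left_module[OF sub(1)] this]
  show ?thesis
    unfolding koszul_iff_linear_resolution Q.koszul_iff_linear_resolution
  proof (intro iffI; elim exE)
    fix M :: "nat \<Rightarrow> ('a, 'k) inc_module" and G d \<epsilon>
    assume "linear_resolution ?A Cmp ?DP (diag_grading P) M G d \<epsilon>"
    from to_Q[OF this] show "\<exists>(M :: nat \<Rightarrow> ('a, 'k) inc_module) G d \<epsilon>.
        linear_resolution ?B Q.Cmp ?DQ (diag_grading Q) M G d \<epsilon>"
      by (elim exE) (intro exI, rule base(2))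
  next
    fix M :: "nat \<Rightarrow> ('a, 'k) inc_module" and G d \<epsilon>
    assume "linear_resolution ?B Q.Cmp ?DQ (diag_grading Q) M G d \<epsilon>"
    from to_P[OF base(1)[OF this]] show "\<exists>(M :: nat \<Rightarrow> ('a, 'k) inc_module) G d \<epsilon>.
        linear_resolution ?A Cmp ?DP (diag_grading P) M G d \<epsilon>" .
  qed
qed

end

theorem theorem2p8:
  fixes P :: "'a set" and r :: "'a rel" and t :: 'a
  assumes "graded_poset P r"
    and "maximal_in P r t"
    and "dagger P r {u. (u, t) \<in> covering r}"
  shows "koszul_ring (incidence_ring P r :: ('a \<times> 'a \<Rightarrow> 'k :: field) ring)
           (incidence_diag P) (incidence_component r) \<longleftrightarrow>
         koszul_ring (incidence_ring (P - {t}) (Restr r (P - {t})) :: ('a \<times> 'a \<Rightarrow> 'k) ring)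
           (incidence_diag (P - {t})) (incidence_component (Restr r (P - {t})))"
proof -
  interpret poset_with_maximal P r "TYPE('k)" t using assms by unfold_locales
  show ?thesis by (rule koszul_iff)
qed

end
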